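(* Let $g\ge 2$ and let $\mathcal F$ be a canonical fundamental $(8g-4)$-gon for a Fuchsian group $\Gamma$ with $S=\Gamma\backslash\mathbb D$ a closed surface of genus $g$. For every multi-parameter $\bar A=\{A_1,\dots,A_{8g-4}\}$ with $A_k\in[P_k,Q_k]$ for each $k$, the boundary map $f_{\bar A}:\mathbb S\to\mathbb S$ has topological entropy \[ h_{\mathrm{top}}(f_{\bar A})=\log\!\big(4g-3+\sqrt{(4g-3)^2-1}\big). \]
   Context: $\mathbb D$ is the unit disk with the hyperbolic metric $2|dz|/(1-|z|^2)$ and $\mathbb S=\partial\mathbb D$. A fundamental $(8g-4)$-gon $\mathcal F$ for $\Gamma$ has sides labelled $1,\dots,8g-4$ counterclockwise, side $k$ joining vertices $V_k$ and $V_{k+1}$ (indices mod $8g-4$). The side pairing is $\sigma(k)=4g-k \bmod (8g-4)$ if $k$ is odd and $\sigma(k)=2-k\bmod(8g-4)$ if $k$ is even; $T_k\in\Gamma$ is the Möbius transformation mapping side $k$ onto side $\sigma(k)$, and $\Gamma$ is generated by $T_1,\dots,T_{8g-4}$. The polygon is canonical if sides $k$ and $\sigma(k)$ have equal length and the angles at vertices $V_k$ and $V_{\sigma(k)+1}$ sum to $\pi$ (such polygons exist for every closed genus-$g$ hyperbolic surface, obtained by cutting along $2g$ closed geodesics). $P_k$ and $Q_{k+1}$ denote the initial and terminal endpoints on $\mathbb S$ of the oriented complete geodesic extending side $k$; the counterclockwise order on $\mathbb S$ is $P_1,Q_1,P_2,Q_2,\dots,P_{8g-4},Q_{8g-4}$,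 and $[P_k,Q_k]$ denotes the counterclockwise arc. For $\bar A=\{A_k\}$ with $A_k\in[P_k,Q_k]$, the boundary map is $f_{\bar A}(x)=T_k(x)$ for $x\in[A_k,A_{k+1})$. Topological entropy for such piecewise continuous, piecewise monotone circle maps is in the sense of Bowen (separated sets). *)

theory Defs
  imports "HOL-Analysis.Analysis"
begin

definition disk :: "complex set" where "disk = ball 0 1"

definition circ :: "complex set" where "circ = sphere 0 1"

text \<open>Hyperbolic distance for the metric 2|dz|/(1-|z|^2).\<close>
definition hdist :: "complex \<Rightarrow> complex \<Rightarrow> real" where
  "hdist z w = (let r = cmod ((z - w) / (1 - cnj w * z)) in ln ((1 + r) / (1 - r)))"

definition phi :: "complex \<Rightarrow> complex \<Rightarrow> complex" where
  "phi p z = (z - p) / (1 - cnj p * z)"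

definition phi_inv :: "complex \<Rightarrow> complex \<Rightarrow> complex" where
  "phi_inv p w = (w + p) / (1 + cnj p * w)"

definition mob :: "complex \<Rightarrow> complex \<Rightarrow> complex \<Rightarrow> complex" where
  "mob a b z = (a * z + b) / (cnj b * z + cnj a)"

definition disk_aut_params :: "complex \<Rightarrow> complex \<Rightarrow> bool" where
  "disk_aut_params a b \<longleftrightarrow> (cmod a)\<^sup>2 - (cmod b)\<^sup>2 = 1"

definition hseg :: "complex \<Rightarrow> complex \<Rightarrow> complex set" where
  "hseg p q = {z \<in> disk. hdist p z + hdist z q = hdist p q}"

text \<open>z lies in the closed half-plane to the left of the oriented complete
  geodesic through p and q (in this order).\<close>
definition left_of :: "complex \<Rightarrow> complex \<Rightarrow> complex \<Rightarrow> bool" where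
  "left_of p q z \<longleftrightarrow> Im (phi p z * cnj (phi p q)) \<ge> 0"

definition strictly_left_of :: "complex \<Rightarrow> complex \<Rightarrow> complex \<Rightarrow> bool" where
  "strictly_left_of p q z \<longleftrightarrow> Im (phi p z * cnj (phi p q)) > 0"

text \<open>Interior angle at vertex p of the polygon with previous vertex r and next vertex q
  (counterclockwise orientation): the angle from the tangent direction towards q to the
  tangent direction towards r.\<close>
definition hangle :: "complex \<Rightarrow> complex \<Rightarrow> complex \<Rightarrow> real" where
  "hangle r p q = Arg (phi p r / phi p q)"

text \<open>Endpoints on the circle of the oriented complete geodesic through p then q:
  initial (backward) and terminal (forward) endpoint.\<close>
definition geo_start :: "complex \<Rightarrow> complex \<Rightarrow> complex" where
  "geo_start p q = phi_inv p (- sgn (phi p q))"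

definition geo_end :: "complex \<Rightarrow> complex \<Rightarrow> complex" where
  "geo_end p q = phi_inv p (sgn (phi p q))"

definition ccw_angle :: "complex \<Rightarrow> complex \<Rightarrow> real" where
  "ccw_angle a b = (if Arg (b / a) < 0 then Arg (b / a) + 2 * pi else Arg (b / a))"

definition ccw_arc :: "complex \<Rightarrow> complex \<Rightarrow> complex set" where
  "ccw_arc a b = {a * cis t | t. 0 \<le> t \<and> t \<le> ccw_angle a b}"

definition ccw_arc_ho :: "complex \<Rightarrow> complex \<Rightarrow> complex set" where
  "ccw_arc_ho a b = {a * cis t | t. 0 \<le> t \<and> t < ccw_angle a b}"

text \<open>Labels are integers, all data are n-periodic; label k stands for its residue
  (label n corresponds to residue 0).\<close>
definition sigma :: "nat \<Rightarrow> int \<Rightarrow> int" where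
  "sigma g k = (let n = 8 * int g - 4 in
     if odd k then (4 * int g - k) mod n else (2 - k) mod n)"

definition side :: "(int \<Rightarrow> complex) \<Rightarrow> int \<Rightarrow> complex set" where
  "side V k = hseg (V k) (V (k + 1))"

definition convex_ccw_polygon :: "int \<Rightarrow> (int \<Rightarrow> complex) \<Rightarrow> bool" where
  "convex_ccw_polygon n V \<longleftrightarrow>
     (\<forall>k. V (k + n) = V k) \<and> (\<forall>k. V k \<in> disk) \<and>
     (\<forall>k j. j mod n \<noteq> k mod n \<and> j mod n \<noteq> (k + 1) mod n \<longrightarrow>
        strictly_left_of (V k) (V (k + 1)) (V j))"

definition polygon :: "int \<Rightarrow> (int \<Rightarrow> complex) \<Rightarrow> complex set" where
  "polygon n V = {z \<in> disk. \<forall>k. left_of (V k) (V (k + 1)) z}"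

text \<open>The group generated by the transformations T k = mob (a k) (b k) (as maps of the plane;
  the inverse of mob a b is mob (cnj a) (- b)).\<close>
inductive_set gen_group :: "(int \<Rightarrow> complex) \<Rightarrow> (int \<Rightarrow> complex) \<Rightarrow> (complex \<Rightarrow> complex) set"
  for a b where
  gen_id: "id \<in> gen_group a b"
| gen_T: "f \<in> gen_group a b \<Longrightarrow> mob (a k) (b k) \<circ> f \<in> gen_group a b"
| gen_Tinv: "f \<in> gen_group a b \<Longrightarrow> mob (cnj (a k)) (- b k) \<circ> f \<in> gen_group a b"

text \<open>Fuchsian group (discrete, i.e. acting properly discontinuously on the disk).\<close>
definition fuchsian :: "(complex \<Rightarrow> complex) set \<Rightarrow> bool" where
  "fuchsian G \<longleftrightarrow>
     (\<forall>K. compact K \<and> K \<subseteq> disk \<longrightarrow>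
        finite {restrict \<gamma> disk | \<gamma>. \<gamma> \<in> G \<and> \<gamma> ` K \<inter> K \<noteq> {}})"

text \<open>Acting freely on the disk (torsion free), so that the quotient is a surface.\<close>
definition acts_freely :: "(complex \<Rightarrow> complex) set \<Rightarrow> bool" where
  "acts_freely G \<longleftrightarrow> (\<forall>\<gamma>\<in>G. (\<exists>z\<in>disk. \<gamma> z = z) \<longrightarrow> (\<forall>w\<in>disk. \<gamma> w = w))"

definition fundamental_domain :: "(complex \<Rightarrow> complex) set \<Rightarrow> complex set \<Rightarrow> bool" where
  "fundamental_domain G F \<longleftrightarrow>
     (\<Union>\<gamma>\<in>G. \<gamma> ` F) = disk \<and>
     (\<forall>\<gamma>1\<in>G. \<forall>\<gamma>2\<in>G. (\<exists>z\<in>disk. \<gamma>1 z \<noteq> \<gamma>2 z) \<longrightarrow>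
        interior (\<gamma>1 ` F) \<inter> interior (\<gamma>2 ` F) = {})"

definition canonical_polygon_setup ::
  "nat \<Rightarrow> (int \<Rightarrow> complex) \<Rightarrow> (int \<Rightarrow> complex) \<Rightarrow> (int \<Rightarrow> complex) \<Rightarrow> bool" where
  "canonical_polygon_setup g V a b \<longleftrightarrow>
     (let n = 8 * int g - 4; G = gen_group a b in
       convex_ccw_polygon n V \<and>
       (\<forall>k. a (k + n) = a k \<and> b (k + n) = b k) \<and>
       (\<forall>k. disk_aut_params (a k) (b k)) \<and>
       (\<forall>k. mob (a k) (b k) ` side V k = side V (sigma g k)) \<and>
       fuchsian G \<and> acts_freely G \<and> fundamental_domain G (polygon n V) \<and>
       (\<forall>k. hdist (V k) (V (k + 1)) = hdist (V (sigma g k)) (V (sigma g k + 1))) \<and>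
       (\<forall>k. hangle (V (k - 1)) (V k) (V (k + 1)) +
            hangle (V (sigma g k)) (V (sigma g k + 1)) (V (sigma g k + 2)) = pi))"

definition Pend :: "(int \<Rightarrow> complex) \<Rightarrow> int \<Rightarrow> complex" where
  "Pend V k = geo_start (V k) (V (k + 1))"

definition Qend :: "(int \<Rightarrow> complex) \<Rightarrow> int \<Rightarrow> complex" where
  "Qend V k = geo_end (V (k - 1)) (V k)"

definition boundary_map ::
  "(int \<Rightarrow> complex) \<Rightarrow> (int \<Rightarrow> complex) \<Rightarrow> (int \<Rightarrow> complex) \<Rightarrow> complex \<Rightarrow> complex" where
  "boundary_map a b A x =
     (let k = (SOME k. x \<in> ccw_arc_ho (A k) (A (k + 1))) in mob (a k) (b k) x)"

definition separated :: "('a::metric_space \<Rightarrow> 'a) \<Rightarrow> 'a set \<Rightarrow> nat \<Rightarrow> real \<Rightarrow> 'a set \<Rightarrow> bool" where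
  "separated f X m \<epsilon> E \<longleftrightarrow> E \<subseteq> X \<and> finite E \<and>
     (\<forall>x\<in>E. \<forall>y\<in>E. x \<noteq> y \<longrightarrow> (\<exists>i<m. dist ((f ^^ i) x) ((f ^^ i) y) > \<epsilon>))"

definition max_separated :: "('a::metric_space \<Rightarrow> 'a) \<Rightarrow> 'a set \<Rightarrow> nat \<Rightarrow> real \<Rightarrow> ereal" where
  "max_separated f X m \<epsilon> = (SUP E \<in> {E. separated f X m \<epsilon> E}. ereal (real (card E)))"

text \<open>h(f) = lim_{eps->0} limsup_m (1/m) log s(m,eps); the limit in eps is monotone,
  hence equal to the supremum over eps > 0.\<close>
definition top_entropy :: "('a::metric_space \<Rightarrow> 'a) \<Rightarrow> 'a set \<Rightarrow> ereal" where
  "top_entropy f X = (SUP \<epsilon> \<in> {0<..}.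
     limsup (\<lambda>m. if max_separated f X m \<epsilon> = \<infinity> then \<infinity>
                  else ereal (ln (real_of_ereal (max_separated f X m \<epsilon>)) / real m)))"

end

theory Submission
  imports Defs
begin

text \<open>
  Let \<open>\<lambda> = 4g - 3 + sqrt ((4g - 3)\<^sup>2 - 1)\<close> and \<open>n = 8g - 4\<close>, so that
  \<open>\<lambda>\<^sup>2 - (n - 2) \<lambda> + 1 = 0\<close>. The points \<open>P\<^sub>k, Q\<^sub>k\<close> form a Markov partition for the map with
  \<open>A\<^sub>k = P\<^sub>k\<close>, whose transition matrix has the explicit eigenvector giving weight \<open>1\<close> to each arc
  \<open>[P\<^sub>k, Q\<^sub>k]\<close> and \<open>\<lambda> - 1\<close> to each arc \<open>[Q\<^sub>k, P\<^bsub>k+1\<^esub>]\<close>. It yields a measure that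
  \<open>T\<^sub>k\<close> stretches by the factor \<open>\<lambda>\<close> on \<open>[P\<^sub>k, P\<^bsub>k+1\<^esub>]\<close>; the relation between the four tiles at a
  vertex extends this to the whole arc \<open>[P\<^sub>k, Q\<^bsub>k+1\<^esub>]\<close> on which \<open>T\<^sub>k\<close> may be used. Hence, whatever the
  parameters are, the number of itineraries of length \<open>m\<close> is \<open>\<lambda>\<^sup>m\<close> up to a constant factor. It bounds
  separated sets from above up to a factor linear in \<open>m\<close>, because branches are monotone, and from below
  because the map is discontinuous at every \<open>A\<^sub>k\<close>.

  The order of the points \<open>P\<^sub>k, Q\<^sub>k\<close> requires that the geodesics extending sides \<open>k - 1\<close> and \<open>k + 1\<close> do not meet.
  If they meet beyond side \<open>k\<close>, then \<open>T\<^sub>k\<close> maps the meeting point to one lying on the inner side of side \<open>\<sigma>(k)\<close>,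
  so that the polygon lies in a triangle with base \<open>\<sigma>(k)\<close>. But then for all other sides \<open>j\<close>, except the two neighbours of
  \<open>\<sigma>(k)\<close>, the adjacent sides meet beyond \<open>j\<close>, and applying this to both \<open>j\<close> and \<open>\<sigma>(j)\<close> gives a contradiction.
\<close>

text \<open>For general parameters the orbits of the break points are uncontrolled, so no finite
  transition matrix is at hand. What survives is the function \<open>psi\<close>: every branch
  multiplies its increments by \<open>lam\<close> wherever that branch can be used. Counting
  itineraries needs only this, monotonicity, the values of \<open>psi\<close> at the partition
  points and its increase \<open>n * lam\<close> over one turn; neither continuity nor strict growth
  of \<open>psi\<close> is required. The circle has no linear order, so everything is lifted: labels
  are integers instead of residues and each side pairing becomes an increasing function
  \<open>tau k\<close> of degree one. Cyclic statements turn into inequalities, at the price of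
  bookkeeping with multiples of \<open>n\<close> and \<open>2 * pi\<close>. The geometry has to
  supply the order of the ideal endpoints, their images under the side pairings and one relation per
  vertex. In Minkowski coordinates incidence and sidedness are signs of 3 by 3 determinants. Angles
  enter only through supplementary pairs, which make a side pairing carry the neighbours of a side
  into lines extending other sides.\<close>

section \<open>Coding the lifted boundary map\<close>

text \<open>An unreduced representative of \<open>sigma g k\<close>, so that it can index lifts to the real line.\<close>
definition pairing :: "nat \<Rightarrow> int \<Rightarrow> int" where
  "pairing g k = (if odd k then 4 * int g - k else 2 - k)"

text \<open>Stated over rings so that one induction serves integer-indexed families, functions of a
  real variable and, with \<open>c = 0\<close>, plain periodicity of vertices and
  coefficients.\<close>

lemma quasi_periodic_int:
  fixes F :: "'a::comm_ring_1 \<Rightarrow> 'b::comm_ring_1"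
  assumes "\<And>x. F (x + d) = F x + c"
  shows "F (x + of_int j * d) = F x + of_int j * c"
proof -
  have nat: "F (x + of_nat i * d) = F x + of_nat i * c" for x i
  proof (induction i)
    case (Suc i)
    then show ?case using assms[of "x + of_nat i * d"] by (simp add: algebra_simps)
  qed simp
  show ?thesis
  proof (cases j rule: int_cases2)
    case (nonneg i)
    then show ?thesis using nat by simp
  next
    case (nonpos i)
    then show ?thesis using nat[of "x + of_int j * d" i] by (simp add: algebra_simps)
  qed
qed

lemma periodic_partition_index:
  fixes b :: "int \<Rightarrow> real"
  assumes step: "\<And>k. b k < b (k + 1)" and per: "\<And>k. b (k + n) = b k + L"
    and "n > 0" "L > 0"
  shows "\<exists>k. b k \<le> t \<and> t < b (k + 1)"
proof -
  have *: "\<exists>k. b k \<le> t \<and> t < b (k + 1)" if "b c \<le> t" "t < b (c + int m)" for c m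
    using that
  proof (induction m)
    case (Suc m)
    show ?case
    proof (cases "t < b (c + int m)")
      case False
      then show ?thesis using Suc.prems
        by (intro exI[of _ "c + int m"]) (auto simp: algebra_simps)
    qed (use Suc in auto)
  qed auto
  have mult: "b (j * n) = b 0 + of_int j * L" for j
    using quasi_periodic_int[of b n L 0 j, OF per] by simp
  define j where "j = \<lfloor>(t - b 0) / L\<rfloor>"
  have "of_int j \<le> (t - b 0) / L" "(t - b 0) / L < of_int j + 1"
    unfolding j_def by linarith+
  then have "b (j * n) \<le> t" "t < b ((j + 1) * n)"
    unfolding mult using \<open>L > 0\<close> by (auto simp: field_simps)
  then show ?thesis
    using *[of "j * n" "nat n"] \<open>n > 0\<close> by (simp add: algebra_simps)
qed

lemma step_imp_mono_int:
  fixes b :: "int \<Rightarrow> real"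
  assumes step: "\<And>k. b k < b (k + 1)" and "k < l"
  shows "b k < b l"
  using \<open>k < l\<close>
proof (induction l rule: int_gr_induct)
  case base
  then show ?case using step by simp
next
  case (step i)
  then show ?case using assms(1)[of i] by simp
qed

lemma step_imp_mono_int_iff:
  fixes b :: "int \<Rightarrow> real"
  assumes step: "\<And>k. b k < b (k + 1)"
  shows "b k < b l \<longleftrightarrow> k < l" "b k \<le> b l \<longleftrightarrow> k \<le> l"
  using step_imp_mono_int[of b, OF step, of k l] step_imp_mono_int[of b, OF step, of l k]
  by (cases k l rule: linorder_cases; auto)+

text \<open>The interface to the geometry. The offsets \<open>+ n\<close> in \<open>tau_p'\<close>
  and \<open>tau_q'\<close> put the images of \<open>p k\<close>, \<open>q k\<close>,
  \<open>p (k + 1)\<close>, \<open>q (k + 1)\<close> in increasing order within one turn. The shift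
  in \<open>tau_per\<close> is \<open>4 * pi\<close> because raising \<open>k\<close> by
  \<open>n\<close> lowers \<open>pairing g k\<close> by \<open>n\<close>: the argument
  \<open>p k\<close> moves one turn forward while its image moves one turn back.\<close>

locale lifted_boundary_map =
  fixes g :: nat and n :: int and p q al :: "int \<Rightarrow> real" and tau :: "int \<Rightarrow> real \<Rightarrow> real"
    and f :: "complex \<Rightarrow> complex"
  assumes g2: "g \<ge> 2" and n_eq: "n = 8 * int g - 4"
    and p_less_q: "p k < q k" and q_less_p: "q k < p (k + 1)"
    and p_per: "p (k + n) = p k + 2 * pi"
    and q_per: "q (k + n) = q k + 2 * pi"
    and al_ge: "p k \<le> al k" and al_le: "al k \<le> q k"
    and al_per: "al (k + n) = al k + 2 * pi"
    and tau_mono: "strict_mono (tau k)" and tau_surj: "surj (tau k)"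
    and tau_cont: "continuous_on UNIV (tau k)"
    and tau_deg: "tau k (t + 2 * pi) = tau k t + 2 * pi"
    and tau_per: "tau (k + n) t = tau k t - 4 * pi"
    and tau_p: "tau k (p k) = q (pairing g k + 1)"
    and tau_q: "tau k (q k) = q (pairing g k + 2)"
    and tau_p': "tau k (p (k + 1)) = p (pairing g k - 1 + n)"
    and tau_q': "tau k (q (k + 1)) = p (pairing g k + n)"
    and tau_comm: "\<exists>c. \<forall>t. tau (pairing g (k - 1) - 1) (tau (k - 1) t)
                       = tau (pairing g k + 1) (tau k t) + 2 * pi * of_int c"
    and f_tau: "al k \<le> t \<Longrightarrow> t < al (k + 1) \<Longrightarrow> f (cis t) = cis (tau k t)"
begin

abbreviation s :: "int \<Rightarrow> int" where "s \<equiv> pairing g"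
definition lam :: real where "lam = 4 * real g - 3 + sqrt ((4 * real g - 3)\<^sup>2 - 1)"

lemma n_ge: "n \<ge> 12" using g2 n_eq by simp

lemma lam_gt: "lam > 5"
proof -
  have "real g \<ge> 2" using g2 by simp
  then have "(4 * real g - 3)\<^sup>2 > 1" by (intro one_less_power) auto
  then have "sqrt ((4 * real g - 3)\<^sup>2 - 1) > 0" by simp
  then show ?thesis using \<open>real g \<ge> 2\<close> unfolding lam_def by linarith
qed

text \<open>The left side is the weight from \<open>q (s k + 1)\<close> to
  \<open>p (s k - 1 + n)\<close>, the image under \<open>tau k\<close> of the interval from
  \<open>p k\<close> to \<open>p (k + 1)\<close> of weight \<open>lam\<close>. Stretching by
  \<open>lam\<close> demands exactly this equation.\<close>

lemma lam_sq: "(of_int n - 2) * lam - 1 = lam * lam"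
proof -
  have "(4 * real g - 3)\<^sup>2 \<ge> 1" using g2 by (intro one_le_power) auto
  then have "(lam - (4 * real g - 3))\<^sup>2 = (4 * real g - 3)\<^sup>2 - 1"
    unfolding lam_def by simp
  then show ?thesis by (simp add: power2_eq_square algebra_simps n_eq)
qed

lemma p_step: "p k < p (k + 1)" and q_step: "q k < q (k + 1)" and al_step: "al k < al (k + 1)"
  using p_less_q[of k] q_less_p[of k] p_less_q[of "k + 1"] al_ge[of "k+1"] al_le[of k] by linarith+

lemmas p_iff = step_imp_mono_int_iff[of p, OF p_step]
lemmas q_iff = step_imp_mono_int_iff[of q, OF q_step]
lemmas al_iff = step_imp_mono_int_iff[of al, OF al_step]

lemma tau_less_iff [simp]: "tau k t < tau k t' \<longleftrightarrow> t < t'"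
  and tau_le_iff [simp]: "tau k t \<le> tau k t' \<longleftrightarrow> t \<le> t'"
  using tau_mono strict_mono_less strict_mono_less_eq by blast+

section \<open>The measure stretched by the factor \<open>lam\<close>\<close>

definition idx :: "real \<Rightarrow> int" where "idx t = (THE k. p k \<le> t \<and> t < p (k + 1))"

lemma idx_unique:
  assumes "p k \<le> t" "t < p (k + 1)" shows "idx t = k"
  unfolding idx_def
proof (rule the_equality)
  fix l assume l: "p l \<le> t \<and> t < p (l + 1)"
  then have "p l < p (k + 1)" "p k < p (l + 1)" using assms by linarith+
  then show "l = k" unfolding p_iff by simp
qed (use assms in auto)

lemma idx: "p (idx t) \<le> t" "t < p (idx t + 1)"
proof -
  obtain k where k: "p k \<le> t" "t < p (k + 1)"
    using periodic_partition_index[of p n "2 * pi" t, OF p_step p_per] n_ge by auto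
  then show "p (idx t) \<le> t" "t < p (idx t + 1)" using idx_unique[OF k] by simp_all
qed

lemma idx_shift: "idx (t + 2 * pi) = idx t + n"
  using idx[of t] p_per[of "idx t"] p_per[of "idx t + 1"]
  by (intro idx_unique) (auto simp: algebra_simps)

lemma idx_p: "idx (p k) = k" and idx_q: "idx (q k) = k"
  using p_step p_less_q[of k] q_less_p by (intro idx_unique; simp add: less_imp_le)+

lemma pairing_per: "s (k + n) = s k - n"
  by (auto simp: pairing_def n_eq)

text \<open>The limit \<open>psi\<close> is the distribution function of the lifted measure; its values at \<open>p k\<close> and \<open>q k\<close>
  come from the eigenvector of the transition matrix and are the same for all iterates.\<close>
primrec psi_seq :: "nat \<Rightarrow> real \<Rightarrow> real" where
  "psi_seq 0 t = idx t * lam + (if t \<ge> q (idx t) then 1 else 0)"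
| "psi_seq (Suc m) t =
     idx t * lam + (psi_seq m (tau (idx t) t) - ((s (idx t) + 1) * lam + 1)) / lam"

text \<open>\<open>tau k\<close> sends \<open>p k\<close> and \<open>q k\<close> to the consecutive
  points \<open>q (s k + 1)\<close> and \<open>q (s k + 2)\<close>, whose values differ by
  \<open>lam\<close>; division by \<open>lam\<close> gives back the weight 1.\<close>

lemma psi_seq_p: "psi_seq m (p k) = k * lam"
  and psi_seq_q: "psi_seq m (q k) = k * lam + 1"
proof (induction m arbitrary: k)
  case 0
  { case 1 show ?case using p_less_q[of k] by (simp add: idx_p) }
  { case 2 show ?case by (simp add: idx_q) }
next
  case (Suc m)
  { case 1 show ?case using Suc by (simp add: idx_p tau_p) }
  { case 2 show ?case using Suc lam_gt by (simp add: idx_q tau_q algebra_simps) }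
qed

lemma psi_seq_shift: "psi_seq m (t + 2 * pi) = psi_seq m t + n * lam"
proof (induction m arbitrary: t)
  case 0
  show ?case unfolding psi_seq.simps idx_shift q_per by (simp add: algebra_simps)
next
  case (Suc m)
  have "tau (idx t + n) (t + 2 * pi) = tau (idx t) t - 2 * pi"
    by (simp add: tau_per tau_deg)
  then have e: "psi_seq m (tau (idx t + n) (t + 2 * pi)) = psi_seq m (tau (idx t) t) - n * lam"
    using Suc[of "tau (idx t) t - 2 * pi"] by simp
  show ?case unfolding psi_seq.simps idx_shift e pairing_per using lam_gt by (simp add: field_simps)
qed

text \<open>Within one piece monotonicity is inherited through \<open>tau\<close>. Across pieces it
  suffices that on piece \<open>k\<close> an iterate stays between \<open>k * lam\<close> and
  \<open>(k + 1) * lam\<close>; the upper bound rests on \<open>lam_sq\<close>.\<close>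

lemma psi_seq_mono: "t \<le> t' \<Longrightarrow> psi_seq m t \<le> psi_seq m t'"
proof (induction m arbitrary: t t')
  case 0
  have le: "idx t \<le> idx t'"
  proof -
    have "p (idx t) < p (idx t' + 1)" using idx(1)[of t] idx(2)[of t'] 0 by linarith
    then show ?thesis unfolding p_iff by simp
  qed
  show ?case
  proof (cases "idx t = idx t'")
    case True
    then show ?thesis using 0 by auto
  next
    case False
    then have "of_int (idx t) + 1 \<le> (of_int (idx t') :: real)" using le by linarith
    then have "(of_int (idx t) + 1) * lam \<le> of_int (idx t') * lam"
      using lam_gt by (intro mult_right_mono) auto
    moreover have "(of_int (idx t) + 1) * lam = of_int (idx t) * lam + lam"
      by (simp add: algebra_simps)
    ultimately show ?thesis using lam_gt by (simp only: psi_seq.simps split: if_split) linarith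
  qed
next
  case (Suc m)
  have le: "idx t \<le> idx t'"
  proof -
    have "p (idx t) < p (idx t' + 1)" using idx(1)[of t] idx(2)[of t'] Suc by linarith
    then show ?thesis unfolding p_iff by simp
  qed
  have lo: "idx t' * lam \<le> psi_seq (Suc m) t'"
  proof -
    have "psi_seq m (tau (idx t') (p (idx t'))) \<le> psi_seq m (tau (idx t') t')"
      using idx by (intro Suc.IH) simp
    then show ?thesis using lam_gt by (simp add: tau_p psi_seq_q)
  qed
  have hi: "psi_seq (Suc m) t \<le> (idx t + 1) * lam"
  proof -
    have "psi_seq m (tau (idx t) t) \<le> psi_seq m (tau (idx t) (p (idx t + 1)))"
      using idx[of t] by (intro Suc.IH) simp
    then have "psi_seq m (tau (idx t) t) - ((s (idx t) + 1) * lam + 1) \<le> lam * lam"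
      unfolding tau_p' psi_seq_p lam_sq[symmetric] by (simp add: algebra_simps)
    then have "(psi_seq m (tau (idx t) t) - ((s (idx t) + 1) * lam + 1)) / lam \<le> lam"
      using lam_gt by (simp add: field_simps)
    then show ?thesis by (simp add: algebra_simps)
  qed
  show ?case
  proof (cases "idx t = idx t'")
    case True
    have "psi_seq m (tau (idx t) t) \<le> psi_seq m (tau (idx t) t')"
      using Suc by simp
    then show ?thesis using True lam_gt by (simp add: divide_right_mono)
  next
    case False
    then have "of_int (idx t) + 1 \<le> (of_int (idx t') :: real)" using le by linarith
    then have "(of_int (idx t) + 1) * lam \<le> of_int (idx t') * lam"
      using lam_gt by (intro mult_right_mono) auto
    then show ?thesis using lo hi by simp
  qed
qed

text \<open>Each pullback divides the difference of consecutive iterates by \<open>lam\<close>. The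
  first two differ by at most \<open>lam\<close>, as both lie between the common values at the ends
  of the piece.\<close>

lemma psi_seq_diff: "\<bar>psi_seq (Suc m) t - psi_seq m t\<bar> \<le> lam * (1 / lam) ^ m"
proof (induction m arbitrary: t)
  case 0
  let ?k = "idx t"
  have "psi_seq j t \<in> {?k * lam .. ?k * lam + lam}" for j
    using psi_seq_mono[OF idx(1)[of t], of j] psi_seq_mono[OF less_imp_le[OF idx(2)[of t]], of j]
    by (simp add: psi_seq_p algebra_simps del: psi_seq.simps)
  from this[of 0] this[of 1] show ?case by (auto simp del: psi_seq.simps)
next
  case (Suc m)
  let ?r = "tau (idx t) t"
  have "psi_seq (Suc (Suc m)) t - psi_seq (Suc m) t = (psi_seq (Suc m) ?r - psi_seq m ?r) / lam"
    by (simp add: diff_divide_distrib)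
  then have "\<bar>psi_seq (Suc (Suc m)) t - psi_seq (Suc m) t\<bar> = \<bar>psi_seq (Suc m) ?r - psi_seq m ?r\<bar> / lam"
    using lam_gt by (simp del: psi_seq.simps)
  also have "\<dots> \<le> lam * (1 / lam) ^ m / lam"
    using Suc lam_gt by (intro divide_right_mono) auto
  finally show ?case by simp
qed

definition psi :: "real \<Rightarrow> real" where "psi t = lim (\<lambda>m. psi_seq m t)"

lemma psi_lim: "(\<lambda>m. psi_seq m t) \<longlonglongrightarrow> psi t"
proof -
  have "summable (\<lambda>m. psi_seq (Suc m) t - psi_seq m t)"
  proof (rule summable_comparison_test')
    show "summable (\<lambda>m. lam * (1 / lam) ^ m)"
      using lam_gt by (intro summable_mult summable_geometric) auto
    show "norm (psi_seq (Suc m) t - psi_seq m t) \<le> lam * (1 / lam) ^ m" if "m \<ge> 0" for m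
      using psi_seq_diff by simp
  qed
  then have "(\<lambda>m. \<Sum>i<m. psi_seq (Suc i) t - psi_seq i t) \<longlonglongrightarrow> (\<Sum>m. psi_seq (Suc m) t - psi_seq m t)"
    by (rule summable_LIMSEQ)
  then have "(\<lambda>m. psi_seq m t - psi_seq 0 t) \<longlonglongrightarrow> (\<Sum>m. psi_seq (Suc m) t - psi_seq m t)"
    by (subst (asm) sum_lessThan_telescope)
  from tendsto_add[OF this tendsto_const[of "psi_seq 0 t"]]
  have "convergent (\<lambda>m. psi_seq m t)"
    by (auto simp: convergent_def simp del: psi_seq.simps)
  then show ?thesis unfolding psi_def by (simp add: convergent_LIMSEQ_iff)
qed

lemma psi_p: "psi (p k) = k * lam" and psi_q: "psi (q k) = k * lam + 1"
  using psi_lim[of "p k"] psi_lim[of "q k"]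
  by (auto simp: psi_seq_p psi_seq_q LIMSEQ_const_iff)

lemma psi_mono: "t \<le> t' \<Longrightarrow> psi t \<le> psi t'"
  using LIMSEQ_le[OF psi_lim psi_lim] psi_seq_mono by blast

lemma psi_shift: "psi (t + 2 * pi) = psi t + n * lam"
proof -
  have "(\<lambda>m. psi_seq m t + n * lam) \<longlonglongrightarrow> psi (t + 2 * pi)"
    using psi_lim[of "t + 2 * pi"] by (simp add: psi_seq_shift)
  moreover have "(\<lambda>m. psi_seq m t + n * lam) \<longlonglongrightarrow> psi t + n * lam"
    by (intro tendsto_add psi_lim tendsto_const)
  ultimately show ?thesis using LIMSEQ_unique by blast
qed

lemma psi_shift_int: "psi (t + 2 * pi * of_int c) = psi t + c * (n * lam)"
  using quasi_periodic_int[of psi "2 * pi" "n * lam" t c, OF psi_shift] by (simp add: mult.commute)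

text \<open>The limit of the recursion. The right end point belongs to the next piece, so there the
  law comes from \<open>lam_sq\<close> instead.\<close>

lemma psi_fixed:
  assumes "p k \<le> t" "t \<le> p (k + 1)"
  shows "psi (tau k t) - psi (tau k (p k)) = lam * (psi t - psi (p k))"
proof (cases "t = p (k + 1)")
  case True
  show ?thesis using lam_sq unfolding True tau_p tau_p' psi_p psi_q by (simp add: algebra_simps)
next
  case False
  then have k: "idx t = k" using assms by (intro idx_unique) auto
  have "(\<lambda>m. psi_seq (Suc m) t) \<longlonglongrightarrow> k * lam + (psi (tau k t) - ((s k + 1) * lam + 1)) / lam"
    unfolding psi_seq.simps k using lam_gt
    by (intro tendsto_intros psi_lim) auto
  then have "psi t = k * lam + (psi (tau k t) - ((s k + 1) * lam + 1)) / lam"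
    using LIMSEQ_Suc[OF psi_lim[of t]] LIMSEQ_unique by blast
  then show ?thesis using lam_gt by (simp add: tau_p psi_p psi_q field_simps)
qed

lemma tau_shift_int: "tau k (t + 2 * pi * of_int c) = tau k t + 2 * pi * of_int c"
  using quasi_periodic_int[of "tau k" "2 * pi" "2 * pi" t c, OF tau_deg] by (simp add: mult.commute)

text \<open>The branch \<open>tau k\<close> one turn later: it differs from
  \<open>tau (k + n)\<close> by two full turns, which cancel in the difference.\<close>

lemma psi_fixed_shifted:
  assumes "p (k + n) \<le> t" "t \<le> p (k + n + 1)"
  shows "psi (tau k t) - psi (tau k (p (k + n))) = lam * (psi t - psi (p (k + n)))"
proof -
  have *: "psi (tau (k + n) r) = psi (tau k r) - 2 * (n * lam)" for r
    using psi_shift_int[of "tau k r" "-2"] by (simp add: tau_per)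
  show ?thesis using psi_fixed[OF assms] unfolding * by simp
qed

text \<open>The four tiles around the vertex k give two factorisations of one group element.
  Comparing them divides any failure of the scaling law on the interval from
  \<open>p k\<close> to \<open>q k\<close> by \<open>lam\<close>.\<close>
lemma psi_scaling_overlap_bound:
  assumes "p k \<le> t" "t \<le> q k"
  shows "\<bar>(psi (tau (k - 1) t) - psi (tau (k - 1) (p k))) - lam * (psi t - psi (p k))\<bar>
           \<le> lam * (1 / lam) ^ m"
  using assms
proof (induction m arbitrary: k t)
  case 0
  have tp: "tau (k - 1) (p k) = p (s (k - 1) - 1 + n)"
    and tq: "tau (k - 1) (q k) = p (s (k - 1) + n)"
    using tau_p'[of "k - 1"] tau_q'[of "k - 1"] by simp_all
  have "psi (tau (k - 1) (p k)) \<le> psi (tau (k - 1) t)"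
    "psi (tau (k - 1) t) \<le> psi (tau (k - 1) (q k))"
    using 0 by (auto intro: psi_mono)
  then have A: "0 \<le> psi (tau (k - 1) t) - psi (tau (k - 1) (p k))"
    "psi (tau (k - 1) t) - psi (tau (k - 1) (p k)) \<le> lam"
    unfolding tp tq psi_p by (auto simp: algebra_simps)
  have "0 \<le> psi t - psi (p k)" "psi t - psi (p k) \<le> 1"
    using psi_mono[OF 0(1)] psi_mono[OF 0(2)] by (auto simp: psi_p psi_q)
  then have "0 \<le> lam * (psi t - psi (p k))" "lam * (psi t - psi (p k)) \<le> lam"
    using lam_gt by auto
  then show ?case using A by auto
next
  case (Suc m)
  define i where "i = s (k - 1) - 1"
  define j where "j = s k + 1"
  obtain c where c: "\<And>t. tau i (tau (k - 1) t) = tau j (tau k t) + 2 * pi * of_int c"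
    using tau_comm[of k] unfolding i_def j_def by blast
  have tp: "tau (k - 1) (p k) = p (i + n)" and tq: "tau (k - 1) (q k) = p (i + n + 1)"
    using tau_p'[of "k - 1"] tau_q'[of "k - 1"] by (simp_all add: i_def algebra_simps)
  have kp: "tau k (p k) = q j" and kq: "tau k (q k) = q (j + 1)"
    using tau_p[of k] tau_q[of k] by (simp_all add: j_def algebra_simps)
  have "p (i + n) \<le> tau (k - 1) t" "tau (k - 1) t \<le> p (i + n + 1)"
    using Suc.prems by (simp_all flip: tp tq)
  from psi_fixed_shifted[OF this]
  have e1: "psi (tau j (tau k t)) - psi (tau j (q j))
      = lam * (psi (tau (k - 1) t) - psi (tau (k - 1) (p k)))"
    unfolding tp[symmetric] c psi_shift_int kp by simp
  let ?r = "tau k t"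
  have r: "q j \<le> ?r" "?r \<le> q (j + 1)" using Suc.prems by (simp_all flip: kp kq)
  have e2: "psi ?r - psi (q j) = lam * (psi t - psi (p k))"
    using psi_fixed[of k t] Suc.prems q_less_p[of k] by (simp add: kp)
  let ?G = "(psi (tau (k - 1) t) - psi (tau (k - 1) (p k))) - lam * (psi t - psi (p k))"
  have qj: "p j \<le> q j" "q j \<le> p (j + 1)" using p_less_q q_less_p by (auto intro: less_imp_le)
  from psi_fixed[OF this]
  have e3: "psi (tau j (q j)) - psi (tau j (p j)) = lam * (psi (q j) - psi (p j))" .
  show ?case
  \<comment> \<open>Up to \<open>p (j + 1)\<close> branch \<open>j\<close> scales exactly, so the
    defect vanishes. Beyond it, \<open>tau k t\<close> lies in the overlap at vertex
    \<open>j + 1\<close>, and the defect there is \<open>lam\<close> times the defect at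
    \<open>k\<close>; this drives the induction.\<close>
  proof (cases "?r \<le> p (j + 1)")
    case True
    from psi_fixed[of j ?r] e3 True qj r
    have "psi (tau j ?r) - psi (tau j (q j)) = lam * (psi ?r - psi (q j))"
      by (simp add: algebra_simps)
    then have "lam * (psi (tau (k - 1) t) - psi (tau (k - 1) (p k)))
        = lam * (lam * (psi t - psi (p k)))"
      using e1 e2 by simp
    then have "?G = 0" using lam_gt by simp
    then show ?thesis using lam_gt by simp
  next
    case False
    let ?G' = "(psi (tau j ?r) - psi (tau j (p (j + 1)))) - lam * (psi ?r - psi (p (j + 1)))"
    have G': "\<bar>?G'\<bar> \<le> lam * (1 / lam) ^ m"
      using Suc.IH[of "j + 1" ?r] False r by simp
    from psi_fixed[of j "p (j + 1)"] e3 p_step[of j]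
    have "psi (tau j (p (j + 1))) - psi (tau j (q j)) = lam * (psi (p (j + 1)) - psi (q j))"
      by (simp add: algebra_simps)
    then have "psi (tau j ?r) - psi (tau j (q j)) = ?G' + lam * (psi ?r - psi (q j))"
      by (simp add: algebra_simps)
    then have "lam * ?G = ?G'" using e1 e2 by (simp add: algebra_simps)
    moreover have "\<bar>x\<bar> = \<bar>y\<bar> / lam" if "lam * x = y" for x y
      using lam_gt that by (auto simp: abs_mult)
    ultimately have "\<bar>?G\<bar> = \<bar>?G'\<bar> / lam" by blast
    also have "\<dots> \<le> lam * (1 / lam) ^ m / lam" using G' lam_gt by (intro divide_right_mono) auto
    finally show ?thesis by simp
  qed
qed

lemma psi_scaling_overlap:
  assumes "p k \<le> t" "t \<le> q k"
  shows "psi (tau (k - 1) t) - psi (tau (k - 1) (p k)) = lam * (psi t - psi (p k))"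
proof -
  let ?G = "(psi (tau (k - 1) t) - psi (tau (k - 1) (p k))) - lam * (psi t - psi (p k))"
  have "(\<lambda>m. lam * (1 / lam) ^ m) \<longlonglongrightarrow> lam * 0"
    using lam_gt by (intro tendsto_mult tendsto_const LIMSEQ_power_zero) auto
  then have "\<bar>?G\<bar> \<le> lam * 0"
    by (rule LIMSEQ_le_const) (use psi_scaling_overlap_bound[OF assms] in auto)
  then show ?thesis by simp
qed

lemma psi_scaling_base:
  assumes "p k \<le> t" "t \<le> q (k + 1)"
  shows "psi (tau k t) - psi (tau k (p k)) = lam * (psi t - psi (p k))"
proof (cases "t \<le> p (k + 1)")
  case False
  from psi_scaling_overlap[of "k + 1" t] False assms
  have "psi (tau k t) - psi (tau k (p (k + 1))) = lam * (psi t - psi (p (k + 1)))" by simp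
  with psi_fixed[of k "p (k + 1)"] p_step[of k] show ?thesis by (simp add: algebra_simps)
qed (use psi_fixed assms in auto)

lemma psi_scaling:
  assumes "al k \<le> t" "t \<le> al (k + 1)" "al k \<le> t'" "t' \<le> al (k + 1)"
  shows "psi (tau k t') - psi (tau k t) = lam * (psi t' - psi t)"
  using psi_scaling_base[of k t] psi_scaling_base[of k t'] assms al_ge[of k] al_le[of "k + 1"]
  by (simp add: algebra_simps)

end

text \<open>Pigeonhole: points more than \<open>\<epsilon>\<close> apart fall into different cells
  of length \<open>\<epsilon>\<close>.\<close>

lemma card_le_of_separated_values:
  fixes h :: "'a \<Rightarrow> real"
  assumes "\<epsilon> > 0" and range: "\<And>x. x \<in> S \<Longrightarrow> c \<le> h x \<and> h x \<le> c + L"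
    and sep: "\<And>x y. x \<in> S \<Longrightarrow> y \<in> S \<Longrightarrow> x \<noteq> y \<Longrightarrow> \<epsilon> < \<bar>h x - h y\<bar>"
    and "L \<ge> 0"
  shows "real (card S) \<le> L / \<epsilon> + 1"
proof -
  define r where "r x = nat \<lfloor>(h x - c) / \<epsilon>\<rfloor>" for x
  have "inj_on r S"
  proof (rule inj_onI, rule ccontr)
    fix x y assume xy: "x \<in> S" "y \<in> S" "r x = r y" "x \<noteq> y"
    have "(h x - c) / \<epsilon> \<ge> 0" "(h y - c) / \<epsilon> \<ge> 0" using range[of x] range[of y] xy assms(1) by auto
    then have "\<lfloor>(h x - c) / \<epsilon>\<rfloor> = \<lfloor>(h y - c) / \<epsilon>\<rfloor>" using xy(3) unfolding r_def by (simp add: eq_nat_nat_iff)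
    then have "\<bar>(h x - c) / \<epsilon> - (h y - c) / \<epsilon>\<bar> < 1" by linarith
    then have "\<bar>h x - h y\<bar> / \<epsilon> < 1" using assms(1) by (simp flip: diff_divide_distrib add: abs_divide)
    then show False using sep[OF xy(1,2,4)] assms(1) by simp
  qed
  moreover have "r ` S \<subseteq> {..nat \<lfloor>L / \<epsilon>\<rfloor>}"
    using range assms(1) unfolding r_def
    by (auto intro!: nat_mono floor_mono divide_right_mono simp: algebra_simps)
  ultimately have "card S \<le> card {..nat \<lfloor>L / \<epsilon>\<rfloor>}" by (intro card_inj_on_le) auto
  then have "real (card S) \<le> real (nat \<lfloor>L / \<epsilon>\<rfloor>) + 1" by simp
  also have "real (nat \<lfloor>L / \<epsilon>\<rfloor>) \<le> L / \<epsilon>" using assms by simp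
  finally show ?thesis by simp
qed

lemma cis_eq_iff: "cis x = cis y \<longleftrightarrow> (\<exists>j::int. x = y + 2 * pi * of_int j)"
proof
  assume "cis x = cis y"
  then have "sin x = sin y \<and> cos x = cos y" by (simp add: complex_eq_iff)
  then obtain j where "x = y + 2 * of_int j * pi"
    by (auto simp: sin_cos_eq_iff elim!: Ints_cases)
  then show "\<exists>j::int. x = y + 2 * pi * of_int j" by (intro exI[of _ j]) simp
next
  assume "\<exists>j::int. x = y + 2 * pi * of_int j"
  then obtain j :: int where "x = y + 2 * pi * of_int j" by blast
  then show "cis x = cis y" using sin_cos_eq_iff[of x y]
    by (auto simp: complex_eq_iff intro!: exI[of _ "of_int j"])
qed

lemma dist_cis_le: "dist (cis x) (cis y) \<le> \<bar>x - y\<bar>"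
proof -
  have "cis x - cis y = cis y * (exp (\<i> * of_real (x - y)) - 1)"
    by (simp add: cis_conv_exp exp_diff right_diff_distrib exp_minus field_simps)
  then have "dist (cis x) (cis y) = 2 * \<bar>sin ((x - y) / 2)\<bar>"
    using dist_exp_i_1[of "x - y"] by (simp add: dist_norm norm_mult)
  also have "\<dots> \<le> 2 * \<bar>(x - y) / 2\<bar>" by (intro mult_left_mono abs_sin_x_le_abs_x) auto
  finally show ?thesis by simp
qed

lemma circ_cis: "x \<in> circ \<Longrightarrow> \<exists>t. x = cis t"
proof (rule exI[of _ "Arg x"])
  assume "x \<in> circ"
  moreover from this have "x \<noteq> 0" by (auto simp: circ_def)
  ultimately show "x = cis (Arg x)" by (simp add: circ_def cis_Arg sgn_div_norm)
qed

lemma circ_lift: "x \<in> circ \<Longrightarrow> \<exists>r. c \<le> r \<and> r < c + 2 * pi \<and> x = cis r"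
proof -
  assume "x \<in> circ"
  then obtain a where a: "x = cis a" using circ_cis by blast
  define j where "j = \<lfloor>(a - c) / (2 * pi)\<rfloor>"
  have "of_int j \<le> (a - c) / (2 * pi)" "(a - c) / (2 * pi) < of_int j + 1"
    unfolding j_def by linarith+
  then have "c \<le> a + 2 * pi * of_int (- j)" "a + 2 * pi * of_int (- j) < c + 2 * pi"
    by (auto simp: field_simps)
  moreover have "cis a = cis (a + 2 * pi * of_int (- j))"
    unfolding cis_eq_iff by (intro exI[of _ j]) simp
  ultimately show ?thesis using a by metis
qed

context lifted_boundary_map
begin

lemma al_per_int: "al (k + j * n) = al k + 2 * pi * of_int j"
  using quasi_periodic_int[of al n "2 * pi" k j, OF al_per] by (simp add: mult.commute)

lemma al_mod:
  "al (k mod n) = al k + 2 * pi * of_int (- (k div n))"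
  "al (k mod n + 1) = al (k + 1) + 2 * pi * of_int (- (k div n))"
proof -
  have m: "k mod n = k + (- (k div n)) * n" by (simp flip: minus_div_mult_eq_mod)
  then have m': "k mod n + 1 = (k + 1) + (- (k div n)) * n" by simp
  show "al (k mod n) = al k + 2 * pi * of_int (- (k div n))" by (subst m) (rule al_per_int)
  show "al (k mod n + 1) = al (k + 1) + 2 * pi * of_int (- (k div n))" by (subst m') (rule al_per_int)
qed

lemma ex_al: "\<exists>k. al k \<le> t \<and> t < al (k + 1)"
  using periodic_partition_index[of al n "2 * pi" t, OF al_step al_per] n_ge by auto

section \<open>Itineraries and their number\<close>

definition sym :: "complex \<Rightarrow> int" where
  "sym x = (THE k. 0 \<le> k \<and> k < n \<and> (\<exists>t. al k \<le> t \<and> t < al (k + 1) \<and> x = cis t))"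

lemma sym_cis:
  assumes "al k \<le> t" "t < al (k + 1)" shows "sym (cis t) = k mod n"
  unfolding sym_def
proof (rule the_equality)
  have "al (k mod n) \<le> t + 2 * pi * of_int (- (k div n))"
    "t + 2 * pi * of_int (- (k div n)) < al (k mod n + 1)"
    unfolding al_mod using assms by auto
  then show "0 \<le> k mod n \<and> k mod n < n \<and> (\<exists>t'. al (k mod n) \<le> t' \<and> t' < al (k mod n + 1) \<and> cis t = cis t')"
    using n_ge cis_eq_iff[of t "t + 2 * pi * of_int (- (k div n))"]
    by (intro conjI exI[of _ "t + 2 * pi * of_int (- (k div n))"])
      (auto intro!: exI[of _ "k div n"])
next
  fix l assume l: "0 \<le> l \<and> l < n \<and> (\<exists>t'. al l \<le> t' \<and> t' < al (l + 1) \<and> cis t = cis t')"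
  then obtain t' j where t': "al l \<le> t'" "t' < al (l + 1)" "t = t' + 2 * pi * of_int j"
    unfolding cis_eq_iff by blast
  then have "al (l + j * n) \<le> t" "t < al (l + 1 + j * n)"
    unfolding al_per_int by auto
  then have "al (l + j * n) < al (k + 1)" "al k < al (l + j * n + 1)"
    using assms by (auto simp: algebra_simps)
  then have "k = l + j * n" unfolding al_iff by simp
  then show "l = k mod n" using l by simp
qed

lemma f_cis: "f (cis t) = cis (tau (sym (cis t)) t)"
proof -
  obtain k where k: "al k \<le> t" "t < al (k + 1)" using ex_al by blast
  let ?j = "- (k div n)"
  have "al (k mod n) \<le> t + 2 * pi * of_int ?j" "t + 2 * pi * of_int ?j < al (k mod n + 1)"
    unfolding al_mod using k by auto
  from f_tau[OF this] have "f (cis (t + 2 * pi * of_int ?j)) = cis (tau (k mod n) t + 2 * pi * of_int ?j)"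
    unfolding tau_shift_int .
  moreover have "cis (r + 2 * pi * of_int ?j) = cis r" for r
    unfolding cis_eq_iff by blast
  ultimately show ?thesis by (simp add: sym_cis[OF k])
qed

lemma f_tau_piece:
  assumes "al k \<le> t" "t < al (k + 1)" shows "f (cis t) = cis (tau k t)" "sym (cis t) = k mod n"
  using f_tau[OF assms] sym_cis[OF assms] by auto

primrec itin :: "nat \<Rightarrow> complex \<Rightarrow> int list" where
  "itin 0 x = []"
| "itin (Suc m) x = sym x # itin m (f x)"

definition words :: "nat \<Rightarrow> real \<Rightarrow> real \<Rightarrow> int list set" where
  "words m t t' = (\<lambda>r. itin m (cis r)) ` {t..<t'}"

lemma sym_range: "sym (cis t) \<in> {0..<n}"
  using ex_al[of t] sym_cis n_ge by force

lemma words_finite: "finite (words m t t')"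
proof -
  have "set (itin m (cis r)) \<subseteq> {0..<n} \<and> length (itin m (cis r)) = m" for m r
  proof (induction m arbitrary: r)
    case (Suc m)
    then show ?case using sym_range f_cis by simp
  qed simp
  then have "words m t t' \<subseteq> {xs. set xs \<subseteq> {0..<n} \<and> length xs = m}"
    unfolding words_def by auto
  then show ?thesis using finite_lists_length_eq[of "{0..<n}" m] finite_subset by auto
qed

text \<open>The interval is cut at the break points. In the bound on \<open>N\<close>, the 2 pays
  for the two end pieces. The break points in between lie anywhere from \<open>p\<close> to
  \<open>q\<close>, so the inner pieces together have \<open>psi\<close> increment at least
  \<open>(N - 2) * lam - 1\<close>, which is at least \<open>N - 2\<close> once \<open>N\<close> is
  3 or more.\<close>

lemma split_into_pieces:
  assumes "t < t'"
  obtains k N c where "N > 0" "c 0 = t" "c N = t'"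
    "\<And>i. i < N \<Longrightarrow> c i < c (Suc i) \<and> al (k + int i) \<le> c i \<and> c (Suc i) \<le> al (k + int i + 1)"
    "real N \<le> 2 + (psi t' - psi t)" "t < al (k + 1)" "al (k + int N - 1) < t'"
proof -
  obtain k where k: "al k \<le> t" "t < al (k + 1)" using ex_al by blast
  have ex: "\<exists>N. t' \<le> al (k + int N)"
  proof -
    obtain l where l: "al l \<le> t'" "t' < al (l + 1)" using ex_al by blast
    have "al k < al (l + 1)" using k l assms by linarith
    then have "k < l + 1" unfolding al_iff .
    then show ?thesis using l by (intro exI[of _ "nat (l + 1 - k)"]) auto
  qed
  define N where "N = (LEAST N. t' \<le> al (k + int N))"
  have N: "t' \<le> al (k + int N)" unfolding N_def using ex by (rule LeastI_ex)
  have N': "al (k + int i) < t'" if "i < N" for i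
    using not_less_Least[OF that[unfolded N_def]] by simp
  have "N > 0" using N k assms by (cases N) auto
  define c where "c i = (if i = 0 then t else if i \<ge> N then t' else al (k + int i))" for i
  have pos: "t < al (k + int i)" if "i > 0" for i
  proof -
    have "al (k + 1) \<le> al (k + int i)" unfolding al_iff using that by simp
    then show ?thesis using k by linarith
  qed
  have step: "c i < c (Suc i) \<and> al (k + int i) \<le> c i \<and> c (Suc i) \<le> al (k + int i + 1)" if "i < N" for i
  proof -
    have e: "k + int (Suc i) = k + int i + 1" by simp
    have lt: "al (k + int i) < al (k + int i + 1)" by (rule al_step)
    show ?thesis
    proof (cases "Suc i < N")
      case True
      then show ?thesis using k pos[of "Suc i"] lt that unfolding c_def e by auto
    next
      case False
      then have "N = Suc i" using that by simp
      then show ?thesis using k pos[of "Suc i"] lt that N[unfolded \<open>N = Suc i\<close> e] N'[OF that] assms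
        unfolding c_def e by auto
    qed
  qed
  have "real N \<le> 2 + (psi t' - psi t)"
  proof (cases "N \<ge> 3")
    case False
    then show ?thesis using psi_mono[of t t'] assms by auto
  next
    case True
    have "t \<le> al (k + 1)" "al (k + int N - 1) \<le> t'" using k N'[of "N - 1"] True by (auto simp: of_nat_diff algebra_simps)
    moreover have "al (k + 1) \<le> q (k + 1)" "p (k + int N - 1) \<le> al (k + int N - 1)"
      by (rule al_le, rule al_ge)
    ultimately have "psi t \<le> psi (q (k + 1))" "psi (p (k + int N - 1)) \<le> psi t'"
      by (auto intro!: psi_mono)
    then have "psi t' - psi t \<ge> (real N - 2) * lam - 1"
      unfolding psi_p psi_q by (simp add: algebra_simps)
    moreover have "(real N - 2) * lam \<ge> (real N - 2) * 2"
      using True lam_gt by (intro mult_left_mono) auto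
    ultimately show ?thesis using True by simp
  qed
  moreover have "al (k + int N - 1) < t'" using N'[of "N - 1"] \<open>N > 0\<close> by (simp add: of_nat_diff algebra_simps)
  ultimately show ?thesis
    using that[of N c k, OF \<open>N > 0\<close> _ _ step] \<open>N > 0\<close> k(2) by (simp add: c_def)
qed

lemma words_Suc:
  assumes "\<And>i. i < N \<Longrightarrow> c i < c (Suc i) \<and> al (k + int i) \<le> c i \<and> c (Suc i) \<le> al (k + int i + 1)"
  shows "words (Suc m) (c 0) (c N) =
    (\<Union>i<N. (#) ((k + int i) mod n) ` words m (tau (k + int i) (c i)) (tau (k + int i) (c (Suc i))))"
proof -
  have "\<exists>i<M. c i \<le> r \<and> r < c (Suc i)" if "c 0 \<le> r" "r < c M" for r M
    using that(2)
  proof (induction M)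
    case (Suc M)
    show ?case
    proof (cases "r < c M")
      case True
      then show ?thesis using Suc.IH less_SucI by blast
    qed (use Suc in auto)
  qed (use that in simp)
  then have "{c 0..<c N} \<subseteq> (\<Union>i<N. {c i..<c (Suc i)})" by fastforce
  moreover have "{c i..<c (Suc i)} \<subseteq> {c 0..<c N}" if "i < N" for i
  proof -
    have "c 0 \<le> c j" if "j \<le> N" for j
      using that
    proof (induction j)
      case (Suc j)
      then show ?case using assms[of j] by force
    qed simp
    moreover have "c j \<le> c N" if "j \<le> N" for j
      using that
    proof (induction j rule: inc_induct)
      case (step j)
      then show ?case using assms[of j] by force
    qed simp
    ultimately have "c 0 \<le> c i" "c (Suc i) \<le> c N" using that by auto
    then show ?thesis by auto
  qed
  ultimately have dec: "{c 0..<c N} = (\<Union>i<N. {c i..<c (Suc i)})" by blast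
  have piece: "(\<lambda>r. itin (Suc m) (cis r)) ` {c i..<c (Suc i)} =
      (#) ((k + int i) mod n) ` words m (tau (k + int i) (c i)) (tau (k + int i) (c (Suc i)))"
    if "i < N" for i
  proof -
    have img: "tau (k + int i) ` {c i..<c (Suc i)} = {tau (k + int i) (c i)..<tau (k + int i) (c (Suc i))}"
    proof (intro equalityI subsetI)
      fix y assume y: "y \<in> {tau (k + int i) (c i)..<tau (k + int i) (c (Suc i))}"
      obtain r where "y = tau (k + int i) r" using tau_surj[of "k + int i"] by blast
      with y show "y \<in> tau (k + int i) ` {c i..<c (Suc i)}" by auto
    qed auto
    have "itin (Suc m) (cis r) = ((k + int i) mod n) # itin m (cis (tau (k + int i) r))"
      if "r \<in> {c i..<c (Suc i)}" for r
      using f_tau_piece[of "k + int i" r] assms[OF \<open>i < N\<close>] that by auto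
    then show ?thesis unfolding words_def img[symmetric] image_image by (intro image_cong) auto
  qed
  show ?thesis unfolding words_def[of "Suc m"] dec image_UN using piece by simp
qed

text \<open>The end pieces force an error term: with at most \<open>2 + (psi t' - psi t)\<close>
  pieces, an additive term \<open>2 ^ m\<close> per piece becomes \<open>2 ^ Suc m\<close> plus
  \<open>2 ^ m\<close> times the increment. The coefficient \<open>lam ^ m - 2 ^ m\<close> absorbs
  the latter because \<open>lam\<close> is at least 3.\<close>

lemma card_words_upper:
  "t < t' \<Longrightarrow> real (card (words m t t')) \<le> (lam ^ m - 2 ^ m) * (psi t' - psi t) + 2 ^ m"
proof (induction m arbitrary: t t')
  case 0
  have "card (words 0 t t') \<le> card {[] :: int list}" by (rule card_mono) (auto simp: words_def)
  then show ?case by simp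
next
  case (Suc m)
  from Suc.prems obtain k N c where c: "N > 0" "c 0 = t" "c N = t'"
    and st: "\<And>i. i < N \<Longrightarrow> c i < c (Suc i) \<and> al (k + int i) \<le> c i \<and> c (Suc i) \<le> al (k + int i + 1)"
    and N: "real N \<le> 2 + (psi t' - psi t)" by (rule split_into_pieces) blast
  let ?w = "\<lambda>i. words m (tau (k + int i) (c i)) (tau (k + int i) (c (Suc i)))"
  have W: "words (Suc m) t t' = (\<Union>i<N. (#) ((k + int i) mod n) ` ?w i)"
    using words_Suc[of N c k m] st c by simp
  have "card (words (Suc m) t t') \<le> (\<Sum>i<N. card ((#) ((k + int i) mod n) ` ?w i))"
    unfolding W by (intro card_UN_le) auto
  also have "\<dots> \<le> (\<Sum>i<N. card (?w i))" by (intro sum_mono card_image_le words_finite)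
  finally have "real (card (words (Suc m) t t')) \<le> (\<Sum>i<N. real (card (?w i)))"
    unfolding of_nat_sum[symmetric] by (rule of_nat_mono)
  also have "\<dots> \<le> (\<Sum>i<N. (lam ^ m - 2 ^ m) * lam * (psi (c (Suc i)) - psi (c i)) + 2 ^ m)"
  proof (rule sum_mono)
    fix i assume i: "i \<in> {..<N}"
    have "psi (tau (k + int i) (c (Suc i))) - psi (tau (k + int i) (c i)) = lam * (psi (c (Suc i)) - psi (c i))"
      using st[of i] i by (intro psi_scaling) auto
    then show "real (card (?w i)) \<le> (lam ^ m - 2 ^ m) * lam * (psi (c (Suc i)) - psi (c i)) + 2 ^ m"
      using Suc.IH[of "tau (k + int i) (c i)" "tau (k + int i) (c (Suc i))"] st[of i] i
      by (simp add: mult.assoc)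
  qed
  also have "\<dots> = (lam ^ m - 2 ^ m) * lam * (psi t' - psi t) + real N * 2 ^ m"
    unfolding sum.distrib sum_distrib_left[symmetric] sum_lessThan_telescope[of "\<lambda>i. psi (c i)"] c by simp
  also have "\<dots> \<le> (lam ^ m - 2 ^ m) * lam * (psi t' - psi t) + (2 + (psi t' - psi t)) * 2 ^ m"
    using N by (simp add: mult_right_mono)
  also have "\<dots> = ((lam ^ m - 2 ^ m) * lam + 2 ^ m) * (psi t' - psi t) + 2 ^ Suc m"
    by (simp add: algebra_simps)
  also have "\<dots> \<le> (lam ^ Suc m - 2 ^ Suc m) * (psi t' - psi t) + 2 ^ Suc m"
  proof -
    have "lam * 2 ^ m \<ge> 3 * 2 ^ m" using lam_gt by (intro mult_right_mono) auto
    then have "(lam ^ m - 2 ^ m) * lam + 2 ^ m \<le> lam ^ Suc m - 2 ^ Suc m"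
      by (simp add: algebra_simps)
    then show ?thesis using psi_mono[of t t'] Suc.prems by (intro add_right_mono mult_right_mono) auto
  qed
  finally show ?case .
qed

text \<open>Intervals are confined to one turn from a break point, so that different pieces have
  different symbols and their words cannot coincide. The confinement persists: the image under
  \<open>tau k\<close> lies between \<open>q (s k + 1)\<close> and \<open>p (s k + n)\<close>, hence
  in the turn from \<open>al (s k + 1)\<close>. Division by \<open>n * lam\<close>, the increment
  over a turn, starts the induction, where only the empty word is counted.\<close>

lemma card_words_lower:
  "t < t' \<Longrightarrow> al k0 \<le> t \<Longrightarrow> t' \<le> al (k0 + n) \<Longrightarrow>
    real (card (words m t t')) \<ge> lam ^ m * (psi t' - psi t) / (n * lam)"
proof (induction m arbitrary: t t' k0)
  case 0
  have "words 0 t t' = {[]}" using 0 by (auto simp: words_def)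
  moreover have "psi t' - psi t \<le> n * lam"
    using psi_mono[OF 0(2)] psi_mono[OF 0(3)] by (simp add: al_per psi_shift)
  ultimately show ?case using lam_gt n_ge by simp
next
  case (Suc m)
  from Suc.prems(1) obtain k N c where c: "N > 0" "c 0 = t" "c N = t'"
    and st: "\<And>i. i < N \<Longrightarrow> c i < c (Suc i) \<and> al (k + int i) \<le> c i \<and> c (Suc i) \<le> al (k + int i + 1)"
    and N: "t < al (k + 1)" "al (k + int N - 1) < t'" by (rule split_into_pieces) blast
  have "al k0 < al (k + 1)" "al (k + int N - 1) < al (k0 + n)" using N Suc.prems by linarith+
  then have kN: "k0 \<le> k" "k + int N \<le> k0 + n" unfolding al_iff by auto
  let ?w = "\<lambda>i. words m (tau (k + int i) (c i)) (tau (k + int i) (c (Suc i)))"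
  have W: "words (Suc m) t t' = (\<Union>i<N. (#) ((k + int i) mod n) ` ?w i)"
    using words_Suc[of N c k m] st c by simp
  have dis: "(k + int i) mod n \<noteq> (k + int j) mod n" if "i < N" "j < N" "i \<noteq> j" for i j
  proof
    assume "(k + int i) mod n = (k + int j) mod n"
    then have "n dvd int i - int j" by (metis add_diff_cancel_left mod_eq_dvd_iff)
    moreover have "\<bar>int i - int j\<bar> < n" using that kN by auto
    ultimately show False using that(3) dvd_imp_le_int[of "int i - int j" n] by auto
  qed
  have "(\<Sum>i<N. lam ^ Suc m * (psi (c (Suc i)) - psi (c i)) / (n * lam)) \<le> (\<Sum>i<N. real (card (?w i)))"
  proof (rule sum_mono)
    fix i assume i: "i \<in> {..<N}"
    let ?k = "k + int i"
    have eq: "psi (tau ?k (c (Suc i))) - psi (tau ?k (c i)) = lam * (psi (c (Suc i)) - psi (c i))"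
      using st[of i] i by (intro psi_scaling) auto
    have st': "c i < c (Suc i)" "al ?k \<le> c i" "c (Suc i) \<le> al (?k + 1)" using st[of i] i by auto
    have "tau ?k (p ?k) \<le> tau ?k (c i)" "tau ?k (c (Suc i)) \<le> tau ?k (q (?k + 1))"
      using st' al_ge[of ?k] al_le[of "?k + 1"] by simp_all
    moreover have "al (s ?k + 1) \<le> q (s ?k + 1)" by (rule al_le)
    moreover have "p (s ?k + n) \<le> al (s ?k + n)" by (rule al_ge)
    moreover have "al (s ?k + n) \<le> al (s ?k + 1 + n)" unfolding al_iff by simp
    ultimately have "al (s ?k + 1) \<le> tau ?k (c i)" "tau ?k (c (Suc i)) \<le> al (s ?k + 1 + n)"
      unfolding tau_p tau_q' by linarith+
    from Suc.IH[OF _ this] st'(1)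
    show "lam ^ Suc m * (psi (c (Suc i)) - psi (c i)) / (n * lam) \<le> real (card (?w i))"
      unfolding eq by (simp add: mult_ac)
  qed
  also have "(\<Sum>i<N. lam ^ Suc m * (psi (c (Suc i)) - psi (c i)) / (n * lam)) = lam ^ Suc m * (psi t' - psi t) / (n * lam)"
    unfolding sum_distrib_left[symmetric] sum_divide_distrib[symmetric]
      sum_lessThan_telescope[of "\<lambda>i. psi (c i)"] c by simp
  also have "(\<Sum>i<N. real (card (?w i))) = real (\<Sum>i<N. card ((#) ((k + int i) mod n) ` ?w i))"
    by (simp add: card_image)
  also have "\<dots> = real (card (words (Suc m) t t'))"
    unfolding W
  proof (subst card_UN_disjoint)
    show "\<forall>i\<in>{..<N}. \<forall>j\<in>{..<N}. i \<noteq> j \<longrightarrow>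
      (#) ((k + int i) mod n) ` ?w i \<inter> (#) ((k + int j) mod n) ` ?w j = {}"
      using dis by blast
    show "\<forall>i\<in>{..<N}. finite ((#) ((k + int i) mod n) ` ?w i)"
      using words_finite by blast
  qed auto
  finally show ?case .
qed

definition num_words :: "nat \<Rightarrow> nat" where "num_words m = card (words m (al 0) (al n))"

lemma al_n: "al n = al 0 + 2 * pi" using al_per[of 0] by simp

lemma num_words_lower: "lam ^ m \<le> real (num_words m)"
proof -
  have "psi (al n) - psi (al 0) = n * lam" by (simp add: al_n psi_shift)
  then show ?thesis
    using card_words_lower[of "al 0" "al n" 0 m] n_ge lam_gt unfolding num_words_def by (simp add: al_n)
qed

lemma num_words_upper: "real (num_words m) \<le> (n * lam + 1) * lam ^ m"
proof -
  have "real (num_words m) \<le> (lam ^ m - 2 ^ m) * (n * lam) + 2 ^ m"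
    using card_words_upper[of "al 0" "al n" m] unfolding num_words_def by (simp add: al_n psi_shift)
  also have "\<dots> \<le> lam ^ m * (n * lam) + lam ^ m"
    using lam_gt n_ge by (intro add_mono mult_right_mono power_mono) auto
  finally show ?thesis by (simp add: algebra_simps)
qed

lemma words_circ: "words m (al 0) (al n) = itin m ` circ"
proof -
  have "circ \<subseteq> cis ` {al 0..<al n}"
  proof
    fix x assume "x \<in> circ"
    then obtain r where "al 0 \<le> r" "r < al 0 + 2 * pi" "x = cis r" using circ_lift by blast
    then show "x \<in> cis ` {al 0..<al n}" by (auto simp: al_n)
  qed
  then have C: "circ = cis ` {al 0..<al n}" by (auto simp: circ_def)
  show ?thesis unfolding words_def C image_image ..
qed

section \<open>Upper bound: separated points with a common itinerary\<close>

primrec liftw :: "int list \<Rightarrow> nat \<Rightarrow> real \<Rightarrow> real" where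
  "liftw w 0 t = t"
| "liftw w (Suc i) t = tau (w ! i) (liftw w i t)"

lemma liftw_mono: "t \<le> t' \<Longrightarrow> liftw w i t \<le> liftw w i t'"
  by (induction i) simp_all

lemma liftw_deg: "liftw w i (t + 2 * pi) = liftw w i t + 2 * pi"
  by (induction i) (simp_all add: tau_deg)

lemma itin_nth: "i < m \<Longrightarrow> itin m x ! i = sym ((f ^^ i) x)"
proof (induction m arbitrary: i x)
  case (Suc m)
  then show ?case by (cases i) (simp_all add: funpow_Suc_right del: funpow.simps)
qed simp

lemma liftw_orbit:
  assumes "itin m (cis t) = w" "i \<le> m"
  shows "(f ^^ i) (cis t) = cis (liftw w i t)"
  using assms(2)
proof (induction i)
  case (Suc i)
  then have e: "(f ^^ i) (cis t) = cis (liftw w i t)" by simp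
  moreover have "w ! i = sym (cis (liftw w i t))"
    using itin_nth[of i m "cis t"] Suc.prems assms(1) e by simp
  ultimately show ?case by (simp add: f_cis[of "liftw w i t"])
qed simp

text \<open>Along a fixed word the lifts \<open>liftw w i\<close> are monotone of degree one and
  follow the true orbits. The sum \<open>h\<close> over all times thus ranges over an interval of
  length \<open>2 * pi * m\<close>, and the summands of a difference of two values share one sign,
  so separation at a single time already separates the values of \<open>h\<close>.\<close>

lemma card_separated_fiber:
  assumes "separated f circ m \<epsilon> E" "\<epsilon> > 0"
  shows "real (card {x \<in> E. itin m x = w}) \<le> 2 * pi * m / \<epsilon> + 1"
proof (rule card_le_of_separated_values)
  define h where "h x = (\<Sum>i<m. liftw w i (Arg2pi x))" for x
  let ?S = "{x \<in> E. itin m x = w}"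
  have ang: "x = cis (Arg2pi x)" if "x \<in> ?S" for x
  proof -
    have "norm x = 1" using that assms unfolding separated_def circ_def by auto
    then show ?thesis using Arg2pi_eq[of x, symmetric] by (simp add: cis_conv_exp mult.commute)
  qed
  show "(\<Sum>i<m. liftw w i 0) \<le> h x \<and> h x \<le> (\<Sum>i<m. liftw w i 0) + 2 * pi * m" if "x \<in> ?S" for x
  proof
    show "(\<Sum>i<m. liftw w i 0) \<le> h x"
      unfolding h_def by (intro sum_mono liftw_mono Arg2pi_ge_0)
    have "h x \<le> (\<Sum>i<m. liftw w i (0 + 2 * pi))"
      unfolding h_def using Arg2pi_lt_2pi[of x] by (intro sum_mono liftw_mono) simp
    then show "h x \<le> (\<Sum>i<m. liftw w i 0) + 2 * pi * m"
      unfolding liftw_deg sum.distrib by (simp add: mult.commute)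
  qed
  have less: "\<epsilon> < h y - h x" if xy: "x \<in> ?S" "y \<in> ?S" "x \<noteq> y" "Arg2pi x \<le> Arg2pi y" for x y
  proof -
    have "x \<in> E" "y \<in> E" using that by auto
    moreover have "\<forall>x\<in>E. \<forall>y\<in>E. x \<noteq> y \<longrightarrow> (\<exists>i<m. dist ((f ^^ i) x) ((f ^^ i) y) > \<epsilon>)"
      using assms(1) by (simp add: separated_def)
    ultimately obtain i where i: "i < m" "dist ((f ^^ i) x) ((f ^^ i) y) > \<epsilon>"
      using xy(3) by blast
    have orbit: "(f ^^ i) z = cis (liftw w i (Arg2pi z))" if "z \<in> ?S" for z
      using liftw_orbit[of m "Arg2pi z" w i] that i by (simp add: ang[OF that, symmetric])
    have "\<epsilon> < dist (cis (liftw w i (Arg2pi x))) (cis (liftw w i (Arg2pi y)))"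
      using i(2) by (simp only: orbit[OF that(1)] orbit[OF that(2)])
    also have "\<dots> \<le> \<bar>liftw w i (Arg2pi x) - liftw w i (Arg2pi y)\<bar>" by (rule dist_cis_le)
    finally have "\<epsilon> < \<bar>liftw w i (Arg2pi x) - liftw w i (Arg2pi y)\<bar>" .
    then have "\<epsilon> < liftw w i (Arg2pi y) - liftw w i (Arg2pi x)"
      using liftw_mono[OF that(4), of w i] by simp
    also have "\<dots> \<le> (\<Sum>i<m. liftw w i (Arg2pi y) - liftw w i (Arg2pi x))"
      using i(1) liftw_mono[OF that(4)] by (intro member_le_sum) auto
    finally show ?thesis unfolding h_def sum_subtractf .
  qed
  show "\<epsilon> < \<bar>h x - h y\<bar>" if "x \<in> ?S" "y \<in> ?S" "x \<noteq> y" for x y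
    using less[OF that] less[OF that(2,1) that(3)[symmetric]] by linarith
qed (use assms in auto)

lemma card_separated:
  assumes "separated f circ m \<epsilon> E" "\<epsilon> > 0"
  shows "real (card E) \<le> real (num_words m) * (2 * pi * m / \<epsilon> + 1)"
proof -
  have E: "E \<subseteq> circ" "finite E" using assms unfolding separated_def by auto
  let ?W = "itin m ` circ"
  have fin: "finite ?W" using words_finite[of m "al 0" "al n"] by (simp add: words_circ)
  have U: "(\<Union>w\<in>?W. {x \<in> E. itin m x = w}) = E" using E by auto
  have "card E \<le> (\<Sum>w\<in>?W. card {x \<in> E. itin m x = w})"
    using card_UN_le[OF fin, of "\<lambda>w. {x \<in> E. itin m x = w}"] unfolding U .
  then have "real (card E) \<le> (\<Sum>w\<in>?W. real (card {x \<in> E. itin m x = w}))"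
    unfolding of_nat_sum[symmetric] by (rule of_nat_mono)
  also have "\<dots> \<le> (\<Sum>w\<in>?W. 2 * pi * m / \<epsilon> + 1)"
    by (intro sum_mono card_separated_fiber assms)
  finally show ?thesis by (simp add: num_words_def words_circ)
qed

section \<open>Lower bound: uniform jumps at the break points\<close>

lemma not_dvd_small: "n dvd z \<Longrightarrow> 0 < \<bar>z\<bar> \<Longrightarrow> \<bar>z\<bar> < n \<Longrightarrow> False"
  using dvd_imp_le_int[of z n] by auto

text \<open>The two images of \<open>al (k + 1)\<close> lie between \<open>p (s k - 1 + n)\<close>
  and \<open>p (s k + n)\<close>, and between \<open>q (s (k + 1) + 1)\<close> and
  \<open>q (s (k + 1) + 2)\<close>. Coincidence modulo full turns would make
  \<open>s k - s (k + 1)\<close> congruent to 2 or 3 modulo \<open>n\<close>. It equals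
  \<open>4g - 1\<close> or \<open>3 - 4g\<close>, roughly half of \<open>n\<close>, which rules this
  out for \<open>g\<close> at least 2.\<close>

lemma discontinuity:
  "cis (tau k (al (k + 1))) \<noteq> cis (tau (k + 1) (al (k + 1)))"
proof
  assume "cis (tau k (al (k + 1))) = cis (tau (k + 1) (al (k + 1)))"
  then obtain j where j: "tau k (al (k + 1)) = tau (k + 1) (al (k + 1)) + 2 * pi * of_int j"
    unfolding cis_eq_iff by blast
  have q_per_int: "q (i + j * n) = q i + 2 * pi * of_int j" for i
    using quasi_periodic_int[of q n "2 * pi" i j, OF q_per] by (simp add: mult.commute)
  define a where "a = s k - 1 + n"
  define b where "b = s (k + 1) + 1 + j * n"
  have "tau k (p (k + 1)) \<le> tau k (al (k + 1))" "tau k (al (k + 1)) \<le> tau k (q (k + 1))"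
    "tau (k + 1) (p (k + 1)) \<le> tau (k + 1) (al (k + 1))"
    "tau (k + 1) (al (k + 1)) \<le> tau (k + 1) (q (k + 1))"
    using al_ge al_le by simp_all
  moreover have "s k + n = a + 1" by (simp add: a_def)
  moreover have "q b = q (s (k + 1) + 1) + 2 * pi * of_int j"
    "q (b + 1) = q (s (k + 1) + 2) + 2 * pi * of_int j"
    using q_per_int[of "s (k + 1) + 1"] q_per_int[of "s (k + 1) + 2"]
    by (simp_all add: b_def algebra_simps)
  ultimately have "p a \<le> q (b + 1)" "q b \<le> p (a + 1)"
    unfolding tau_p tau_q tau_p' tau_q' a_def[symmetric] j by simp_all
  then have "p a < p (b + 1 + 1)" "q b < q (a + 1)"
    using q_less_p[of "b + 1"] p_less_q[of "a + 1"] by linarith+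
  then have "a = b \<or> a = b + 1" unfolding p_iff q_iff by auto
  moreover have "a - b = s k - s (k + 1) - 2 + (1 - j) * n"
    by (simp add: a_def b_def algebra_simps)
  ultimately have "s k - s (k + 1) - 2 = (j - 1) * n \<or> s k - s (k + 1) - 3 = (j - 1) * n"
    by (auto simp: algebra_simps)
  then have "n dvd s k - s (k + 1) - 2 \<or> n dvd s k - s (k + 1) - 3"
    by auto
  moreover have "s k - s (k + 1) = (if odd k then 4 * int g - 1 else 3 - 4 * int g)"
    by (simp add: pairing_def)
  ultimately have "n dvd s k - s (k + 1) - 2 \<or> n dvd s k - s (k + 1) - 3"
    "s k - s (k + 1) = 4 * int g - 1 \<or> s k - s (k + 1) = 3 - 4 * int g" by (auto split: if_splits)
  then obtain z where "n dvd z" "z = 4 * int g - 3 \<or> z = 4 * int g - 4 \<or> z = 1 - 4 * int g \<or> z = - 4 * int g"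
    by force
  then show False using not_dvd_small[of z] g2 n_eq by auto
qed

lemma tau_per_int: "tau (k + j * n) t = tau k t - 4 * pi * of_int j"
  using quasi_periodic_int[of "\<lambda>k. tau k t" n "- 4 * pi" k j] tau_per by (simp add: mult.commute)

text \<open>Closed branch intervals with different labels meet on the circle at most in break
  points, where the two branches disagree.\<close>

lemma branches_separate:
  assumes kl: "0 \<le> k" "k < n" "0 \<le> l" "l < n" "k \<noteq> l"
    and t: "al k \<le> t" "t \<le> al (k + 1)" and t': "al l \<le> t'" "t' \<le> al (l + 1)"
  shows "cis t \<noteq> cis t' \<or> cis (tau k t) \<noteq> cis (tau l t')"
proof (rule ccontr)
  assume "\<not> ?thesis"
  then have e: "cis t = cis t'" "cis (tau k t) = cis (tau l t')" by auto
  then obtain j where j: "t = t' + 2 * pi * of_int j" unfolding cis_eq_iff by blast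
  define l' where "l' = l + j * n"
  have l': "al l' \<le> t" "t \<le> al (l' + 1)"
    using t' al_per_int[of l j] al_per_int[of "l + 1" j]
    unfolding l'_def j by (simp_all add: algebra_simps)
  have "tau l' t = tau l t' + 2 * pi * of_int (- j)"
    unfolding l'_def tau_per_int j tau_shift_int by simp
  then have c: "cis (tau l' t) = cis (tau l t')" unfolding cis_eq_iff by blast
  have "l' \<noteq> k"
  proof
    assume "l' = k"
    then have "l' mod n = k mod n" by simp
    then show False using kl unfolding l'_def by simp
  qed
  have "al k \<le> al (l' + 1)" "al l' \<le> al (k + 1)" using t l' by linarith+
  then have "l' = k + 1 \<or> k = l' + 1" using \<open>l' \<noteq> k\<close> unfolding al_iff by auto
  then show False
  proof
    assume "l' = k + 1"
    then have "t = al (k + 1)" using t l' by simp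
    then show False using discontinuity[of k] e(2) c \<open>l' = k + 1\<close> by simp
  next
    assume "k = l' + 1"
    then have "t = al (l' + 1)" using t l' by simp
    then show False using discontinuity[of l'] e(2) c \<open>k = l' + 1\<close> by simp
  qed
qed

text \<open>Compactness. The branches are used on closed intervals, to which they extend
  continuously although the boundary map itself jumps.\<close>

lemma branch_gap:
  assumes kl: "0 \<le> k" "k < n" "0 \<le> l" "l < n" "k \<noteq> l"
  shows "\<exists>c>0. \<forall>t t'. al k \<le> t \<and> t \<le> al (k + 1) \<and> al l \<le> t' \<and> t' \<le> al (l + 1) \<longrightarrow>
    c \<le> dist (cis t) (cis t') + dist (cis (tau k t)) (cis (tau l t'))"
proof -
  let ?K = "{al k..al (k + 1)} \<times> {al l..al (l + 1)}"
  let ?F = "\<lambda>x. dist (cis (fst x)) (cis (snd x)) + dist (cis (tau k (fst x))) (cis (tau l (snd x)))"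
  have "compact ?K" by (intro compact_Times compact_Icc)
  moreover have "?K \<noteq> {}" using al_step[of k] al_step[of l] by (auto simp: less_imp_le)
  moreover have "continuous_on ?K ?F"
    by (intro continuous_intros continuous_on_compose2[OF tau_cont]) auto
  ultimately obtain x where x: "x \<in> ?K" "\<And>y. y \<in> ?K \<Longrightarrow> ?F x \<le> ?F y"
    using continuous_attains_inf[of ?K ?F] by blast
  have "?F x > 0"
    using branches_separate[OF kl, of "fst x" "snd x"] x(1)
    by (auto simp: add_pos_nonneg add_nonneg_pos)
  moreover have "?F x \<le> dist (cis t) (cis t') + dist (cis (tau k t)) (cis (tau l t'))"
    if "al k \<le> t" "t \<le> al (k + 1)" "al l \<le> t'" "t' \<le> al (l + 1)" for t t'
    using x(2)[of "(t, t')"] that by simp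
  ultimately show ?thesis by blast
qed

lemma expansive_constant:
  "\<exists>\<epsilon>>0. \<forall>x\<in>circ. \<forall>y\<in>circ. sym x \<noteq> sym y \<longrightarrow> dist x y > \<epsilon> \<or> dist (f x) (f y) > \<epsilon>"
proof -
  define D where "D = {(k, l). 0 \<le> k \<and> k < n \<and> 0 \<le> l \<and> l < n \<and> k \<noteq> l}"
  define G where "G z c \<longleftrightarrow> (\<forall>t t'. al (fst z) \<le> t \<and> t \<le> al (fst z + 1) \<and>
      al (snd z) \<le> t' \<and> t' \<le> al (snd z + 1) \<longrightarrow>
      c \<le> dist (cis t) (cis t') + dist (cis (tau (fst z) t)) (cis (tau (snd z) t')))" for z c
  have "\<exists>c. c > 0 \<and> G z c" if "z \<in> D" for z
    using branch_gap[of "fst z" "snd z"] that unfolding G_def D_def by (auto simp: case_prod_beta)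
  then have "\<forall>z\<in>D. \<exists>c. c > 0 \<and> G z c" by blast
  from bchoice[OF this] obtain c where c: "\<And>z. z \<in> D \<Longrightarrow> c z > 0" "\<And>z. z \<in> D \<Longrightarrow> G z (c z)"
    by blast
  have c': "c z \<le> dist (cis t) (cis t') + dist (cis (tau (fst z) t)) (cis (tau (snd z) t'))"
    if "z \<in> D" "al (fst z) \<le> t" "t \<le> al (fst z + 1)" "al (snd z) \<le> t'" "t' \<le> al (snd z + 1)"
    for z t t'
    using c(2)[OF that(1)] that(2-) unfolding G_def by blast
  have "D \<subseteq> {0..<n} \<times> {0..<n}" unfolding D_def by auto
  then have fin: "finite D" using finite_subset by blast
  \<comment> \<open>The inserted 1 spares showing that \<open>D\<close> is nonempty. With a third of
    the minimum, two distances of sum at least \<open>3 * \<epsilon>\<close> include one strictly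
    above \<open>\<epsilon>\<close>.\<close>
  define \<epsilon> where "\<epsilon> = Min (insert 1 (c ` D)) / 3"
  have pos: "\<epsilon> > 0" unfolding \<epsilon>_def using fin c(1) by (subst zero_less_divide_iff) (auto simp: Min_gr_iff)
  have eps: "3 * \<epsilon> \<le> c z" if "z \<in> D" for z
    using fin that unfolding \<epsilon>_def by (auto intro!: Min_le)
  have "dist x y > \<epsilon> \<or> dist (f x) (f y) > \<epsilon>" if xy: "x \<in> circ" "y \<in> circ" "sym x \<noteq> sym y" for x y
  proof -
    have lift: "\<exists>t. al (sym x) \<le> t \<and> t \<le> al (sym x + 1) \<and> x = cis t" if "x \<in> circ" for x
    proof -
      obtain t where t: "x = cis t" using circ_cis \<open>x \<in> circ\<close> by blast
      obtain k where k: "al k \<le> t" "t < al (k + 1)" using ex_al by blast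
      have "x = cis (t + 2 * pi * of_int (- (k div n)))"
        unfolding t cis_eq_iff by (intro exI[of _ "k div n"]) simp
      then show ?thesis using k sym_cis[OF k] unfolding t
        by (intro exI[of _ "t + 2 * pi * of_int (- (k div n))"]) (simp add: al_mod)
    qed
    obtain t where t: "al (sym x) \<le> t" "t \<le> al (sym x + 1)" "x = cis t" using lift xy by blast
    obtain t' where t': "al (sym y) \<le> t'" "t' \<le> al (sym y + 1)" "y = cis t'" using lift xy by blast
    have z: "(sym x, sym y) \<in> D" using sym_range[of t] sym_range[of t'] xy(3) t(3) t'(3) unfolding D_def by auto
    have "c (sym x, sym y) \<le> dist x y + dist (f x) (f y)"
      using c'[OF z, of t t'] t t' f_cis[of t] f_cis[of t'] by simp
    then show ?thesis using eps[OF z] pos by linarith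
  qed
  then show ?thesis using pos by blast
qed

lemma f_circ: "x \<in> circ \<Longrightarrow> f x \<in> circ"
  using circ_cis[of x] f_cis by (auto simp: circ_def)

lemma funpow_circ: "x \<in> circ \<Longrightarrow> (f ^^ i) x \<in> circ"
  by (induction i) (auto intro: f_circ)

lemma itin_length: "length (itin m x) = m"
  by (induction m arbitrary: x) auto

text \<open>One point is chosen per itinerary. Orbits with different symbols at time
  \<open>i\<close> are apart at time \<open>i\<close> or \<open>i + 1\<close>, so words of length
  \<open>m\<close> need \<open>Suc m\<close> times.\<close>

lemma many_separated:
  "\<exists>\<epsilon>>0. \<forall>m. \<exists>E. separated f circ (Suc m) \<epsilon> E \<and> card E = num_words m"
proof -
  obtain \<epsilon> where \<epsilon>: "\<epsilon> > 0"
    "\<And>x y. x \<in> circ \<Longrightarrow> y \<in> circ \<Longrightarrow> sym x \<noteq> sym y \<Longrightarrow> dist x y > \<epsilon> \<or> dist (f x) (f y) > \<epsilon>"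
    using expansive_constant by blast
  have "\<exists>E. separated f circ (Suc m) \<epsilon> E \<and> card E = num_words m" for m
  proof -
    define W where "W = itin m ` circ"
    define r where "r = inv_into circ (itin m)"
    have fin: "finite W" using words_finite[of m "al 0" "al n"] by (simp add: words_circ W_def)
    have sep: "\<exists>i<Suc m. dist ((f ^^ i) x) ((f ^^ i) y) > \<epsilon>"
      if xy: "x \<in> circ" "y \<in> circ" "itin m x \<noteq> itin m y" for x y
    proof -
      obtain i where i: "i < m" "itin m x ! i \<noteq> itin m y ! i"
        using xy(3) nth_equalityI[of "itin m x" "itin m y"] by (auto simp: itin_length)
      then have "dist ((f ^^ i) x) ((f ^^ i) y) > \<epsilon> \<or> dist ((f ^^ Suc i) x) ((f ^^ Suc i) y) > \<epsilon>"
        using \<epsilon>(2)[OF funpow_circ[OF xy(1)] funpow_circ[OF xy(2)], of i i] by (simp add: itin_nth)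
      then show ?thesis using i(1) Suc_mono less_SucI by blast
    qed
    have r: "r w \<in> circ" "itin m (r w) = w" if "w \<in> W" for w
      using that unfolding W_def r_def by (auto intro: inv_into_into f_inv_into_f)
    have "separated f circ (Suc m) \<epsilon> (r ` W)"
      unfolding separated_def
    proof (intro conjI ballI impI)
      fix x y assume "x \<in> r ` W" "y \<in> r ` W" "x \<noteq> y"
      then obtain v w where "v \<in> W" "w \<in> W" "x = r v" "y = r w" "v \<noteq> w" by blast
      then show "\<exists>i<Suc m. dist ((f ^^ i) x) ((f ^^ i) y) > \<epsilon>"
        using sep[of x y] r[of v] r[of w] by simp
    qed (use r(1) fin in auto)
    moreover have "card (r ` W) = num_words m"
      by (subst card_image) (auto simp: inj_on_inv_into num_words_def words_circ W_def r_def)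
    ultimately show ?thesis by blast
  qed
  then show ?thesis using \<epsilon>(1) by blast
qed

section \<open>Growth rate of separated sets\<close>

lemma max_separated_le:
  assumes "\<epsilon> > 0"
  shows "max_separated f circ m \<epsilon> \<le> ereal (real (num_words m) * (2 * pi * m / \<epsilon> + 1))"
  unfolding max_separated_def using card_separated[OF _ assms] by (intro SUP_least) auto

lemma max_separated_ge:
  assumes "separated f circ m \<epsilon> E"
  shows "ereal (real (card E)) \<le> max_separated f circ m \<epsilon>"
  unfolding max_separated_def using assms by (intro SUP_upper) auto

lemma max_separated_ge_1: "1 \<le> max_separated f circ m \<epsilon>"
proof -
  have "separated f circ m \<epsilon> {1}" by (auto simp: separated_def circ_def)
  from max_separated_ge[OF this] show ?thesis by (simp add: one_ereal_def)
qed

lemma max_separated_real: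
  assumes "\<epsilon> > 0"
  obtains r where "max_separated f circ m \<epsilon> = ereal r" "1 \<le> r"
    "r \<le> real (num_words m) * (2 * pi * m / \<epsilon> + 1)"
  using max_separated_le[OF assms, of m] max_separated_ge_1[of m \<epsilon>]
  by (cases "max_separated f circ m \<epsilon>") (auto simp: one_ereal_def)

definition rate :: "real \<Rightarrow> nat \<Rightarrow> ereal" where
  "rate \<epsilon> m = (if max_separated f circ m \<epsilon> = \<infinity> then \<infinity>
     else ereal (ln (real_of_ereal (max_separated f circ m \<epsilon>)) / real m))"

lemma rate_limsup_le:
  assumes "\<epsilon> > 0"
  shows "limsup (rate \<epsilon>) \<le> ereal (ln lam)"
proof -
  define K where "K = (n * lam + 1) * (2 * pi / \<epsilon> + 1)"
  have "K > 0" unfolding K_def using lam_gt n_ge assms by (intro mult_pos_pos add_pos_pos) auto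
  have le: "rate \<epsilon> m \<le> ereal (ln K / m + ln m / m + ln lam)" if "m \<ge> 1" for m
  proof -
    obtain r where r: "max_separated f circ m \<epsilon> = ereal r" "1 \<le> r"
      "r \<le> real (num_words m) * (2 * pi * m / \<epsilon> + 1)" using max_separated_real[OF assms] .
    note r(3)
    also have "real (num_words m) * (2 * pi * m / \<epsilon> + 1) \<le> ((n * lam + 1) * lam ^ m) * ((2 * pi / \<epsilon> + 1) * m)"
      using assms that lam_gt n_ge by (intro mult_mono num_words_upper) (auto simp: algebra_simps)
    also have "\<dots> = K * m * lam ^ m" by (simp add: K_def)
    finally have "ln r \<le> ln (K * m * lam ^ m)" using r(2) by (intro ln_mono) auto
    also have "\<dots> = ln K + ln m + m * ln lam"
      using \<open>K > 0\<close> that lam_gt by (simp add: ln_mult_pos ln_realpow)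
    finally have "ln r / m \<le> (ln K + ln m + m * ln lam) / m" using that by (intro divide_right_mono) auto
    also have "\<dots> = ln K / m + ln m / m + ln lam" using that by (simp add: field_simps)
    finally show ?thesis unfolding rate_def r(1) by simp
  qed
  have "(\<lambda>m. ln K / real m + ln (real m) / real m + ln lam) \<longlonglongrightarrow> 0 + 0 + ln lam"
    using lim_ln_over_n lim_const_over_n[of "ln K"] by (intro tendsto_add tendsto_const) auto
  then have "(\<lambda>m. ereal (ln K / real m + ln (real m) / real m + ln lam)) \<longlonglongrightarrow> ereal (ln lam)"
    by simp
  then have "limsup (\<lambda>m. ereal (ln K / real m + ln (real m) / real m + ln lam)) = ereal (ln lam)"
    by (intro lim_imp_Limsup) auto
  moreover have "limsup (rate \<epsilon>) \<le> limsup (\<lambda>m. ereal (ln K / real m + ln (real m) / real m + ln lam))"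
    using le by (intro Limsup_mono eventually_sequentiallyI[of 1])
  ultimately show ?thesis by simp
qed

lemma rate_limsup_ge:
  "\<exists>\<epsilon>>0. ereal (ln lam) \<le> limsup (rate \<epsilon>)"
proof -
  obtain \<epsilon> where \<epsilon>: "\<epsilon> > 0" "\<And>m. \<exists>E. separated f circ (Suc m) \<epsilon> E \<and> card E = num_words m"
    using many_separated by blast
  have le: "ereal (ln lam - ln lam / m) \<le> rate \<epsilon> m" if m: "m \<ge> 1" for m
  proof -
    obtain l where l: "m = Suc l" using m by (cases m) auto
    obtain r where r: "max_separated f circ m \<epsilon> = ereal r" "1 \<le> r"
      using max_separated_real[OF \<epsilon>(1)] .
    have "lam ^ l \<le> r"
      using \<epsilon>(2)[of l] max_separated_ge[of m \<epsilon>] num_words_lower[of l] r l by fastforce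
    then have "ln (lam ^ l) \<le> ln r" using lam_gt by (intro ln_mono) auto
    then have "l * ln lam \<le> ln r" using lam_gt by (simp add: ln_realpow)
    then have "l * ln lam / m \<le> ln r / m" by (intro divide_right_mono) auto
    moreover have "l * ln lam / m = ln lam - ln lam / m" using l by (simp add: field_simps)
    ultimately show ?thesis unfolding rate_def r(1) by simp
  qed
  have "(\<lambda>m. ln lam - ln lam / real m) \<longlonglongrightarrow> ln lam - 0"
    using lim_const_over_n[of "ln lam"] by (intro tendsto_diff tendsto_const) auto
  then have "(\<lambda>m. ereal (ln lam - ln lam / real m)) \<longlonglongrightarrow> ereal (ln lam)"
    by simp
  then have "limsup (\<lambda>m. ereal (ln lam - ln lam / real m)) = ereal (ln lam)"
    by (intro lim_imp_Limsup) auto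
  moreover have "limsup (\<lambda>m. ereal (ln lam - ln lam / real m)) \<le> limsup (rate \<epsilon>)"
    using le by (intro Limsup_mono eventually_sequentiallyI[of 1])
  ultimately show ?thesis using \<epsilon>(1) by auto
qed

theorem entropy: "top_entropy f circ = ereal (ln lam)"
proof -
  have "top_entropy f circ = (SUP \<epsilon> \<in> {0<..}. limsup (rate \<epsilon>))"
    unfolding top_entropy_def rate_def ..
  also have "\<dots> = ereal (ln lam)"
  proof (rule antisym)
    show "(SUP \<epsilon> \<in> {0<..}. limsup (rate \<epsilon>)) \<le> ereal (ln lam)"
      using rate_limsup_le by (intro SUP_least) auto
    show "ereal (ln lam) \<le> (SUP \<epsilon> \<in> {0<..}. limsup (rate \<epsilon>))"
      using rate_limsup_ge by (auto intro: SUP_upper2)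
  qed
  finally show ?thesis .
qed

end

section \<open>Hyperbolic geometry in Minkowski space\<close>

type_synonym vec3 = "real \<times> real \<times> real"

fun dot3 :: "vec3 \<Rightarrow> vec3 \<Rightarrow> real" where
  "dot3 (a, b, c) (x, y, z) = a * x + b * y + c * z"

fun cross :: "vec3 \<Rightarrow> vec3 \<Rightarrow> vec3" where
  "cross (a, b, c) (x, y, z) = (b * z - c * y, c * x - a * z, a * y - b * x)"

definition det3 :: "vec3 \<Rightarrow> vec3 \<Rightarrow> vec3 \<Rightarrow> real" where
  "det3 u v w = dot3 (cross u v) w"

lemma dot3_linear: "dot3 h (x *\<^sub>R u + y *\<^sub>R v) = x * dot3 h u + y * dot3 h v"
  by (cases h; cases u; cases v) (simp add: algebra_simps)

lemma det3_linear: "det3 u v (x *\<^sub>R w + y *\<^sub>R w') = x * det3 u v w + y * det3 u v w'"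
  by (simp add: det3_def dot3_linear)

lemma det3_rotate: "det3 u v w = det3 v w u"
  by (cases u; cases v; cases w) (simp add: det3_def algebra_simps)

lemma det3_swap: "det3 v u w = - det3 u v w"
  by (cases u; cases v; cases w) (simp add: det3_def algebra_simps)

lemma det3_same [simp]: "det3 u u w = 0" "det3 u w u = 0" "det3 w u u = 0"
  by (cases u; cases w; simp add: det3_def algebra_simps)+

lemma det3_cross: "det3 u v (cross h h') = det3 h h' (cross u v)"
  by (cases u; cases v; cases h; cases h') (simp add: det3_def algebra_simps)

lemma cross_cross: "cross (cross u v) (cross v w) = det3 u v w *\<^sub>R v"
  by (cases u; cases v; cases w) (simp add: det3_def algebra_simps)

lemma det3_cross_cross:
  "det3 (cross u v) (cross v w) (cross x y) = det3 u v w * det3 x y v"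
  by (cases u; cases v; cases w; cases x; cases y) (simp add: det3_def algebra_simps)

text \<open>The three-term Grassmann-Pluecker relation, for the pencil of planes through
  \<open>o'\<close>.\<close>

lemma pluecker:
  "det3 o' u x' * det3 o' w x = det3 o' u x * det3 o' w x' + det3 o' w u * det3 o' x x'"
  by (cases o'; cases u; cases w; cases x; cases x') (simp add: det3_def algebra_simps)

lemma cramer:
  "det3 h1 h2 h3 *\<^sub>R y =
     dot3 h3 y *\<^sub>R cross h1 h2 + dot3 h1 y *\<^sub>R cross h2 h3 + dot3 h2 y *\<^sub>R cross h3 h1"
  by (cases h1; cases h2; cases h3; cases y) (simp add: det3_def algebra_simps)

text \<open>Four linear functionals in dimension three are dependent; the coefficients are their 3
  by 3 minors.\<close>

lemma four_functionals:
  "det3 b c d * dot3 a x + det3 a b d * dot3 c x = det3 a c d * dot3 b x + det3 a b c * dot3 d x"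
  by (cases a; cases b; cases c; cases d; cases x) (simp add: det3_def algebra_simps)

lemma mod_neq_of_close:
  fixes i j n :: int
  assumes "i \<noteq> j" "\<bar>i - j\<bar> < n" shows "i mod n \<noteq> j mod n"
proof
  assume "i mod n = j mod n"
  then have "n dvd i - j" by (simp add: mod_eq_dvd_iff)
  then show False using dvd_imp_le_int[of "i - j" n] assms by auto
qed

text \<open>Stated for rays in \<open>\<real>\<^sup>3\<close>, so that it applies to the vertices of a polygon as well as to its side lines.\<close>
lemma convex_chain_det_pos:
  fixes w :: "int \<Rightarrow> vec3"
  assumes pos: "\<And>i j. j mod n \<noteq> i mod n \<Longrightarrow> j mod n \<noteq> (i + 1) mod n \<Longrightarrow> 0 < det3 (w i) (w (i + 1)) (w j)"
    and "i < j" "j < k" "k < i + n"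
  shows "0 < det3 (w i) (w j) (w k)"
proof -
  have first: "0 < det3 (w i) (w (i + 1)) (w l)" if "i + 1 < l" "l < i + n" for l
    using that by (intro pos mod_neq_of_close) auto
  show ?thesis
  proof (cases "j = i + 1")
    case True
    then show ?thesis using first assms by auto
  next
    case False
    show ?thesis
      using \<open>j < k\<close> \<open>k < i + n\<close>
    proof (induction k rule: int_gr_induct)
      case base
      have "0 < det3 (w j) (w (j + 1)) (w i)"
        using assms base False by (intro pos mod_neq_of_close) auto
      then show ?case by (metis det3_rotate)
    next
      case (step l)
      have "0 < det3 (w l) (w (l + 1)) (w i)"
        using assms step False by (intro pos mod_neq_of_close) auto
      then have "0 < det3 (w i) (w l) (w (l + 1))" by (metis det3_rotate)
      \<comment> \<open>Seen from \<open>w i\<close>, the rays turn monotonically. The Pluecker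
        relation with auxiliary ray \<open>w (i + 1)\<close> composes the turn from \<open>j\<close>
        to \<open>l\<close> with the turn from \<open>l\<close> to \<open>l + 1\<close>.\<close>
      then have "0 < det3 (w i) (w j) (w l) * det3 (w i) (w (i + 1)) (w (l + 1))
          + det3 (w i) (w (i + 1)) (w j) * det3 (w i) (w l) (w (l + 1))"
        using step first[of "l + 1"] first[of j] assms False by (intro add_pos_pos mult_pos_pos) auto
      then have "0 < det3 (w i) (w j) (w (l + 1)) * det3 (w i) (w (i + 1)) (w l)"
        by (simp only: pluecker[of "w i" "w j" "w (l + 1)" "w (i + 1)" "w l"])
      then show ?case using first[of l] step assms False by (simp add: zero_less_mult_iff)
    qed
  qed
qed

text \<open>\<open>H z\<close> is a vector of the Minkowski space \<open>\<real>\<^sup>1\<^sup>,\<^sup>2\<close> on the ray representing the point \<open>z\<close> of the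
  closed disk; hyperbolic lines become planes through the origin.\<close>
definition H :: "complex \<Rightarrow> vec3" where
  "H z = (1 + (cmod z)\<^sup>2, 2 * Re z, 2 * Im z)"

fun mink :: "vec3 \<Rightarrow> vec3 \<Rightarrow> real" where
  "mink (t, x, y) (t', x', y') = t * t' - x * x' - y * y'"

text \<open>The closed future light cone, apex included. Its closure under nonnegative combinations
  replaces arguments on convexity of the closed disk.\<close>

definition fcone :: "vec3 set" where "fcone = {u. 0 \<le> fst u \<and> 0 \<le> mink u u}"

lemma mink_H: "mink (H z) (H z) = (1 - (cmod z)\<^sup>2)\<^sup>2"
  by (simp only: H_def cmod_power2 mink.simps) algebra

lemma H_fcone: "H z \<in> fcone"
  unfolding fcone_def by (auto simp: mink_H) (simp add: H_def)

lemma fst_H_pos: "0 < fst (H z)"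
  by (simp add: H_def add_pos_nonneg)

text \<open>Cauchy-Schwarz for the space parts, each of which is bounded by its time part.\<close>

lemma mink_fcone_nonneg:
  assumes "u \<in> fcone" "v \<in> fcone" shows "0 \<le> mink u v"
proof -
  obtain t x y where u: "u = (t, x, y)" by (cases u)
  obtain t' x' y' where v: "v = (t', x', y')" by (cases v)
  have a: "0 \<le> t" "0 \<le> t'" "x\<^sup>2 + y\<^sup>2 \<le> t\<^sup>2" "x'\<^sup>2 + y'\<^sup>2 \<le> t'\<^sup>2"
    using assms unfolding fcone_def u v by (auto simp: power2_eq_square)
  have "(x * x' + y * y')\<^sup>2 \<le> (x\<^sup>2 + y\<^sup>2) * (x'\<^sup>2 + y'\<^sup>2)"
    using zero_le_power2[of "x * y' - y * x'"] by (simp add: power2_eq_square algebra_simps)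
  also have "\<dots> \<le> t\<^sup>2 * t'\<^sup>2" using a by (intro mult_mono) auto
  finally have "(x * x' + y * y')\<^sup>2 \<le> (t * t')\<^sup>2" by (simp add: power_mult_distrib)
  then have "x * x' + y * y' \<le> t * t'" by (rule power2_le_imp_le) (use a in simp)
  then show ?thesis by (simp add: u v)
qed

lemma mink_comb:
  "mink (x *\<^sub>R u + y *\<^sub>R v) (x *\<^sub>R u + y *\<^sub>R v) = x\<^sup>2 * mink u u + 2 * (x * y) * mink u v + y\<^sup>2 * mink v v"
  by (cases u; cases v) (simp add: power2_eq_square algebra_simps)

lemma fcone_comb:
  assumes "u \<in> fcone" "v \<in> fcone" "0 \<le> x" "0 \<le> y"
  shows "x *\<^sub>R u + y *\<^sub>R v \<in> fcone"
  using assms mink_fcone_nonneg[OF assms(1,2)] unfolding fcone_def by (auto simp: mink_comb)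

lemma fcone_point:
  assumes "0 < fst u" "0 < mink u u"
  obtains z c where "z \<in> disk" "0 < c" "u = c *\<^sub>R H z"
proof -
  obtain t x y where u: "u = (t, x, y)" by (cases u)
  \<comment> \<open>Inverts \<open>H\<close> by stereographic projection: for
    \<open>u = c *\<^sub>R H z\<close> the time coordinate is \<open>c * (1 + |z|^2)\<close> and the
    root is \<open>c * (1 - |z|^2)\<close>, so \<open>r = 2 * c\<close> and
    \<open>z = (x, y) / r\<close>.\<close>
  define r where "r = t + sqrt (mink u u)"
  have r: "r > 0" "(r - t)\<^sup>2 = t\<^sup>2 - (x\<^sup>2 + y\<^sup>2)" "r > t"
    using assms by (auto simp: r_def u add_pos_nonneg power2_eq_square)
  define z where "z = Complex (x / r) (y / r)"
  have q: "(cmod z)\<^sup>2 = (x\<^sup>2 + y\<^sup>2) / r\<^sup>2"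
    by (simp add: z_def cmod_power2 power_divide add_divide_distrib)
  have n: "x\<^sup>2 + y\<^sup>2 = r * (2 * t - r)" using r(2) by (simp add: power2_eq_square algebra_simps)
  have q': "(cmod z)\<^sup>2 = 2 * t / r - 1" unfolding q n using r by (simp add: power2_eq_square field_simps)
  also have "\<dots> < 1" using r by (simp add: field_simps)
  finally have "cmod z < 1" using abs_square_less_1[of "cmod z"] by simp
  moreover have "u = (r / 2) *\<^sub>R H z" unfolding H_def q' using r by (simp add: u z_def)
  ultimately show ?thesis using r that[of z "r / 2"] by (simp add: disk_def)
qed

text \<open>A vector with time part \<open>t\<close> and space part \<open>z\<close> is read as the
  Hermitian matrix with diagonal \<open>t, t\<close> and upper right entry \<open>z\<close>, whose
  determinant is \<open>mink u u\<close>. The formula is \<open>M X M^*\<close> for the matrix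
  \<open>M\<close> with rows \<open>a, b\<close> and \<open>cnj b, cnj a\<close>.\<close>

definition mobM :: "complex \<Rightarrow> complex \<Rightarrow> vec3 \<Rightarrow> vec3" where
  "mobM a b u = (let t = fst u; z = Complex (fst (snd u)) (snd (snd u));
      w = of_real (2 * t) * a * b + a\<^sup>2 * z + b\<^sup>2 * cnj z
    in (((cmod a)\<^sup>2 + (cmod b)\<^sup>2) * t + 2 * Re (a * cnj b * z), Re w, Im w))"

lemma mobM_linear: "mobM a b (x *\<^sub>R u + y *\<^sub>R v) = x *\<^sub>R mobM a b u + y *\<^sub>R mobM a b v"
  by (cases u; cases v) (simp add: mobM_def Let_def power2_eq_square algebra_simps)

lemma mobM_inverse: "mobM (cnj a) (- b) (mobM a b u) = ((cmod a)\<^sup>2 - (cmod b)\<^sup>2)\<^sup>2 *\<^sub>R u"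
  by (cases u; cases a; cases b)
    (simp add: mobM_def Let_def power2_eq_square cmod_power2[unfolded power2_eq_square] algebra_simps)

lemma mink_mobM: "mink (mobM a b u) (mobM a b u) = ((cmod a)\<^sup>2 - (cmod b)\<^sup>2)\<^sup>2 * mink u u"
  by (cases u; cases a; cases b)
    (simp add: mobM_def Let_def power2_eq_square cmod_power2[unfolded power2_eq_square] algebra_simps)

text \<open>Multilinearity reduces the claim to the images of the standard basis and avoids
  expanding a polynomial in all coordinates.\<close>

lemma det3_mobM:
  "det3 (mobM a b u) (mobM a b v) (mobM a b w) = ((cmod a)\<^sup>2 - (cmod b)\<^sup>2) ^ 3 * det3 u v w"
proof -
  let ?M = "mobM a b"
  define e1 e2 e3 :: vec3 where e: "e1 = (1, 0, 0)" "e2 = (0, 1, 0)" "e3 = (0, 0, 1)"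
  have lin: "?M (x, y, z) = x *\<^sub>R ?M e1 + y *\<^sub>R ?M e2 + z *\<^sub>R ?M e3" for x y z
    using mobM_linear[of a b 1 "x *\<^sub>R e1 + y *\<^sub>R e2" z e3] mobM_linear[of a b x e1 y e2]
    by (simp add: e)
  have mult: "det3 (x *\<^sub>R p + y *\<^sub>R q + z *\<^sub>R r) (x' *\<^sub>R p + y' *\<^sub>R q + z' *\<^sub>R r)
      (x'' *\<^sub>R p + y'' *\<^sub>R q + z'' *\<^sub>R r) = det3 p q r * det3 (x, y, z) (x', y', z') (x'', y'', z'')"
    for p q r and x y z x' y' z' x'' y'' z'' :: real
    by (cases p; cases q; cases r) (simp add: det3_def algebra_simps)
  have "det3 (?M e1) (?M e2) (?M e3) = ((cmod a)\<^sup>2 - (cmod b)\<^sup>2) ^ 3"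
    by (cases a; cases b) (simp add: e det3_def mobM_def Let_def power2_eq_square power3_eq_cube
        cmod_power2[unfolded power2_eq_square] algebra_simps)
  then show ?thesis using mult by (cases u; cases v; cases w) (simp only: lin)
qed

lemma mobM_H:
  assumes "cnj b * z + cnj a \<noteq> 0"
  shows "mobM a b (H z) = (cmod (cnj b * z + cnj a))\<^sup>2 *\<^sub>R H (mob a b z)"
proof -
  define N D where "N = a * z + b" and "D = cnj b * z + cnj a"
  have D: "(cmod D)\<^sup>2 \<noteq> 0" using assms D_def by simp
  have m: "mob a b z = N / D" by (simp add: mob_def N_def D_def)
  define W where "W = N / D"
  have "of_real ((cmod D)\<^sup>2) * W = N * cnj D"
    using assms unfolding complex_norm_square by (simp add: D_def W_def)
  then have q: "Re (N * cnj D) = (cmod D)\<^sup>2 * Re W" "Im (N * cnj D) = (cmod D)\<^sup>2 * Im W"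
    by (metis Re_complex_of_real Im_complex_of_real times_complex.sel mult_zero_left diff_zero add_0_right)+
  have "(cmod D)\<^sup>2 * (cmod W)\<^sup>2 = (cmod N)\<^sup>2"
    using D by (simp add: W_def norm_divide power_divide)
  then have "(cmod D)\<^sup>2 *\<^sub>R H W = ((cmod D)\<^sup>2 + (cmod N)\<^sup>2, 2 * Re (N * cnj D), 2 * Im (N * cnj D))"
    unfolding H_def q by (simp add: distrib_left)
  also have "\<dots> = mobM a b (H z)"
    unfolding N_def D_def H_def
    by (cases z; cases a; cases b)
      (simp add: mobM_def Let_def power2_eq_square cmod_power2[unfolded power2_eq_square] algebra_simps)
  finally show ?thesis by (simp add: m D_def W_def)
qed

lemma mob_den_nz:
  assumes "disk_aut_params a b" "cmod z \<le> 1" shows "cnj b * z + cnj a \<noteq> 0"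
proof
  assume "cnj b * z + cnj a = 0"
  then have "cmod a = cmod (cnj b * z)"
    by (metis add_eq_0_iff complex_mod_cnj norm_minus_cancel)
  also have "\<dots> \<le> cmod b * 1" unfolding norm_mult complex_mod_cnj using assms by (intro mult_left_mono) auto
  finally have "(cmod a)\<^sup>2 \<le> (cmod b)\<^sup>2" by (simp add: power_mono)
  then show False using assms(1) unfolding disk_aut_params_def by linarith
qed

lemma mob_norm:
  assumes "disk_aut_params a b" "cmod z \<le> 1"
  shows "(1 - (cmod (mob a b z))\<^sup>2) * (cmod (cnj b * z + cnj a))\<^sup>2 = 1 - (cmod z)\<^sup>2"
proof -
  have "(cmod (cnj b * z + cnj a))\<^sup>2 - (cmod (a * z + b))\<^sup>2 = ((cmod a)\<^sup>2 - (cmod b)\<^sup>2) * (1 - (cmod z)\<^sup>2)"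
    by (cases a; cases b; cases z)
      (simp add: power2_eq_square cmod_power2[unfolded power2_eq_square] algebra_simps)
  also have "\<dots> = 1 - (cmod z)\<^sup>2" using assms(1) by (simp add: disk_aut_params_def)
  finally show ?thesis
    using mob_den_nz[OF assms] by (simp add: mob_def norm_divide power_divide left_diff_distrib)
qed

lemma mob_cball:
  assumes "disk_aut_params a b" "cmod z \<le> 1" shows "cmod (mob a b z) \<le> 1"
proof (rule ccontr)
  assume "\<not> ?thesis"
  then have "(1 - (cmod (mob a b z))\<^sup>2) < 0" by (simp add: one_less_power)
  then have "(1 - (cmod (mob a b z))\<^sup>2) * (cmod (cnj b * z + cnj a))\<^sup>2 < 0"
    using mob_den_nz[OF assms] by (intro mult_neg_pos) auto
  then have "1 < (cmod z)\<^sup>2" unfolding mob_norm[OF assms] by simp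
  moreover have "(cmod z)\<^sup>2 \<le> 1" using assms by (simp add: power_le_one)
  ultimately show False by simp
qed

lemma mob_norm_eq_1:
  assumes "disk_aut_params a b" "cmod z \<le> 1" shows "cmod (mob a b z) = 1 \<longleftrightarrow> cmod z = 1"
proof -
  have "cmod w = 1 \<longleftrightarrow> 1 - (cmod w)\<^sup>2 = 0" for w
    using power2_eq_iff_nonneg[of "cmod w" 1] by auto
  then show ?thesis using mob_norm[OF assms] mob_den_nz[OF assms] by (metis mult_eq_0_iff norm_eq_zero zero_eq_power2)
qed

lemma mob_disk: "disk_aut_params a b \<Longrightarrow> z \<in> disk \<Longrightarrow> mob a b z \<in> disk"
  using mob_cball[of a b z] mob_norm_eq_1[of a b z] by (auto simp: disk_def)

lemma mob_circ: "disk_aut_params a b \<Longrightarrow> z \<in> circ \<Longrightarrow> mob a b z \<in> circ"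
  using mob_norm_eq_1[of a b z] by (auto simp: circ_def)

lemma disk_aut_params_inv: "disk_aut_params a b \<Longrightarrow> disk_aut_params (cnj a) (- b)"
  by (simp add: disk_aut_params_def)

lemma disk_aut_params_complex: "disk_aut_params a b \<longleftrightarrow> a * cnj a - b * cnj b = 1"
proof -
  have "a * cnj a - b * cnj b = of_real ((cmod a)\<^sup>2 - (cmod b)\<^sup>2)"
    by (simp only: of_real_diff complex_norm_square)
  then show ?thesis unfolding disk_aut_params_def by (metis of_real_eq_1_iff)
qed

lemma mob_inverse:
  assumes "disk_aut_params a b" "cmod z \<le> 1"
  shows "mob (cnj a) (- b) (mob a b z) = z"
proof -
  let ?N = "a * z + b" and ?D = "cnj b * z + cnj a"
  have D: "?D \<noteq> 0" using mob_den_nz[OF assms] .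
  have e: "a * cnj a - b * cnj b = 1" using assms by (simp add: disk_aut_params_complex)
  have "cnj a * (?N / ?D) - b = (cnj a * ?N - b * ?D) / ?D" "a - cnj b * (?N / ?D) = (a * ?D - cnj b * ?N) / ?D"
    using D by (simp_all add: field_simps)
  moreover have "cnj a * ?N - b * ?D = (a * cnj a - b * cnj b) * z"
    "a * ?D - cnj b * ?N = a * cnj a - b * cnj b" by (simp_all add: algebra_simps)
  ultimately show ?thesis using D e by (simp add: mob_def)
qed

lemma mob_inverse':
  assumes "disk_aut_params a b" "cmod z \<le> 1"
  shows "mob a b (mob (cnj a) (- b) z) = z"
  using mob_inverse[OF disk_aut_params_inv[OF assms(1)] assms(2)] by simp

lemma mobM_H_pos:
  assumes "disk_aut_params a b" "cmod z \<le> 1"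
  obtains c where "0 < c" "mobM a b (H z) = c *\<^sub>R H (mob a b z)"
  using mobM_H[OF mob_den_nz[OF assms]] mob_den_nz[OF assms] that by (metis zero_less_norm_iff zero_less_power)

lemma mobM_cancel:
  assumes "disk_aut_params a b" "mobM a b u = mobM a b v" shows "u = v"
proof -
  have "mobM (cnj a) (- b) (mobM a b u) = u" for u
    unfolding mobM_inverse using assms(1) by (simp add: disk_aut_params_def)
  then show ?thesis using assms(2) by metis
qed

text \<open>Dividing all coefficients by \<open>sqrt (1 - |p|^2)\<close> normalises
  \<open>phi p\<close>, so that everything known about \<open>mob\<close> applies to it.\<close>

lemma phi_as_mob:
  assumes "p \<in> disk"
  obtains a b where "disk_aut_params a b" "phi p = mob a b" "phi_inv p = mob (cnj a) (- b)"
proof -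
  define r where "r = sqrt (1 - (cmod p)\<^sup>2)"
  have lt: "(cmod p)\<^sup>2 < 1" using assms abs_square_less_1[of "cmod p"] by (simp add: disk_def)
  then have r: "r > 0" "r\<^sup>2 = 1 - (cmod p)\<^sup>2" by (simp_all add: r_def)
  have s: "(cmod (1 / of_real r))\<^sup>2 - (cmod (- p / of_real r))\<^sup>2 = (1 - (cmod p)\<^sup>2) / r\<^sup>2"
    by (simp add: norm_divide power_divide diff_divide_distrib)
  have "disk_aut_params (1 / of_real r) (- p / of_real r)"
    unfolding disk_aut_params_def s using r lt by simp
  moreover have "phi p z = mob (1 / of_real r) (- p / of_real r) z" for z
  proof -
    have "1 / of_real r * z + - p / of_real r = (z - p) / of_real r"
      "cnj (- p / of_real r) * z + cnj (1 / of_real r) = (1 - cnj p * z) / of_real r"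
      using r by (simp_all add: field_simps)
    then show ?thesis using r by (simp add: phi_def mob_def)
  qed
  moreover have "phi_inv p z = mob (cnj (1 / of_real r)) (- (- p / of_real r)) z" for z
  proof -
    have "cnj (1 / of_real r) * z + - (- p / of_real r) = (z + p) / of_real r"
      "cnj (- (- p / of_real r)) * z + cnj (cnj (1 / of_real r)) = (1 + cnj p * z) / of_real r"
      using r by (simp_all add: field_simps)
    then show ?thesis using r by (simp add: phi_inv_def mob_def)
  qed
  ultimately show ?thesis using that by blast
qed

lemma phi_cball: "p \<in> disk \<Longrightarrow> cmod z \<le> 1 \<Longrightarrow> cmod (phi p z) \<le> 1"
  by (metis phi_as_mob mob_cball)

lemma phi_disk: "p \<in> disk \<Longrightarrow> z \<in> disk \<Longrightarrow> phi p z \<in> disk"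
  by (metis phi_as_mob mob_disk)

lemma phi_circ_iff: "p \<in> disk \<Longrightarrow> cmod z \<le> 1 \<Longrightarrow> cmod (phi p z) = 1 \<longleftrightarrow> cmod z = 1"
  by (metis phi_as_mob mob_norm_eq_1)

lemma phi_self [simp]: "phi p p = 0"
  by (simp add: phi_def)

lemma phi_inv_phi: "p \<in> disk \<Longrightarrow> cmod z \<le> 1 \<Longrightarrow> phi_inv p (phi p z) = z"
  by (metis phi_as_mob mob_inverse)

lemma phi_phi_inv: "p \<in> disk \<Longrightarrow> cmod z \<le> 1 \<Longrightarrow> phi p (phi_inv p z) = z"
  by (metis phi_as_mob mob_inverse')

lemma phi_inv_circ: "p \<in> disk \<Longrightarrow> z \<in> circ \<Longrightarrow> phi_inv p z \<in> circ"
  by (metis phi_as_mob mob_circ disk_aut_params_inv)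

lemma disk_imp_cball: "p \<in> disk \<Longrightarrow> cmod p \<le> 1"
  by (simp add: disk_def)

lemma phi_eq_0_iff: "p \<in> disk \<Longrightarrow> cmod z \<le> 1 \<Longrightarrow> phi p z = 0 \<longleftrightarrow> z = p"
  using phi_inv_phi[of p z] phi_inv_phi[of p p] disk_imp_cball[of p] by auto

text \<open>Both sides are disk automorphisms vanishing at \<open>p\<close>, so they differ by a
  rotation. Explicitly \<open>u\<close> is \<open>cnj D / D\<close> with \<open>D\<close> the
  denominator of \<open>mob a b\<close> at \<open>p\<close>.\<close>

lemma phi_mob:
  assumes "disk_aut_params a b" "p \<in> disk"
  obtains u where "cmod u = 1" "\<And>z. cmod z \<le> 1 \<Longrightarrow> phi (mob a b p) (mob a b z) = u * phi p z"
proof -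
  let ?D = "\<lambda>z. cnj b * z + cnj a" and ?N = "\<lambda>z. a * z + b"
  have Dp: "?D p \<noteq> 0" using mob_den_nz[OF assms(1)] assms(2) by (simp add: disk_def)
  have e: "a * cnj a - b * cnj b = 1" using assms by (simp add: disk_aut_params_complex)
  have "phi (mob a b p) (mob a b z) = cnj (?D p) / ?D p * phi p z" if "cmod z \<le> 1" for z
  proof -
    have Dz: "?D z \<noteq> 0" using mob_den_nz[OF assms(1) that] .
    have "mob a b z - mob a b p = (?N z * ?D p - ?N p * ?D z) / (?D z * ?D p)"
      using Dp Dz by (simp add: mob_def divide_simps)
    also have "?N z * ?D p - ?N p * ?D z = (a * cnj a - b * cnj b) * (z - p)" by (simp add: algebra_simps)
    finally have 1: "mob a b z - mob a b p = (z - p) / (?D z * ?D p)" using e by simp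
    have cD: "cnj (?D p) \<noteq> 0" using Dp by (simp only: complex_cnj_zero_iff) simp
    have "1 - cnj (mob a b p) * mob a b z = 1 - (cnj (?N p) / cnj (?D p)) * (?N z / ?D z)"
      by (simp add: mob_def)
    also have "\<dots> = (cnj (?D p) * ?D z - cnj (?N p) * ?N z) / (cnj (?D p) * ?D z)"
      using cD Dz by (simp add: diff_divide_distrib)
    also have "cnj (?D p) * ?D z - cnj (?N p) * ?N z = (a * cnj a - b * cnj b) * (1 - cnj p * z)"
      by (simp add: algebra_simps)
    finally have 2: "1 - cnj (mob a b p) * mob a b z = (1 - cnj p * z) / (cnj (?D p) * ?D z)"
      using e by simp
    have "(x / (dz * dp)) / (y / (dp' * dz)) = dp' / dp * (x / y)" if "dz \<noteq> 0" for x y dz dp dp' :: complex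
      using that by simp
    from this[OF Dz] show ?thesis unfolding phi_def 1 2 .
  qed
  moreover have "cmod (cnj (?D p) / ?D p) = 1" unfolding norm_divide complex_mod_cnj using Dp by simp
  ultimately show ?thesis using that by blast
qed

text \<open>\<open>phi p\<close> moves \<open>p\<close> to the centre, where geodesics through it
  become diameters; the sign of \<open>y\<close> then tells on which side of \<open>p\<close> the
  point lies.\<close>

lemma H_collinear_imp_phi:
  assumes "p \<in> disk" "q \<in> disk" "cmod z \<le> 1" "H z = x *\<^sub>R H p + y *\<^sub>R H q"
  obtains c where "0 < c" "phi p z = of_real (c * y) * phi p q"
proof -
  obtain a b where ab: "disk_aut_params a b" "phi p = mob a b" using phi_as_mob[OF assms(1)] by metis
  obtain cz where cz: "0 < cz" "mobM a b (H z) = cz *\<^sub>R H (phi p z)"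
    using mobM_H_pos[OF ab(1) assms(3)] ab(2) by metis
  obtain cp where cp: "0 < cp" "mobM a b (H p) = cp *\<^sub>R H (phi p p)"
    using mobM_H_pos[OF ab(1) disk_imp_cball[OF assms(1)]] ab(2) by metis
  obtain cq where cq: "0 < cq" "mobM a b (H q) = cq *\<^sub>R H (phi p q)"
    using mobM_H_pos[OF ab(1) disk_imp_cball[OF assms(2)]] ab(2) by metis
  have "cz *\<^sub>R H (phi p z) = x *\<^sub>R cp *\<^sub>R H 0 + y *\<^sub>R cq *\<^sub>R H (phi p q)"
    unfolding cz(2)[symmetric] assms(4) mobM_linear cp cq by simp
  then have "cz * Re (phi p z) = y * cq * Re (phi p q)" "cz * Im (phi p z) = y * cq * Im (phi p q)"
    by (simp_all add: H_def)
  then have "phi p z = of_real ((cq / cz) * y) * phi p q"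
    using cz by (simp add: complex_eq_iff field_simps)
  then show ?thesis using that[of "cq / cz"] cz cq by simp
qed

lemma phi_imp_H_collinear:
  assumes "p \<in> disk" "q \<in> disk" "cmod z \<le> 1" "phi p z = of_real s * phi p q"
  obtains c x where "0 < c" "H z = x *\<^sub>R H p + (c * s) *\<^sub>R H q" "0 \<le> s \<Longrightarrow> s \<le> 1 \<Longrightarrow> 0 \<le> x"
proof -
  obtain a b where ab: "disk_aut_params a b" "phi p = mob a b" using phi_as_mob[OF assms(1)] by metis
  obtain cz where cz: "0 < cz" "mobM a b (H z) = cz *\<^sub>R H (phi p z)"
    using mobM_H_pos[OF ab(1) assms(3)] ab(2) by metis
  obtain cp where cp: "0 < cp" "mobM a b (H p) = cp *\<^sub>R H (phi p p)"
    using mobM_H_pos[OF ab(1) disk_imp_cball[OF assms(1)]] ab(2) by metis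
  obtain cq where cq: "0 < cq" "mobM a b (H q) = cq *\<^sub>R H (phi p q)"
    using mobM_H_pos[OF ab(1) disk_imp_cball[OF assms(2)]] ab(2) by metis
  let ?w = "phi p q"
  \<comment> \<open>Solves the time coordinate \<open>1 + s^2 |w|^2 = k + s (1 + |w|^2)\<close>; the
    space coordinates agree automatically.\<close>
  define k where "k = (1 - s) * (1 - s * (cmod ?w)\<^sup>2)"
  have "H (phi p z) = k *\<^sub>R H 0 + s *\<^sub>R H ?w"
    unfolding assms(4) by (simp add: H_def k_def norm_mult power_mult_distrib power2_eq_square algebra_simps)
  then have "mobM a b (H z) = (cz * k / cp) *\<^sub>R mobM a b (H p) + (cz * s / cq) *\<^sub>R mobM a b (H q)"
    unfolding cz cp cq using cp cq by (simp add: scaleR_add_right)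
  also have "\<dots> = mobM a b ((cz * k / cp) *\<^sub>R H p + (cz * s / cq) *\<^sub>R H q)" by (simp only: mobM_linear)
  finally have "H z = (cz * k / cp) *\<^sub>R H p + (cz / cq * s) *\<^sub>R H q"
    using mobM_cancel[OF ab(1)] by simp
  moreover have "0 \<le> cz * k / cp" if "0 \<le> s" "s \<le> 1"
  proof -
    have "cmod ?w \<le> 1" using phi_cball[OF assms(1) disk_imp_cball[OF assms(2)]] .
    then have "s * (cmod ?w)\<^sup>2 \<le> 1 * 1" using that by (intro mult_mono) (auto simp: power_le_one)
    then show ?thesis using that cz cp by (simp add: k_def)
  qed
  ultimately show ?thesis using cz cq by (intro that[of "cz / cq" "cz * k / cp"]) auto
qed

text \<open>Moving \<open>p\<close> to the centre changes the determinant by positive factors only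
  and turns it into a planar cross product.\<close>

lemma det3_H_phi:
  assumes "p \<in> disk" "q \<in> disk" "cmod z \<le> 1"
  obtains c where "0 < c" "det3 (H p) (H q) (H z) = c * Im (phi p z * cnj (phi p q))"
proof -
  obtain a b where ab: "disk_aut_params a b" "phi p = mob a b" using phi_as_mob[OF assms(1)] by metis
  obtain cz where cz: "0 < cz" "mobM a b (H z) = cz *\<^sub>R H (phi p z)"
    using mobM_H_pos[OF ab(1) assms(3)] ab(2) by metis
  obtain cp where cp: "0 < cp" "mobM a b (H p) = cp *\<^sub>R H (phi p p)"
    using mobM_H_pos[OF ab(1) disk_imp_cball[OF assms(1)]] ab(2) by metis
  obtain cq where cq: "0 < cq" "mobM a b (H q) = cq *\<^sub>R H (phi p q)"
    using mobM_H_pos[OF ab(1) disk_imp_cball[OF assms(2)]] ab(2) by metis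
  have "det3 (H p) (H q) (H z) = det3 (mobM a b (H p)) (mobM a b (H q)) (mobM a b (H z))"
    using ab(1) by (simp add: det3_mobM disk_aut_params_def)
  also have "\<dots> = (4 * cp * cq * cz) * Im (phi p z * cnj (phi p q))"
    unfolding cz cp cq by (simp add: H_def det3_def algebra_simps)
  finally show ?thesis using that[of "4 * cp * cq * cz"] cz cp cq by simp
qed

lemma strictly_left_of_iff:
  assumes "p \<in> disk" "q \<in> disk" "cmod z \<le> 1"
  shows "strictly_left_of p q z \<longleftrightarrow> 0 < det3 (H p) (H q) (H z)"
  using det3_H_phi[OF assms] unfolding strictly_left_of_def by (metis zero_less_mult_pos mult_pos_pos)

lemma left_of_iff:
  assumes "p \<in> disk" "q \<in> disk" "cmod z \<le> 1"
  shows "left_of p q z \<longleftrightarrow> 0 \<le> det3 (H p) (H q) (H z)"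
proof -
  obtain c where "0 < c" "det3 (H p) (H q) (H z) = c * Im (phi p z * cnj (phi p q))"
    using det3_H_phi[OF assms] .
  then show ?thesis unfolding left_of_def by (simp add: zero_le_mult_iff)
qed

text \<open>A line has two ideal endpoints; the sign of the coefficient of \<open>H q\<close>
  decides between them.\<close>

lemma geodesic_endpoint_unique:
  assumes "p \<in> disk" "q \<in> disk" "p \<noteq> q" "e \<in> circ" "H e = x *\<^sub>R H p + y *\<^sub>R H q" "y \<noteq> 0"
  shows "e = phi_inv p (of_real (sgn y) * sgn (phi p q))"
proof -
  have e: "cmod e = 1" using assms by (simp add: circ_def)
  obtain c where c: "0 < c" "phi p e = of_real (c * y) * phi p q"
    using H_collinear_imp_phi[OF assms(1,2) _ assms(5)] e by (metis order_refl)
  have "cmod (phi p e) = 1" using phi_circ_iff[OF assms(1)] e by simp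
  then have "phi p e = sgn (phi p e)" by (simp add: sgn_div_norm)
  also have "\<dots> = of_real (sgn y) * sgn (phi p q)"
    unfolding c sgn_mult sgn_of_real using c(1) by simp
  finally show ?thesis using phi_inv_phi[OF assms(1), of e] e by simp
qed

lemma geo_start_eqI:
  assumes "p \<in> disk" "q \<in> disk" "p \<noteq> q" "e \<in> circ" "H e = x *\<^sub>R H p + y *\<^sub>R H q" "y < 0"
  shows "e = geo_start p q"
  using geodesic_endpoint_unique[OF assms(1-5)] assms(6) by (simp add: geo_start_def)

lemma geo_end_eqI:
  assumes "p \<in> disk" "q \<in> disk" "p \<noteq> q" "e \<in> circ" "H e = x *\<^sub>R H p + y *\<^sub>R H q" "0 < y"
  shows "e = geo_end p q"
  using geodesic_endpoint_unique[OF assms(1-5)] assms(6) by (simp add: geo_end_def)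

lemma mink_H_pos: "p \<in> disk \<Longrightarrow> 0 < mink (H p) (H p)"
proof -
  assume "p \<in> disk"
  then have "(cmod p)\<^sup>2 < 1" using abs_square_less_1[of "cmod p"] by (simp add: disk_def)
  then show ?thesis unfolding mink_H by simp
qed

lemma geo_start_H:
  assumes "p \<in> disk" "q \<in> disk" "p \<noteq> q"
  obtains x y where "0 < x" "0 < y" "H (geo_start p q) = x *\<^sub>R H p - y *\<^sub>R H q" "geo_start p q \<in> circ"
proof -
  let ?w = "phi p q" and ?e = "geo_start p q"
  have w: "?w \<noteq> 0" using phi_eq_0_iff[OF assms(1) disk_imp_cball[OF assms(2)]] assms(3) by auto
  have s: "- sgn ?w \<in> circ" using w by (simp add: circ_def norm_sgn)
  then have e: "?e \<in> circ" unfolding geo_start_def by (rule phi_inv_circ[OF assms(1)])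
  have "phi p ?e = - sgn ?w"
    unfolding geo_start_def using phi_phi_inv[OF assms(1), of "- sgn ?w"] s by (simp add: circ_def)
  also have "\<dots> = of_real (- 1 / cmod ?w) * ?w" by (simp add: sgn_div_norm scaleR_conv_of_real field_simps)
  finally obtain c x where c: "0 < c" "H ?e = x *\<^sub>R H p + (c * (- 1 / cmod ?w)) *\<^sub>R H q"
    using phi_imp_H_collinear[OF assms(1,2), of ?e] e by (metis circ_def mem_sphere_0 order_refl)
  define y where "y = c / cmod ?w"
  have y: "0 < y" using c w by (simp add: y_def)
  have h: "H ?e = x *\<^sub>R H p - y *\<^sub>R H q" using c(2) by (simp add: y_def)
  then have "fst (H ?e) = x * fst (H p) - y * fst (H q)" by simp
  then have "0 < x * fst (H p) - y * fst (H q)" using fst_H_pos[of ?e] by simp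
  moreover have "0 < y * fst (H q)" using y fst_H_pos by simp
  ultimately have "0 < x * fst (H p)" by linarith
  then have "0 < x" using fst_H_pos[of p] by (simp add: zero_less_mult_iff)
  then show ?thesis using that y h e by blast
qed

lemma geo_end_H:
  assumes "p \<in> disk" "q \<in> disk" "p \<noteq> q"
  obtains x y where "0 < x" "0 < y" "H (geo_end p q) = y *\<^sub>R H q - x *\<^sub>R H p" "geo_end p q \<in> circ"
proof -
  obtain x y where xy: "0 < x" "0 < y" "H (geo_start q p) = x *\<^sub>R H q - y *\<^sub>R H p" "geo_start q p \<in> circ"
    using geo_start_H[OF assms(2,1)] assms(3) by metis
  have "geo_start q p = geo_end p q"
    by (rule geo_end_eqI[OF assms xy(4), of "- y" x]) (use xy in simp_all)
  then show ?thesis using that xy by metis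
qed

section \<open>Geodesic segments, their images and angles\<close>

lemma norm_phi_commute: "cmod (phi p z) = cmod (phi z p)"
proof -
  have "cmod (1 - cnj p * z) = cmod (cnj (1 - cnj p * z))" by (rule complex_mod_cnj[symmetric])
  also have "cnj (1 - cnj p * z) = 1 - cnj z * p" by (simp add: mult.commute)
  finally show ?thesis by (simp add: phi_def norm_divide norm_minus_commute)
qed

lemma hdist_phi: "hdist p z = ln ((1 + cmod (phi p z)) / (1 - cmod (phi p z)))"
  by (simp add: hdist_def Let_def flip: phi_def norm_phi_commute[of p z])

text \<open>The addition theorem of the hyperbolic tangent: the moduli are \<open>tanh\<close> of
  half the distances.\<close>

lemma hdist_add_cmod:
  fixes x y z :: real
  assumes "0 \<le> x" "x < 1" "0 \<le> y" "y < 1" "0 \<le> z" "z < 1"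
    and "ln ((1 + x) / (1 - x)) + ln ((1 + y) / (1 - y)) = ln ((1 + z) / (1 - z))"
  shows "x + y = z * (1 + x * y)"
proof -
  have "ln ((1 + x) / (1 - x) * ((1 + y) / (1 - y))) = ln ((1 + z) / (1 - z))"
    using assms by (subst ln_mult_pos) auto
  then have "(1 + x) / (1 - x) * ((1 + y) / (1 - y)) = (1 + z) / (1 - z)"
    using assms by (subst (asm) ln_inj_iff) auto
  then have "(1 + x) * (1 + y) * (1 - z) = (1 + z) * ((1 - x) * (1 - y))"
    using assms by (simp add: frac_eq_eq)
  then show ?thesis by (simp add: algebra_simps)
qed

text \<open>The case of equality in the triangle inequality, with \<open>p\<close> moved to the
  centre. Squaring leaves \<open>(X - m) * (1 + m^2 - S) = 0\<close> with a positive second factor,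
  and \<open>X = m\<close> is equality in Cauchy-Schwarz, so \<open>v\<close> is a nonnegative
  multiple of \<open>w\<close>.\<close>

lemma hseg_collinear:
  assumes "p \<in> disk" "q \<in> disk" "p \<noteq> q" "z \<in> hseg p q"
  obtains x y where "0 \<le> x" "0 \<le> y" "H z = x *\<^sub>R H p + y *\<^sub>R H q"
proof -
  define v w where "v = phi p z" and "w = phi p q"
  have z: "z \<in> disk" "hdist p z + hdist z q = hdist p q" using assms by (auto simp: hseg_def)
  have vw: "v \<in> disk" "w \<in> disk" using phi_disk assms z by (auto simp: v_def w_def)
  have w0: "w \<noteq> 0" using phi_eq_0_iff[OF assms(1) disk_imp_cball[OF assms(2)]] assms(3) by (auto simp: w_def)
  define r where "r = cmod (phi z q)"
  obtain a b where ab: "disk_aut_params a b" "phi p = mob a b" using phi_as_mob[OF assms(1)] by metis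
  have "cmod (phi v w) = r"
    using phi_mob[OF ab(1) z(1)] disk_imp_cball[OF assms(2)] unfolding v_def w_def ab(2) r_def
    by (metis mult_1 norm_mult)
  then have rr: "r = cmod (w - v) / cmod (1 - cnj v * w)" by (simp add: phi_def norm_divide)
  have r: "0 \<le> r" "r < 1" using phi_disk[OF z(1) assms(2)] by (auto simp: r_def disk_def)
  have n: "cmod v < 1" "cmod w < 1" using vw by (auto simp: disk_def)
  have "cmod v + r = cmod w * (1 + cmod v * r)"
    using z(2) n r unfolding hdist_phi v_def[symmetric] w_def[symmetric] r_def[symmetric]
    by (intro hdist_add_cmod) auto
  then have e: "r * (1 - cmod v * cmod w) = cmod w - cmod v" by (simp add: algebra_simps)
  have m: "cmod v * cmod w < 1" using n mult_strict_mono[of "cmod v" 1 "cmod w" 1] by auto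
  then have le: "cmod v \<le> cmod w" using e r mult_nonneg_nonneg[of r "1 - cmod v * cmod w"] by linarith
  define X m S where "X = Re (cnj v * w)" and "m = cmod v * cmod w" and "S = (cmod v)\<^sup>2 + (cmod w)\<^sup>2"
  have d1: "(cmod (w - v))\<^sup>2 = S - 2 * X" "(cmod (1 - cnj v * w))\<^sup>2 = 1 - 2 * X + m\<^sup>2"
    unfolding X_def S_def m_def by (simp_all add: cmod_power2 power_mult_distrib, simp_all add: power2_eq_square algebra_simps)
  have "1 - cnj v * w \<noteq> 0"
  proof
    assume "1 - cnj v * w = 0"
    then have "cmod (cnj v * w) = 1" by simp
    then show False using m by (simp add: norm_mult m_def)
  qed
  then have "cmod (w - v) = r * cmod (1 - cnj v * w)" using rr by simp
  then have "cmod (w - v) * (1 - m) = (cmod w - cmod v) * cmod (1 - cnj v * w)"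
    using e unfolding m_def by (metis mult.assoc mult.commute)
  then have "(S - 2 * X) * (1 - m)\<^sup>2 = (cmod w - cmod v)\<^sup>2 * (1 - 2 * X + m\<^sup>2)"
    unfolding d1[symmetric] power_mult_distrib[symmetric] by simp
  also have "(cmod w - cmod v)\<^sup>2 = S - 2 * m" unfolding S_def m_def by (simp add: power2_eq_square algebra_simps)
  finally have "(X - m) * (1 + m\<^sup>2 - S) = 0" by (simp add: power2_eq_square algebra_simps)
  moreover have "1 + m\<^sup>2 - S = (1 - (cmod v)\<^sup>2) * (1 - (cmod w)\<^sup>2)"
    unfolding S_def m_def by (simp add: power2_eq_square algebra_simps)
  moreover have "(cmod v)\<^sup>2 < 1" "(cmod w)\<^sup>2 < 1" using n by (simp_all add: abs_square_less_1)
  ultimately have Xm: "X = m" by auto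
  define s where "s = cmod v / cmod w"
  have s: "0 \<le> s" "s \<le> 1" using le w0 by (auto simp: s_def)
  have "(cmod (v - of_real s * w))\<^sup>2 = (cmod v)\<^sup>2 - 2 * s * X + s\<^sup>2 * (cmod w)\<^sup>2"
    unfolding X_def by (simp add: cmod_power2, simp add: power2_eq_square algebra_simps)
  also have "\<dots> = 0" unfolding Xm m_def s_def using w0 by (simp add: power2_eq_square field_simps)
  finally have "v = of_real s * w" by simp
  then obtain c x where "0 < c" "H z = x *\<^sub>R H p + (c * s) *\<^sub>R H q" "0 \<le> x"
    using phi_imp_H_collinear[OF assms(1,2) disk_imp_cball[OF z(1)], of s] s unfolding v_def w_def by metis
  then show ?thesis using that[of x "c * s"] s by simp
qed

lemma geo_start_eq_geo_end:
  assumes "p \<in> disk" "q \<in> disk" "p \<noteq> q" shows "geo_start p q = geo_end q p"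
proof -
  obtain x y where "0 < x" "H (geo_start p q) = x *\<^sub>R H p - y *\<^sub>R H q" "geo_start p q \<in> circ"
    using geo_start_H[OF assms] .
  then show ?thesis using geo_end_eqI[OF assms(2,1) assms(3)[symmetric], of "geo_start p q" "- y" x] by simp
qed

lemma hseg_ends:
  assumes "p \<in> disk" "q \<in> disk" shows "p \<in> hseg p q" "q \<in> hseg p q"
  using assms by (simp_all add: hseg_def hdist_phi)

lemma H_independent:
  assumes "p \<in> disk" "q \<in> disk" "p \<noteq> q" "x *\<^sub>R H p = y *\<^sub>R H q"
  shows "y = 0"
proof (rule ccontr)
  assume y: "y \<noteq> 0"
  have "H q = (1 / y) *\<^sub>R (y *\<^sub>R H q)" using y by simp
  also have "\<dots> = (x / y) *\<^sub>R H p + 0 *\<^sub>R H q" by (simp flip: assms(4))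
  finally obtain c where "phi p q = of_real (c * 0) * phi p q"
    using H_collinear_imp_phi[OF assms(1,2) disk_imp_cball[OF assms(2)]] by metis
  then show False using phi_eq_0_iff[OF assms(1) disk_imp_cball[OF assms(2)]] assms(3) by simp
qed

text \<open>An endpoint of a segment spans an extremal ray of the cone over the segment, so it is the image of an endpoint.\<close>
lemma hseg_image_start:
  assumes ab: "disk_aut_params a b" and d: "p \<in> disk" "q \<in> disk" "p' \<in> disk" "q' \<in> disk"
    and ne: "p \<noteq> q" "p' \<noteq> q'" and img: "mob a b ` hseg p q = hseg p' q'"
  shows "mob a b p = p' \<or> mob a b q = p'"
proof -
  let ?T = "mob a b"
  have T: "?T p \<in> disk" "?T q \<in> disk" using mob_disk[OF ab] d by auto
  obtain z where z: "z \<in> hseg p q" "p' = ?T z" using hseg_ends[OF d(3,4)] img by blast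
  have zd: "z \<in> disk" using z by (simp add: hseg_def)
  obtain x y where xy: "0 \<le> x" "0 \<le> y" "H z = x *\<^sub>R H p + y *\<^sub>R H q"
    using hseg_collinear[OF d(1,2) ne(1) z(1)] .
  have "?T p \<in> hseg p' q'" "?T q \<in> hseg p' q'" using img hseg_ends[OF d(1,2)] by auto
  then obtain \<alpha> \<beta> \<gamma> \<delta> where g: "0 \<le> \<alpha>" "0 \<le> \<beta>" "H (?T p) = \<alpha> *\<^sub>R H p' + \<beta> *\<^sub>R H q'"
    "0 \<le> \<gamma>" "0 \<le> \<delta>" "H (?T q) = \<gamma> *\<^sub>R H p' + \<delta> *\<^sub>R H q'"
    using hseg_collinear[OF d(3,4) ne(2)] by metis
  obtain c where c: "0 < c" "mobM a b (H z) = c *\<^sub>R H (?T z)" using mobM_H_pos[OF ab disk_imp_cball[OF zd]] .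
  obtain cp where cp: "0 < cp" "mobM a b (H p) = cp *\<^sub>R H (?T p)" using mobM_H_pos[OF ab disk_imp_cball[OF d(1)]] .
  obtain cq where cq: "0 < cq" "mobM a b (H q) = cq *\<^sub>R H (?T q)" using mobM_H_pos[OF ab disk_imp_cball[OF d(2)]] .
  have "c *\<^sub>R H p' = x *\<^sub>R cp *\<^sub>R (\<alpha> *\<^sub>R H p' + \<beta> *\<^sub>R H q') + y *\<^sub>R cq *\<^sub>R (\<gamma> *\<^sub>R H p' + \<delta> *\<^sub>R H q')"
    unfolding g(3,6)[symmetric] cp(2)[symmetric] cq(2)[symmetric] mobM_linear[symmetric] xy(3)[symmetric]
    using c z(2) by simp
  then have "(c - x * cp * \<alpha> - y * cq * \<gamma>) *\<^sub>R H p' = (x * cp * \<beta> + y * cq * \<delta>) *\<^sub>R H q'"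
    by (simp add: algebra_simps)
  from H_independent[OF d(3,4) ne(2) this] have "x * cp * \<beta> + y * cq * \<delta> = 0" .
  then have "x * cp * \<beta> = 0" "y * cq * \<delta> = 0"
    using xy cp cq g by (simp_all add: add_nonneg_eq_0_iff)
  moreover have "x \<noteq> 0 \<or> y \<noteq> 0" using xy(3) fst_H_pos[of z] by auto
  ultimately have "\<beta> = 0 \<or> \<delta> = 0" using cp cq by auto
  then show ?thesis
  proof
    assume "\<beta> = 0"
    then obtain k where "phi p' (?T p) = of_real (k * 0) * phi p' q'"
      using H_collinear_imp_phi[OF d(3,4) disk_imp_cball[OF T(1)] g(3)] by metis
    then show ?thesis using phi_eq_0_iff[OF d(3) disk_imp_cball[OF T(1)]] by simp
  next
    assume "\<delta> = 0"
    then obtain k where "phi p' (?T q) = of_real (k * 0) * phi p' q'"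
      using H_collinear_imp_phi[OF d(3,4) disk_imp_cball[OF T(2)] g(6)] by metis
    then show ?thesis using phi_eq_0_iff[OF d(3) disk_imp_cball[OF T(2)]] by simp
  qed
qed

lemma hseg_commute:
  assumes "p \<in> disk" "q \<in> disk" shows "hseg p q = hseg q p"
proof -
  have "hdist x y = hdist y x" for x y unfolding hdist_phi by (simp add: norm_phi_commute[of x y])
  then show ?thesis unfolding hseg_def by (metis add.commute)
qed

lemma hseg_image_ends:
  assumes ab: "disk_aut_params a b" and d: "p \<in> disk" "q \<in> disk" "p' \<in> disk" "q' \<in> disk"
    and ne: "p \<noteq> q" "p' \<noteq> q'" and img: "mob a b ` hseg p q = hseg p' q'"
  shows "mob a b p = p' \<and> mob a b q = q' \<or> mob a b p = q' \<and> mob a b q = p'"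
  using hseg_image_start[OF ab d ne img] hseg_image_start[OF ab d(1,2,4,3) ne(1) ne(2)[symmetric]]
    img hseg_commute[OF d(3,4)] ne by metis

lemma Arg_sum_pi:
  assumes "x \<noteq> 0" "y \<noteq> 0" "Arg x + Arg y = pi"
  obtains r where "0 < r" "x * y = - of_real r"
proof -
  have "x * y = of_real (cmod x * cmod y) * cis (Arg x + Arg y)"
    using rcis_cmod_Arg[of x, symmetric] rcis_cmod_Arg[of y, symmetric]
    unfolding rcis_def by (metis cis_mult mult.assoc mult.left_commute of_real_mult)
  then have "x * y = - of_real (cmod x * cmod y)" using assms(3) by simp
  then show ?thesis using that[of "cmod x * cmod y"] assms by simp
qed

text \<open>The conclusion says that the geodesic from \<open>mob a b r\<close> to \<open>mob a b p\<close> continues to \<open>s'\<close>.\<close>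
lemma supplementary_angles:
  assumes ab: "disk_aut_params a b" and d: "p \<in> disk" "q \<in> disk" "r \<in> disk" "s' \<in> disk"
    and ne: "p \<noteq> q" "p \<noteq> r" "s' \<noteq> mob a b p"
    and ang: "hangle r p q + hangle (mob a b q) (mob a b p) s' = pi
      \<or> hangle s' (mob a b p) (mob a b q) + hangle q p r = pi"
  obtains c x where "0 < c" "H (mob a b r) = x *\<^sub>R H (mob a b p) - c *\<^sub>R H s'"
proof -
  let ?T = "mob a b"
  have T: "?T p \<in> disk" "?T q \<in> disk" "?T r \<in> disk" using mob_disk[OF ab] d by auto
  obtain u where u: "cmod u = 1" "\<And>z. cmod z \<le> 1 \<Longrightarrow> phi (?T p) (?T z) = u * phi p z"
    using phi_mob[OF ab d(1)] by blast
  have u0: "u \<noteq> 0" using u by auto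
  define R Q S where "R = phi (?T p) (?T r)" and "Q = phi (?T p) (?T q)" and "S = phi (?T p) s'"
  have RQ: "R = u * phi p r" "Q = u * phi p q" unfolding R_def Q_def using u(2) disk_imp_cball d by auto
  have nz: "R \<noteq> 0" "Q \<noteq> 0" "S \<noteq> 0"
    unfolding RQ S_def using u0 phi_eq_0_iff[OF d(1)] phi_eq_0_iff[OF T(1)] disk_imp_cball d ne by auto
  have quot: "phi p r / phi p q = R / Q" "phi p q / phi p r = Q / R" using u0 by (simp_all add: RQ)
  have "\<exists>k>0. R = of_real (- k) * S"
    using ang
  proof
    assume "hangle r p q + hangle (?T q) (?T p) s' = pi"
    then have "Arg (R / Q) + Arg (Q / S) = pi"
      unfolding hangle_def quot Q_def[symmetric] S_def[symmetric] .
    then obtain k where "0 < k" "(R / Q) * (Q / S) = - of_real k"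
      using Arg_sum_pi[of "R / Q" "Q / S"] nz by auto
    then show ?thesis using nz by (auto simp: field_simps)
  next
    assume "hangle s' (?T p) (?T q) + hangle q p r = pi"
    then have "Arg (S / Q) + Arg (Q / R) = pi"
      unfolding hangle_def quot Q_def[symmetric] S_def[symmetric] .
    then obtain k where k: "0 < k" "(S / Q) * (Q / R) = - of_real k"
      using Arg_sum_pi[of "S / Q" "Q / R"] nz by auto
    then have "S = - of_real k * R" using nz by (simp add: field_simps)
    then have "R = of_real (- (1 / k)) * S" using k by simp
    then show ?thesis using k by (intro exI[of _ "1 / k"]) simp
  qed
  then obtain k where k: "k > 0" "R = of_real (- k) * S" by blast
  obtain c x where "0 < c" "H (?T r) = x *\<^sub>R H (?T p) + (c * (- k)) *\<^sub>R H s'"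
    using phi_imp_H_collinear[OF T(1) d(4) disk_imp_cball[OF T(3)], of "- k"] k(2)
    unfolding R_def S_def by metis
  then show ?thesis using that[of "c * k" x] k(1) by simp
qed

section \<open>Canonical polygons\<close>

lemma mobM_fcone:
  assumes "u \<in> fcone" shows "mobM a b u \<in> fcone"
proof -
  obtain t x y where u: "u = (t, x, y)" by (cases u)
  let ?z = "Complex x y"
  have t: "0 \<le> t" "(cmod ?z)\<^sup>2 \<le> t\<^sup>2" using assms unfolding cmod_power2 by (auto simp: u fcone_def power2_eq_square)
  have z: "cmod ?z \<le> t" by (rule power2_le_imp_le[OF t(2,1)])
  have "- Re (a * cnj b * ?z) \<le> cmod (a * cnj b * ?z)" using abs_Re_le_cmod[of "a * cnj b * ?z"] by linarith
  also have "\<dots> \<le> cmod a * cmod b * t" using z by (simp add: norm_mult mult_left_mono)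
  finally have "- 2 * Re (a * cnj b * ?z) \<le> 2 * cmod a * cmod b * t" by simp
  moreover have "0 \<le> (cmod a - cmod b)\<^sup>2 * t" using t by simp
  moreover have "(cmod a - cmod b)\<^sup>2 * t = ((cmod a)\<^sup>2 + (cmod b)\<^sup>2) * t - 2 * cmod a * cmod b * t"
    by (simp add: power2_eq_square algebra_simps)
  ultimately have "0 \<le> ((cmod a)\<^sup>2 + (cmod b)\<^sup>2) * t + 2 * Re (a * cnj b * ?z)" by linarith
  then have "0 \<le> fst (mobM a b u)" by (simp add: mobM_def Let_def u)
  then show ?thesis using assms by (simp add: fcone_def mink_mobM)
qed

lemma continuous_on_det3_H: "continuous_on S (\<lambda>z. det3 u v (H z))"
proof -
  obtain x y w where h: "cross u v = (x, y, w)" by (cases "cross u v")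
  show ?thesis unfolding det3_def h H_def dot3.simps by (intro continuous_intros)
qed

lemma continuous_on_mob: "disk_aut_params a b \<Longrightarrow> continuous_on disk (mob a b)"
  unfolding mob_def using mob_den_nz[of a b] by (intro continuous_intros) (auto simp: disk_def)

lemma det3_linear_diff: "det3 u v (x *\<^sub>R w - y *\<^sub>R w') = x * det3 u v w - y * det3 u v w'"
  using det3_linear[of u v x w "- y" w'] by simp

lemma det3_scale: "det3 (x *\<^sub>R u) (y *\<^sub>R v) (z *\<^sub>R w) = x * y * z * det3 u v w"
  by (cases u; cases v; cases w) (simp add: det3_def algebra_simps)

lemma det3_line: "det3 (x *\<^sub>R u) (y *\<^sub>R u - z *\<^sub>R v) w = x * z * det3 v u w"
  by (cases u; cases v; cases w) (simp add: det3_def algebra_simps)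

lemma det3_line2:
  "det3 (x *\<^sub>R u - y *\<^sub>R v) (y' *\<^sub>R v - x' *\<^sub>R u) w = (x * y' - y * x') * det3 u v w"
  by (cases u; cases v; cases w) (simp add: det3_def algebra_simps)

lemma fcone_interior_add:
  assumes "0 < fst u" "0 < mink u u" "v \<in> fcone" "0 \<le> y"
  shows "0 < fst (u + y *\<^sub>R v)" "0 < mink (u + y *\<^sub>R v) (u + y *\<^sub>R v)"
proof -
  have u: "u \<in> fcone" using assms by (simp add: fcone_def)
  have v: "0 \<le> fst v" "0 \<le> mink v v" using assms by (auto simp: fcone_def)
  show "0 < fst (u + y *\<^sub>R v)" using assms v by (simp add: add_pos_nonneg)
  show "0 < mink (u + y *\<^sub>R v) (u + y *\<^sub>R v)"
    using mink_comb[of 1 u y v] mink_fcone_nonneg[OF u assms(3)] assms v by (simp add: add_pos_nonneg)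
qed

lemma pairing_pairing: "pairing g (pairing g k) = k"
  by (simp add: pairing_def)

locale canonical =
  fixes g :: nat and n :: int and V a b :: "int \<Rightarrow> complex"
  assumes g2: "g \<ge> 2" and n_eq: "n = 8 * int g - 4"
    and canon: "canonical_polygon_setup g V a b"
begin

abbreviation s :: "int \<Rightarrow> int" where "s \<equiv> pairing g"
abbreviation T :: "int \<Rightarrow> complex \<Rightarrow> complex" where "T k \<equiv> mob (a k) (b k)"
abbreviation HV :: "int \<Rightarrow> vec3" where "HV k \<equiv> H (V k)"
abbreviation dt :: "int \<Rightarrow> vec3 \<Rightarrow> real" where "dt k \<equiv> det3 (H (V k)) (H (V (k + 1)))"

lemma n_ge: "n \<ge> 12" using g2 n_eq by simp

lemma V_per: "V (k + n) = V k" and V_disk: "V k \<in> disk"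
  and V_left: "j mod n \<noteq> k mod n \<Longrightarrow> j mod n \<noteq> (k + 1) mod n \<Longrightarrow> strictly_left_of (V k) (V (k + 1)) (V j)"
  using canon unfolding canonical_polygon_setup_def convex_ccw_polygon_def Let_def n_eq by blast+

lemma ab: "disk_aut_params (a k) (b k)"
  using canon unfolding canonical_polygon_setup_def Let_def by blast

lemma V_cball: "cmod (V k) \<le> 1" using V_disk disk_imp_cball by blast

lemma V_per_int: "V (k + j * n) = V k"
  using quasi_periodic_int[of V n 0 k j] V_per by simp

lemma V_cong: "i mod n = j mod n \<Longrightarrow> V (i + c) = V (j + c)"
proof -
  assume "i mod n = j mod n"
  then obtain m where "i - j = n * m" by (auto simp: mod_eq_dvd_iff elim: dvdE)
  then have "i + c = (j + c) + m * n" by (simp add: algebra_simps)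
  then show ?thesis by (simp only: V_per_int)
qed

lemma sigma_V: "V (sigma g k + c) = V (s k + c)"
  by (rule V_cong) (simp add: sigma_def pairing_def Let_def n_eq)

lemma det_pos: "j mod n \<noteq> k mod n \<Longrightarrow> j mod n \<noteq> (k + 1) mod n \<Longrightarrow> 0 < dt k (HV j)"
  using V_left[of j k] strictly_left_of_iff[OF V_disk V_disk V_cball] by blast

lemma det_pos': "k + 1 < j \<Longrightarrow> j < k + n \<Longrightarrow> 0 < dt k (HV j)"
  by (intro det_pos mod_neq_of_close) auto

lemma det_nonneg: "0 \<le> dt k (HV j)"
proof (cases "j mod n = k mod n \<or> j mod n = (k + 1) mod n")
  case True
  then have "V j = V k \<or> V j = V (k + 1)" using V_cong[of j k 0] V_cong[of j "k + 1" 0] by auto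
  then show ?thesis by auto
qed (use det_pos in \<open>auto intro: less_imp_le\<close>)

text \<open>Needed for points in the interior of side \<open>k\<close>: together with
  \<open>det_nonneg\<close> they lie strictly to the left of every other side line.\<close>

lemma det_pos_side:
  assumes "j mod n \<noteq> k mod n" shows "0 < dt j (HV k) \<or> 0 < dt j (HV (k + 1))"
proof (cases "k mod n = (j + 1) mod n")
  case True
  then have "(k + 1) mod n = (j + 1 + 1) mod n" by (metis mod_add_left_eq)
  moreover have "(j + 1 + 1) mod n \<noteq> j mod n" "(j + 1 + 1) mod n \<noteq> (j + 1) mod n"
    using n_ge by (intro mod_neq_of_close; simp)+
  ultimately show ?thesis using det_pos[of "k + 1" j] by simp
next
  case False
  then show ?thesis using det_pos[of k j] assms by auto
qed

lemma V_inj: assumes "i mod n \<noteq> j mod n" shows "V i \<noteq> V j"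
proof
  assume eq: "V i = V j"
  show False
  proof (cases "j mod n = (i + 1) mod n")
    case True
    then have "V j = V (i + 1)" using V_cong[of j "i + 1" 0] by simp
    then show False using det_pos'[of i "i + 2"] n_ge eq by simp
  next
    case False
    then show False using det_pos[of j i] assms eq by simp
  qed
qed

lemma V_neq: "V k \<noteq> V (k + 1)" "V (k - 1) \<noteq> V k" "V (k + 1) \<noteq> V k" "V k \<noteq> V (k - 1)"
  using n_ge by (intro V_inj mod_neq_of_close; simp)+

lemma side_image: "T k ` hseg (V k) (V (k + 1)) = hseg (V (s k)) (V (s k + 1))"
proof -
  have "T k ` side V k = side V (sigma g k)"
    using canon unfolding canonical_polygon_setup_def Let_def by blast
  then show ?thesis using sigma_V[of k 0] sigma_V[of k 1] by (simp add: side_def)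
qed

definition inner :: "complex set" where
  "inner = {z \<in> disk. \<forall>j\<in>{0..<n}. 0 < dt j (H z)}"

lemma inner_subset: "inner \<subseteq> polygon n V"
proof
  fix z assume z: "z \<in> inner"
  have "left_of (V k) (V (k + 1)) z" for k
  proof -
    have "0 < dt (k mod n) (H z)" using z n_ge by (simp add: inner_def)
    moreover have "V (k mod n) = V k" "V (k mod n + 1) = V (k + 1)"
      using V_cong[of "k mod n" k 0] V_cong[of "k mod n" k 1] by simp_all
    ultimately show ?thesis using z by (simp add: left_of_iff[OF V_disk V_disk] inner_def disk_def)
  qed
  then show "z \<in> polygon n V" using z by (simp add: polygon_def inner_def)
qed

lemma open_inner: "open inner"
proof -
  have "open {z. 0 < dt j (H z)}" for j
    by (intro open_Collect_less continuous_on_const continuous_on_det3_H)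
  then have "open (disk \<inter> (\<Inter>j\<in>{0..<n}. {z. 0 < dt j (H z)}))"
    by (intro open_Int open_INT) (auto simp: disk_def)
  moreover have "inner = disk \<inter> (\<Inter>j\<in>{0..<n}. {z. 0 < dt j (H z)})" by (auto simp: inner_def)
  ultimately show ?thesis by simp
qed

lemma open_T_inner: "open (T k ` inner)"
proof -
  have "T k ` inner = disk \<inter> mob (cnj (a k)) (- b k) -` inner"
  proof (intro equalityI subsetI)
    fix z assume "z \<in> T k ` inner"
    then obtain w where "w \<in> inner" "z = T k w" by blast
    moreover from this have "w \<in> disk" by (simp add: inner_def)
    ultimately show "z \<in> disk \<inter> mob (cnj (a k)) (- b k) -` inner"
      using mob_disk[OF ab] mob_inverse[OF ab, of w] disk_imp_cball by auto
  next
    fix z assume z: "z \<in> disk \<inter> mob (cnj (a k)) (- b k) -` inner"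
    then have "z = T k (mob (cnj (a k)) (- b k) z)" using mob_inverse'[OF ab] disk_imp_cball by auto
    then show "z \<in> T k ` inner" using z by blast
  qed
  moreover have "open (disk \<inter> mob (cnj (a k)) (- b k) -` inner)"
    using continuous_on_mob[OF disk_aut_params_inv[OF ab]] open_inner
    by (intro continuous_open_preimage) (simp_all add: disk_def)
  ultimately show ?thesis by simp
qed

text \<open>A fixed label would be \<open>2g\<close> or \<open>1\<close> modulo
  \<open>4g - 2\<close>, an even modulus, with the parity opposite to the one assumed.\<close>

lemma pairing_not_fixed: "k mod n \<noteq> s k mod n"
proof
  assume "k mod n = s k mod n"
  then obtain m where m: "s k - k = n * m" by (metis dvdE mod_eq_dvd_iff)
  show False
  proof (cases "odd k")
    case True
    then have "k = 2 * int g - (4 * int g - 2) * m" using m by (simp add: pairing_def n_eq algebra_simps)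
    then have "even k" by simp
    then show False using True by simp
  next
    case False
    then have "k = 1 - (4 * int g - 2) * m" using m by (simp add: pairing_def n_eq algebra_simps)
    then have "odd k" by simp
    then show False using False by simp
  qed
qed

text \<open>Otherwise the tile and its image would lie on the same side of the common side, so their interiors would meet.\<close>
lemma T_reverses_side: "\<not> (T k (V k) = V (s k) \<and> T k (V (k + 1)) = V (s k + 1))"
proof
  assume A: "T k (V k) = V (s k) \<and> T k (V (k + 1)) = V (s k + 1)"
  let ?M = "mobM (cnj (a k)) (- b k)" and ?S = "mob (cnj (a k)) (- b k)"
  let ?m = "s k + 2"
  note ab' = disk_aut_params_inv[OF ab[of k]]
  have S: "?S (V (s k)) = V k" "?S (V (s k + 1)) = V (k + 1)"
    using A mob_inverse[OF ab V_cball] by metis+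
  obtain c1 where c1: "0 < c1" "?M (HV (s k)) = c1 *\<^sub>R HV k"
    using mobM_H_pos[OF ab' V_cball[of "s k"]] S by metis
  obtain c2 where c2: "0 < c2" "?M (HV (s k + 1)) = c2 *\<^sub>R HV (k + 1)"
    using mobM_H_pos[OF ab' V_cball[of "s k + 1"]] S by metis
  define y where "y = ?S (V ?m)"
  obtain c3 where c3: "0 < c3" "?M (HV ?m) = c3 *\<^sub>R H y"
    using mobM_H_pos[OF ab' V_cball[of ?m]] unfolding y_def by metis
  have pm: "0 < dt (s k) (HV ?m)" using n_ge by (intro det_pos') auto
  have "dt (s k) (HV ?m) = det3 (?M (HV (s k))) (?M (HV (s k + 1))) (?M (HV ?m))"
    unfolding det3_mobM using ab'[unfolded disk_aut_params_def] by simp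
  also have "\<dots> = c1 * c2 * c3 * dt k (H y)" unfolding c1 c2 c3 det3_scale ..
  finally have "0 < (c1 * c2 * c3) * dt k (H y)" using pm by simp
  then have py: "0 < dt k (H y)" by (rule zero_less_mult_pos) (use c1 c2 c3 in simp)
  \<comment> \<open>\<open>A' j + e * B' j\<close> is the value of side functional \<open>j\<close>
    at the pullback of a point near side \<open>s k\<close>, displaced by \<open>e\<close> towards
    vertex \<open>?m\<close>. On side \<open>k\<close> itself \<open>A'\<close> vanishes and
    \<open>B'\<close> is positive; for all other sides \<open>A'\<close> is positive, so one small
    \<open>e\<close> serves them all.\<close>
  define A' B' where "A' j = c1 * dt j (HV k) + c2 * dt j (HV (k + 1))" and "B' j = c3 * dt j (H y)" for j
  have "\<forall>\<^sub>F e in at_right 0. 0 < A' j + e * B' j" if "j \<in> {0..<n}" for j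
  proof (cases "j mod n = k mod n")
    case True
    then have "V j = V k" "V (j + 1) = V (k + 1)" using V_cong[of j k 0] V_cong[of j k 1] by auto
    then have "A' j = 0" "0 < B' j" using py c3 by (simp_all add: A'_def B'_def)
    then show ?thesis by (auto intro: eventually_mono[OF eventually_at_right_less])
  next
    case False
    have "0 < dt j (HV k) \<or> 0 < dt j (HV (k + 1))" using det_pos_side[OF False] .
    then have "0 < A' j" unfolding A'_def using c1 c2 det_nonneg[of j k] det_nonneg[of j "k + 1"]
      by (auto intro: add_pos_nonneg add_nonneg_pos)
    moreover have "((\<lambda>e. A' j + e * B' j) \<longlongrightarrow> A' j + 0 * B' j) (at_right 0)"
      by (intro tendsto_intros)
    ultimately show ?thesis by (auto dest: order_tendstoD(1)[where a = 0])
  qed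
  then have "\<forall>\<^sub>F e in at_right 0. \<forall>j\<in>{0..<n}. 0 < A' j + e * B' j"
    by (intro eventually_ball_finite) auto
  then have "\<forall>\<^sub>F e in at_right (0::real). (\<forall>j\<in>{0..<n}. 0 < A' j + e * B' j) \<and> 0 < e"
    by (intro eventually_conj eventually_at_right_less)
  then obtain e :: real where e: "0 < e" "\<And>j. j \<in> {0..<n} \<Longrightarrow> 0 < A' j + e * B' j"
    using eventually_happens'[OF trivial_limit_at_right_real] by blast
  \<comment> \<open>An inner point of side \<open>s k\<close>, moved slightly into the polygon. Both
    it and its pullback will lie in \<open>inner\<close>.\<close>
  define u where "u = (1 *\<^sub>R HV (s k) + 1 *\<^sub>R HV (s k + 1)) + e *\<^sub>R HV ?m"
  have "0 < fst (HV (s k) + 1 *\<^sub>R HV (s k + 1))" "0 < mink (HV (s k) + 1 *\<^sub>R HV (s k + 1)) (HV (s k) + 1 *\<^sub>R HV (s k + 1))"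
    using fcone_interior_add[OF fst_H_pos mink_H_pos[OF V_disk] H_fcone, of 1] by auto
  from fcone_interior_add[OF this H_fcone, of e "V ?m"] e(1)
  have "0 < fst u" "0 < mink u u" unfolding u_def by auto
  then obtain z c where z: "z \<in> disk" "0 < c" "u = c *\<^sub>R H z" using fcone_point by blast
  obtain c' where c': "0 < c'" "?M (H z) = c' *\<^sub>R H (?S z)" using mobM_H_pos[OF ab' disk_imp_cball[OF z(1)]] .
  have "z \<in> inner"
  proof -
    have "0 < dt j (H z)" if "j \<in> {0..<n}" for j
    proof -
      have "c * dt j (H z) = dt j u"
        unfolding z(3) using det3_linear[of _ _ c "H z" 0 "H z"] by simp
      also have "\<dots> = dt j (1 *\<^sub>R (1 *\<^sub>R HV (s k) + 1 *\<^sub>R HV (s k + 1)) + e *\<^sub>R HV ?m)"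
        unfolding u_def by simp
      also have "\<dots> = dt j (HV (s k)) + dt j (HV (s k + 1)) + e * dt j (HV ?m)"
        unfolding det3_linear by simp
      also have "0 < \<dots>"
      proof (cases "j mod n = s k mod n")
        case True
        then have "V j = V (s k)" "V (j + 1) = V (s k + 1)" using V_cong[of j "s k" 0] V_cong[of j "s k" 1] by auto
        then show ?thesis using pm e by simp
      next
        case False
        have "0 < dt j (HV (s k)) \<or> 0 < dt j (HV (s k + 1))" using det_pos_side[OF False] .
        moreover have "0 \<le> e * dt j (HV ?m)" using e(1) det_nonneg by simp
        ultimately show ?thesis using det_nonneg[of j "s k"] det_nonneg[of j "s k + 1"] by linarith
      qed
      finally show ?thesis using z(2) by (simp add: zero_less_mult_iff)
    qed
    then show ?thesis using z(1) by (simp add: inner_def)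
  qed
  moreover have "?S z \<in> inner"
  proof -
    have "u = 1 *\<^sub>R (1 *\<^sub>R HV (s k) + 1 *\<^sub>R HV (s k + 1)) + e *\<^sub>R HV ?m" by (simp add: u_def)
    then have "?M u = 1 *\<^sub>R (1 *\<^sub>R ?M (HV (s k)) + 1 *\<^sub>R ?M (HV (s k + 1))) + e *\<^sub>R ?M (HV ?m)"
      by (simp only: mobM_linear)
    then have "?M u = (c1 *\<^sub>R HV k + c2 *\<^sub>R HV (k + 1)) + (e * c3) *\<^sub>R H y"
      unfolding c1 c2 c3 by simp
    moreover have "?M u = (c * c') *\<^sub>R H (?S z)"
      using mobM_linear[of _ _ c "H z" 0 "H z"] c' unfolding z(3) by simp
    ultimately have eq: "(c * c') *\<^sub>R H (?S z) = 1 *\<^sub>R (c1 *\<^sub>R HV k + c2 *\<^sub>R HV (k + 1)) + (e * c3) *\<^sub>R H y"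
      by simp
    have "0 < dt j (H (?S z))" if "j \<in> {0..<n}" for j
    proof -
      have "(c * c') * dt j (H (?S z)) = dt j ((c * c') *\<^sub>R H (?S z) + 0 *\<^sub>R H y)"
        unfolding det3_linear by simp
      also have "\<dots> = dt j (1 *\<^sub>R (c1 *\<^sub>R HV k + c2 *\<^sub>R HV (k + 1)) + (e * c3) *\<^sub>R H y)"
        using eq by simp
      also have "\<dots> = A' j + e * B' j" unfolding det3_linear A'_def B'_def by simp
      also have "0 < \<dots>" using e(2)[OF that] .
      finally show ?thesis by (rule zero_less_mult_pos) (use z(2) c' in simp)
    qed
    then show ?thesis using mob_disk[OF ab' z(1)] by (simp add: inner_def)
  qed
  then have "T k (?S z) \<in> T k ` inner" by blast
  then have "z \<in> T k ` inner" using mob_inverse'[OF ab disk_imp_cball[OF z(1)]] by simp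
  ultimately have zz: "z \<in> inner \<inter> T k ` inner" by blast
  have "T k ` inner \<subseteq> interior (T k ` polygon n V)"
    using open_T_inner inner_subset by (intro interior_maximal) auto
  moreover have "inner \<subseteq> interior (id ` polygon n V)"
    using open_inner inner_subset by (intro interior_maximal) auto
  ultimately have meet: "interior (T k ` polygon n V) \<inter> interior (id ` polygon n V) \<noteq> {}"
    using zz by blast
  have "T k \<circ> id \<in> gen_group a b" by (intro gen_T gen_id)
  then have G: "T k \<in> gen_group a b" "id \<in> gen_group a b" using gen_id by simp_all
  have FD: "fundamental_domain (gen_group a b) (polygon n V)"
    using canon unfolding canonical_polygon_setup_def Let_def n_eq by blast
  have "\<exists>z\<in>disk. T k z \<noteq> id z"
    using A V_inj[OF pairing_not_fixed[of k]] V_disk[of k] by (intro bexI[of _ "V k"]) auto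
  then show False using FD G meet unfolding fundamental_domain_def by blast
qed

lemma T_V: "T k (V k) = V (s k + 1)" "T k (V (k + 1)) = V (s k)"
  using hseg_image_ends[OF ab V_disk V_disk V_disk V_disk V_neq(1) V_neq(1) side_image[of k]]
    T_reverses_side[of k] by auto

lemma angles: "hangle (V (k - 1)) (V k) (V (k + 1)) + hangle (V (s k)) (V (s k + 1)) (V (s k + 2)) = pi"
proof -
  have "hangle (V (k - 1)) (V k) (V (k + 1)) +
    hangle (V (sigma g k)) (V (sigma g k + 1)) (V (sigma g k + 2)) = pi"
    using canon unfolding canonical_polygon_setup_def Let_def by blast
  then show ?thesis using sigma_V[of k 0] sigma_V[of k 1] sigma_V[of k 2] by simp
qed

text \<open>Together with \<open>T_next\<close> the only use of the angle condition: side
  \<open>k - 1\<close> is carried into the line extending side \<open>s k + 1\<close>, beyond its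
  initial vertex.\<close>

lemma T_prev:
  obtains c x where "0 < c" "H (T k (V (k - 1))) = x *\<^sub>R HV (s k + 1) - c *\<^sub>R HV (s k + 2)"
  using supplementary_angles[OF ab[of k] V_disk[of k] V_disk[of "k + 1"] V_disk[of "k - 1"] V_disk[of "s k + 2"] V_neq(1,4)]
    angles[of k] V_neq(3)[of "s k + 1"] T_V[of k] by (metis add.assoc one_add_one)

lemma T_next:
  obtains c x where "0 < c" "H (T k (V (k + 2))) = x *\<^sub>R HV (s k) - c *\<^sub>R HV (s k - 1)"
proof -
  have "hangle (V (s k - 1)) (V (s k)) (V (s k + 1)) + hangle (V k) (V (k + 1)) (V (k + 2)) = pi"
    using angles[of "s k"] by (simp add: pairing_pairing)
  moreover have "V (k + 1) \<noteq> V (k + 2)" using V_neq(1)[of "k + 1"] by (simp add: algebra_simps)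
  ultimately show ?thesis
    using supplementary_angles[OF ab[of k] V_disk[of "k + 1"] V_disk[of k] V_disk[of "k + 2"] V_disk[of "s k - 1"] V_neq(3)]
      V_neq(2)[of "s k"] T_V[of k] that by metis
qed

end

lemma det3_swap_right: "det3 u w v = - det3 u v w"
  by (cases u; cases v; cases w) (simp add: det3_def algebra_simps)

context canonical
begin

section \<open>Ideal endpoints of the side lines and their images\<close>

definition P :: "int \<Rightarrow> complex" where "P k = Pend V k"
definition Q :: "int \<Rightarrow> complex" where "Q k = Qend V k"

lemma P_H:
  obtains x y where "0 < x" "0 < y" "H (P k) = x *\<^sub>R HV k - y *\<^sub>R HV (k + 1)"
  using geo_start_H[OF V_disk V_disk V_neq(1)] unfolding P_def Pend_def by metis

lemma Q_H:
  obtains x y where "0 < x" "0 < y" "H (Q k) = y *\<^sub>R HV k - x *\<^sub>R HV (k - 1)"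
  using geo_end_H[OF V_disk V_disk V_neq(2)] unfolding Q_def Qend_def by metis

lemma P_circ: "P k \<in> circ" and Q_circ: "Q k \<in> circ"
  using geo_start_H[OF V_disk V_disk V_neq(1)] geo_end_H[OF V_disk V_disk V_neq(2)]
  unfolding P_def Pend_def Q_def Qend_def by metis+

lemma circ_cball: "e \<in> circ \<Longrightarrow> cmod e \<le> 1" by (simp add: circ_def)

lemma mobM_T:
  assumes "e \<in> circ" "H e = x *\<^sub>R HV i + y *\<^sub>R HV j"
  obtains c ci cj where "0 < c" "0 < ci" "0 < cj"
    "H (T k e) = (x * ci / c) *\<^sub>R H (T k (V i)) + (y * cj / c) *\<^sub>R H (T k (V j))"
proof -
  obtain c where c: "0 < c" "mobM (a k) (b k) (H e) = c *\<^sub>R H (T k e)"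
    using mobM_H_pos[OF ab circ_cball[OF assms(1)]] .
  obtain ci where ci: "0 < ci" "mobM (a k) (b k) (HV i) = ci *\<^sub>R H (T k (V i))"
    using mobM_H_pos[OF ab V_cball] .
  obtain cj where cj: "0 < cj" "mobM (a k) (b k) (HV j) = cj *\<^sub>R H (T k (V j))"
    using mobM_H_pos[OF ab V_cball] .
  have "c *\<^sub>R H (T k e) = x *\<^sub>R ci *\<^sub>R H (T k (V i)) + y *\<^sub>R cj *\<^sub>R H (T k (V j))"
    using c ci cj assms(2) mobM_linear[of "a k" "b k" x "HV i" y "HV j"] by simp
  then have "(1 / c) *\<^sub>R c *\<^sub>R H (T k e) = (1 / c) *\<^sub>R (x *\<^sub>R ci *\<^sub>R H (T k (V i)) + y *\<^sub>R cj *\<^sub>R H (T k (V j)))"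
    by simp
  then have "H (T k e) = (x * ci / c) *\<^sub>R H (T k (V i)) + (y * cj / c) *\<^sub>R H (T k (V j))"
    using c(1) by (simp add: scaleR_add_right)
  then show ?thesis using that c ci cj by blast
qed

lemma T_circ: "e \<in> circ \<Longrightarrow> T k e \<in> circ" using mob_circ[OF ab] .

lemma T_P: "T k (P k) = Q (s k + 1)"
proof -
  obtain x y where xy: "0 < x" "0 < y" "H (P k) = x *\<^sub>R HV k - y *\<^sub>R HV (k + 1)" using P_H .
  then have "H (P k) = x *\<^sub>R HV k + (- y) *\<^sub>R HV (k + 1)" by simp
  then obtain c ci cj where c: "0 < c" "0 < ci" "0 < cj"
    "H (T k (P k)) = (x * ci / c) *\<^sub>R HV (s k + 1) + (- y * cj / c) *\<^sub>R HV (s k)"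
    using mobM_T[OF P_circ, of k x k "- y" "k + 1" k] unfolding T_V by metis
  then have "H (T k (P k)) = (- y * cj / c) *\<^sub>R HV (s k) + (x * ci / c) *\<^sub>R HV (s k + 1)"
    by (simp add: add.commute)
  from geo_end_eqI[OF V_disk V_disk V_neq(1) T_circ[OF P_circ] this]
  have "T k (P k) = geo_end (V (s k)) (V (s k + 1))" using c xy by simp
  then show ?thesis by (simp add: Q_def Qend_def)
qed

lemma T_Q_next: "T k (Q (k + 1)) = P (s k)"
proof -
  obtain x y where xy: "0 < x" "0 < y" "H (Q (k + 1)) = y *\<^sub>R HV (k + 1) - x *\<^sub>R HV (k + 1 - 1)" using Q_H .
  then have "H (Q (k + 1)) = y *\<^sub>R HV (k + 1) + (- x) *\<^sub>R HV k" by simp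
  then obtain c ci cj where c: "0 < c" "0 < ci" "0 < cj"
    "H (T k (Q (k + 1))) = (y * ci / c) *\<^sub>R HV (s k) + (- x * cj / c) *\<^sub>R HV (s k + 1)"
    using mobM_T[OF Q_circ, of "k + 1" y "k + 1" "- x" k k] unfolding T_V by metis
  have "T k (Q (k + 1)) = geo_start (V (s k)) (V (s k + 1))"
    by (rule geo_start_eqI[OF V_disk V_disk V_neq(1) T_circ[OF Q_circ] c(4)]) (use c xy in simp_all)
  then show ?thesis by (simp add: P_def Pend_def)
qed

text \<open>By \<open>T_prev\<close> side \<open>k - 1\<close> is carried into the line of side
  \<open>s k + 1\<close> with the same direction, so terminal endpoint goes to terminal endpoint. In
  contrast, \<open>T_P\<close> and \<open>T_Q_next\<close> follow from the reversal of the paired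
  side alone.\<close>

lemma T_Q: "T k (Q k) = Q (s k + 2)"
proof -
  obtain x y where xy: "0 < x" "0 < y" "H (Q k) = y *\<^sub>R HV k - x *\<^sub>R HV (k - 1)" using Q_H .
  then have "H (Q k) = y *\<^sub>R HV k + (- x) *\<^sub>R HV (k - 1)" by simp
  then obtain c ci cj where c: "0 < c" "0 < ci" "0 < cj"
    "H (T k (Q k)) = (y * ci / c) *\<^sub>R HV (s k + 1) + (- x * cj / c) *\<^sub>R H (T k (V (k - 1)))"
    using mobM_T[OF Q_circ, of k y k "- x" "k - 1" k] unfolding T_V by metis
  obtain d z where d: "0 < d" "H (T k (V (k - 1))) = z *\<^sub>R HV (s k + 1) - d *\<^sub>R HV (s k + 2)" using T_prev .
  have "H (T k (Q k)) = (y * ci / c + (- x * cj / c) * z) *\<^sub>R HV (s k + 1) + (x * cj / c * d) *\<^sub>R HV (s k + 1 + 1)"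
    unfolding c(4) d(2) by (simp add: algebra_simps scaleR_add_left)
  from geo_end_eqI[OF V_disk V_disk V_neq(1) T_circ[OF Q_circ] this]
  have "T k (Q k) = geo_end (V (s k + 1)) (V (s k + 1 + 1))" using c d xy by simp
  then show ?thesis by (simp add: Q_def Qend_def algebra_simps)
qed

lemma T_P_next: "T k (P (k + 1)) = P (s k - 1)"
proof -
  obtain x y where xy: "0 < x" "0 < y" "H (P (k + 1)) = x *\<^sub>R HV (k + 1) - y *\<^sub>R HV (k + 1 + 1)" using P_H .
  then have "H (P (k + 1)) = x *\<^sub>R HV (k + 1) + (- y) *\<^sub>R HV (k + 2)" by (simp add: algebra_simps)
  then obtain c ci cj where c: "0 < c" "0 < ci" "0 < cj"
    "H (T k (P (k + 1))) = (x * ci / c) *\<^sub>R HV (s k) + (- y * cj / c) *\<^sub>R H (T k (V (k + 2)))"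
    using mobM_T[OF P_circ, of "k + 1" x "k + 1" "- y" "k + 2" k] unfolding T_V by metis
  obtain d z where d: "0 < d" "H (T k (V (k + 2))) = z *\<^sub>R HV (s k) - d *\<^sub>R HV (s k - 1)" using T_next .
  have "H (T k (P (k + 1))) = (x * ci / c + (- y * cj / c) * z) *\<^sub>R HV (s k) + (y * cj / c * d) *\<^sub>R HV (s k - 1)"
    unfolding c(4) d(2) by (simp add: algebra_simps scaleR_add_left)
  from geo_end_eqI[OF V_disk V_disk V_neq(4) T_circ[OF P_circ] this]
  have "T k (P (k + 1)) = geo_end (V (s k)) (V (s k - 1))" using c d xy by simp
  then show ?thesis
    using geo_start_eq_geo_end[OF V_disk V_disk V_neq(2)[of "s k"]] by (simp add: P_def Pend_def)
qed

section \<open>Lines extending the two neighbours of a side do not meet\<close>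

text \<open>The lines extending sides \<open>k - 1\<close> and \<open>k + 1\<close> meet, in the closed disk, at the point represented by \<open>X\<close>.\<close>
definition meet_outside :: "int \<Rightarrow> bool" where
  "meet_outside k \<longleftrightarrow> (\<exists>X\<in>fcone. dt (k - 1) X = 0 \<and> dt (k + 1) X = 0 \<and> dt k X < 0)"

definition meet_inside :: "int \<Rightarrow> bool" where
  "meet_inside k \<longleftrightarrow> (\<exists>X\<in>fcone. dt (k - 1) X = 0 \<and> dt (k + 1) X = 0 \<and> 0 < dt k X)"

lemma det3_MT: "det3 (mobM (a k) (b k) u) (mobM (a k) (b k) v) (mobM (a k) (b k) w) = det3 u v w"
  using ab[of k] by (simp add: det3_mobM disk_aut_params_def)

text \<open>\<open>T k\<close> exchanges the two sides of the line of side \<open>k\<close> relative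
  to \<open>s k\<close>, and carries the lines of sides \<open>k - 1\<close> and
  \<open>k + 1\<close> to those of \<open>s k + 1\<close> and \<open>s k - 1\<close>.\<close>

lemma meet_outside_imp_inside:
  assumes "meet_outside k" shows "meet_inside (s k)"
proof -
  let ?M = "mobM (a k) (b k)"
  obtain X where X: "X \<in> fcone" "dt (k - 1) X = 0" "dt (k + 1) X = 0" "dt k X < 0"
    using assms unfolding meet_outside_def by blast
  obtain c0 where c0: "0 < c0" "?M (HV (k - 1)) = c0 *\<^sub>R H (T k (V (k - 1)))" using mobM_H_pos[OF ab V_cball] .
  obtain c1 where c1: "0 < c1" "?M (HV k) = c1 *\<^sub>R HV (s k + 1)" using mobM_H_pos[OF ab V_cball] T_V by metis
  obtain c2 where c2: "0 < c2" "?M (HV (k + 1)) = c2 *\<^sub>R HV (s k)" using mobM_H_pos[OF ab V_cball] T_V by metis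
  obtain c3 where c3: "0 < c3" "?M (HV (k + 2)) = c3 *\<^sub>R H (T k (V (k + 2)))" using mobM_H_pos[OF ab V_cball] .
  obtain d z where d: "0 < d" "H (T k (V (k - 1))) = z *\<^sub>R HV (s k + 1) - d *\<^sub>R HV (s k + 2)" using T_prev .
  obtain d' z' where d': "0 < d'" "H (T k (V (k + 2))) = z' *\<^sub>R HV (s k) - d' *\<^sub>R HV (s k - 1)" using T_next .
  have "0 = det3 (?M (HV k)) (?M (HV (k - 1))) (?M X)"
    using X(2) det3_swap[of "HV k" "HV (k - 1)" X] by (simp add: det3_MT)
  also have "\<dots> = det3 (c1 *\<^sub>R HV (s k + 1)) ((c0 * z) *\<^sub>R HV (s k + 1) - (c0 * d) *\<^sub>R HV (s k + 2)) (?M X)"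
    unfolding c1 c0 d by (simp add: scaleR_diff_right)
  also have "\<dots> = c1 * (c0 * d) * det3 (HV (s k + 2)) (HV (s k + 1)) (?M X)" by (rule det3_line)
  finally have 1: "dt (s k + 1) (?M X) = 0"
    using c0 c1 d det3_swap[of "HV (s k + 2)" "HV (s k + 1)" "?M X"] by (simp add: algebra_simps)
  have "0 = det3 (?M (HV (k + 1))) (?M (HV (k + 2))) (?M X)"
    using X(3) by (simp add: det3_MT algebra_simps)
  also have "\<dots> = det3 (c2 *\<^sub>R HV (s k)) ((c3 * z') *\<^sub>R HV (s k) - (c3 * d') *\<^sub>R HV (s k - 1)) (?M X)"
    unfolding c2 c3 d' by (simp add: scaleR_diff_right)
  also have "\<dots> = c2 * (c3 * d') * det3 (HV (s k - 1)) (HV (s k)) (?M X)" by (rule det3_line)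
  finally have 2: "dt (s k - 1) (?M X) = 0" using c2 c3 d' by simp
  have "0 > det3 (?M (HV k)) (?M (HV (k + 1))) (1 *\<^sub>R ?M X)" using X(4) by (simp add: det3_MT)
  also have "det3 (?M (HV k)) (?M (HV (k + 1))) (1 *\<^sub>R ?M X) = c1 * c2 * det3 (HV (s k + 1)) (HV (s k)) (?M X)"
    unfolding c1 c2 det3_scale by simp
  also have "\<dots> = - (c1 * c2) * dt (s k) (?M X)" using det3_swap[of "HV (s k + 1)" "HV (s k)" "?M X"] by simp
  finally have "0 < (c1 * c2) * dt (s k) (?M X)" by simp
  then have "0 < dt (s k) (?M X)" by (rule zero_less_mult_pos) (use c1 c2 in simp)
  then show ?thesis unfolding meet_inside_def using 1 2 mobM_fcone[OF X(1)] by blast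
qed

text \<open>The covector of the plane over a side line, with \<open>dt k\<close> as pairing; lines
  can thus be treated as vectors of the dual space.\<close>

definition side_line :: "int \<Rightarrow> vec3" where "side_line k = cross (HV k) (HV (k + 1))"

lemma dot3_ln': "dot3 (side_line k) w = dt k w" by (simp add: side_line_def det3_def)

lemma side_line_cong: "i mod n = j mod n \<Longrightarrow> side_line i = side_line j"
  unfolding side_line_def using V_cong[of i j 0] V_cong[of i j 1] by simp

lemma side_line_per: "side_line (k + n) = side_line k" by (rule side_line_cong) simp

text \<open>The dual polygon is convex as well: consecutive covectors satisfy the same local
  positivity as consecutive vertices.\<close>

lemma side_line_pos:
  assumes "i < j" "j < k" "k < i + n" shows "0 < det3 (side_line i) (side_line j) (side_line k)"
proof (rule convex_chain_det_pos[OF _ assms])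
  fix i j :: int assume ij: "j mod n \<noteq> i mod n" "j mod n \<noteq> (i + 1) mod n"
  have "0 < dt i (HV (i + 1 + 1))" using n_ge by (intro det_pos') auto
  moreover have "0 < dt j (HV (i + 1))"
  proof (rule det_pos)
    show "(i + 1) mod n \<noteq> j mod n" using ij by simp
    show "(i + 1) mod n \<noteq> (j + 1) mod n"
    proof
      assume "(i + 1) mod n = (j + 1) mod n"
      then have "n dvd i - j" by (simp add: mod_eq_dvd_iff)
      then show False using ij(1) by (simp add: mod_eq_dvd_iff dvd_diff_commute)
    qed
  qed
  ultimately show "0 < det3 (side_line i) (side_line (i + 1)) (side_line j)"
    unfolding side_line_def det3_cross_cross by simp
qed

lemma dt_cross: "dt k (cross (side_line i) (side_line j)) = det3 (side_line i) (side_line j) (side_line k)"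
  unfolding side_line_def[of k] by (rule det3_cross)

text \<open>The lines extending sides \<open>j - 1\<close> and \<open>j + 1\<close> meet at a point of the triangle formed by
  the lines extending sides \<open>k - 1\<close>, \<open>k\<close>, \<open>k + 1\<close>, by Cramer's rule a nonnegative combination of its corners.\<close>
lemma meet_inside_imp_outside:
  assumes "meet_inside k" "k + 1 < j" "j < k - 1 + n"
  shows "meet_outside j"
proof -
  obtain X where X: "X \<in> fcone" "dt (k - 1) X = 0" "dt (k + 1) X = 0" "0 < dt k X"
    using assms unfolding meet_inside_def by blast
  let ?h1 = "side_line (k - 1)" and ?h2 = "side_line k" and ?h3 = "side_line (k + 1)"
  define D where "D = det3 ?h1 ?h2 ?h3"
  have D: "0 < D" unfolding D_def using n_ge by (intro side_line_pos) auto
  have "D *\<^sub>R X = dt k X *\<^sub>R cross ?h3 ?h1"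
    unfolding D_def using cramer[of ?h1 ?h2 ?h3 X] X by (simp add: dot3_ln')
  then have e: "dt k X *\<^sub>R cross ?h3 ?h1 = D *\<^sub>R X" ..
  have "cross ?h3 ?h1 = (1 / dt k X) *\<^sub>R (dt k X *\<^sub>R cross ?h3 ?h1)" using X(4) by simp
  also have "\<dots> = (D / dt k X) *\<^sub>R X + 0 *\<^sub>R X" unfolding e by simp
  finally have c: "cross ?h3 ?h1 = (D / dt k X) *\<^sub>R X + 0 *\<^sub>R X" .
  \<comment> \<open>Corners of the triangle: this one is a positive multiple of the given meeting
    point \<open>X\<close>, the other two are multiples of \<open>V k\<close> and
    \<open>V (k + 1)\<close>.\<close>
  have c31: "cross ?h3 ?h1 \<in> fcone" unfolding c using D X(4) by (intro fcone_comb X(1)) auto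
  have v1: "0 \<le> det3 (HV (k - 1)) (HV k) (HV (k + 1))" "0 \<le> det3 (HV k) (HV (k + 1)) (HV (k + 2))"
    using det_nonneg[of "k - 1" "k + 1"] det_nonneg[of k "k + 2"] by simp_all
  have c12: "cross ?h1 ?h2 \<in> fcone" "cross ?h2 ?h3 \<in> fcone"
    using fcone_comb[OF H_fcone H_fcone v1(1) order_refl, of "V k" 0] fcone_comb[OF H_fcone H_fcone v1(2) order_refl, of "V (k + 1)" 0]
      cross_cross[of "HV (k - 1)" "HV k" "HV (k + 1)"] cross_cross[of "HV k" "HV (k + 1)" "HV (k + 2)"]
    by (simp_all add: side_line_def algebra_simps)
  \<comment> \<open>The intersection of the lines of sides \<open>j - 1\<close> and
    \<open>j + 1\<close>. Its values at the three lines of the triangle are the Cramer coefficients;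
    a value is 0 when the two lines coincide.\<close>
  define Y where "Y = cross (side_line (j - 1)) (side_line (j + 1))"
  have y3: "0 \<le> dt (k + 1) Y"
  proof (cases "k + 1 = j - 1")
    case True
    show ?thesis unfolding Y_def dt_cross True by simp
  next
    case False
    then have "0 < det3 (side_line (k + 1)) (side_line (j - 1)) (side_line (j + 1))" using assms by (intro side_line_pos) auto
    then show ?thesis unfolding Y_def dt_cross by (metis det3_rotate less_imp_le)
  qed
  have y1: "0 \<le> dt (k - 1) Y"
  proof (cases "k - 1 + n = j + 1")
    case True
    then have "side_line (k - 1) = side_line (j + 1)" by (metis side_line_per)
    then show ?thesis unfolding Y_def dt_cross by simp
  next
    case False
    then have "0 < det3 (side_line (j - 1)) (side_line (j + 1)) (side_line (k - 1 + n))" using assms by (intro side_line_pos) auto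
    then show ?thesis unfolding Y_def dt_cross side_line_per by simp
  qed
  have y2: "0 < dt k Y"
    using side_line_pos[of "j - 1" "j + 1" "k + n"] assms unfolding Y_def dt_cross side_line_per by simp
  have "D *\<^sub>R Y = 1 *\<^sub>R (dt (k + 1) Y *\<^sub>R cross ?h1 ?h2 + dt (k - 1) Y *\<^sub>R cross ?h2 ?h3) + dt k Y *\<^sub>R cross ?h3 ?h1"
    unfolding D_def using cramer[of ?h1 ?h2 ?h3 Y] by (simp add: dot3_ln')
  also have "\<dots> \<in> fcone" using y1 y2 y3 c12 c31 by (intro fcone_comb) auto
  finally have DY: "D *\<^sub>R Y \<in> fcone" .
  have dl: "dt i (D *\<^sub>R Y) = D * dt i Y" for i using det3_linear[of _ _ D Y 0 Y] by simp
  have "dt (j - 1) Y = 0" "dt (j + 1) Y = 0" unfolding Y_def dt_cross by simp_all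
  moreover have "dt j Y < 0"
    using side_line_pos[of "j - 1" j "j + 1"] n_ge det3_swap_right[of "side_line (j - 1)" "side_line j" "side_line (j + 1)"]
    unfolding Y_def dt_cross by simp
  ultimately have "dt (j - 1) (D *\<^sub>R Y) = 0 \<and> dt (j + 1) (D *\<^sub>R Y) = 0 \<and> dt j (D *\<^sub>R Y) < 0"
    unfolding dl using D by (simp add: mult_pos_neg)
  then show ?thesis unfolding meet_outside_def using DY by blast
qed

text \<open>Both points are multiples, with factors of opposite sign, of the intersection vector of
  the same two lines. Two vectors of the future cone allow this only with vanishing time coordinate,
  hence only for the apex.\<close>

lemma not_inside_and_outside: "\<not> (meet_inside k \<and> meet_outside k)"
proof
  assume A: "meet_inside k \<and> meet_outside k"
  let ?h1 = "side_line (k - 1)" and ?h2 = "side_line k" and ?h3 = "side_line (k + 1)"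
  obtain X where X: "X \<in> fcone" "dt (k - 1) X = 0" "dt (k + 1) X = 0" "0 < dt k X"
    using A unfolding meet_inside_def by blast
  obtain Y where Y: "Y \<in> fcone" "dt (k - 1) Y = 0" "dt (k + 1) Y = 0" "dt k Y < 0"
    using A unfolding meet_outside_def by blast
  define D where "D = det3 ?h1 ?h2 ?h3"
  have D: "0 < D" unfolding D_def using n_ge by (intro side_line_pos) auto
  have x: "D *\<^sub>R X = dt k X *\<^sub>R cross ?h3 ?h1" and y: "D *\<^sub>R Y = dt k Y *\<^sub>R cross ?h3 ?h1"
    unfolding D_def using cramer[of ?h1 ?h2 ?h3 X] cramer[of ?h1 ?h2 ?h3 Y] X Y by (simp_all add: dot3_ln')
  let ?t = "fst (cross ?h3 ?h1)"
  have "D * fst X = dt k X * ?t" "D * fst Y = dt k Y * ?t" using arg_cong[OF x, of fst] arg_cong[OF y, of fst] by simp_all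
  moreover have "0 \<le> fst X" "0 \<le> fst Y" using X Y by (auto simp: fcone_def)
  moreover from this have "0 \<le> D * fst X" "0 \<le> D * fst Y" using D by simp_all
  ultimately have "0 \<le> dt k X * ?t" "0 \<le> dt k Y * ?t" by linarith+
  then have "?t = 0" using X(4) Y(4) by (auto simp: zero_le_mult_iff)
  then have "fst X = 0" using \<open>D * fst X = dt k X * ?t\<close> D by simp
  then obtain b c where bc: "X = (0, b, c)" by (cases X) auto
  then have "b * b + c * c \<le> 0" using X(1) by (simp add: fcone_def)
  then have "X = (0, 0, 0)" using bc by (simp only: sum_squares_le_zero_iff)
  then have "dt k X = 0" by (simp add: det3_def) (cases "cross (HV k) (HV (k + 1))"; simp)
  then show False using X(4) by simp
qed

lemma meet_outside_cong: "i mod n = j mod n \<Longrightarrow> meet_outside i = meet_outside j"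
  unfolding meet_outside_def
  using V_cong[of i j 0] V_cong[of i j 1] V_cong[of i j "-1"] V_cong[of i j 2]
  by (simp add: algebra_simps)

lemma no_meet_inside: "\<not> meet_inside k"
proof
  assume k: "meet_inside k"
  \<comment> \<open>Wanted is \<open>j\<close> with neither \<open>j\<close> nor \<open>s j\<close>
    congruent to \<open>k - 1\<close>, \<open>k\<close> or \<open>k + 1\<close>. If
    \<open>k + 2\<close> fails, \<open>k + 6\<close> works: it has the same parity, so its partner
    moves by 4, out of this window of three labels, and \<open>n\<close> is too large for it to wrap
    around.\<close>
  have "\<exists>j. k + 1 < j \<and> j < k - 1 + n \<and> (s j - (k - 1)) mod n > 2"
  proof (cases "(s (k + 2) - (k - 1)) mod n > 2")
    case True
    then show ?thesis using n_ge by (intro exI[of _ "k + 2"]) auto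
  next
    case False
    define r where "r = (s (k + 2) - (k - 1)) mod n"
    have r: "0 \<le> r" "r \<le> 2" using False n_ge by (auto simp: r_def)
    have "s (k + 6) - (k - 1) = (s (k + 2) - (k - 1)) - 4" by (simp add: pairing_def)
    then have "(s (k + 6) - (k - 1)) mod n = (r - 4) mod n" unfolding r_def by (metis mod_diff_left_eq)
    also have "\<dots> = (r - 4 + n) mod n" by simp
    also have "\<dots> = r - 4 + n" using r n_ge by (intro mod_pos_pos_trivial) auto
    finally show ?thesis using r n_ge by (intro exI[of _ "k + 6"]) auto
  qed
  then obtain j where j: "k + 1 < j" "j < k - 1 + n" "(s j - (k - 1)) mod n > 2" by blast
  define j' where "j' = k - 1 + (s j - (k - 1)) mod n"
  have "j' mod n = s j mod n" unfolding j'_def by (simp add: mod_add_right_eq)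
  moreover have "k + 1 < j'" "j' < k - 1 + n" using j n_ge by (auto simp: j'_def)
  ultimately have "meet_outside (s j)"
    using meet_inside_imp_outside[OF k, of j'] meet_outside_cong by blast
  moreover have "meet_inside (s j)"
    using meet_inside_imp_outside[OF k j(1,2)] by (rule meet_outside_imp_inside)
  ultimately show False using not_inside_and_outside by blast
qed

lemma no_meet_outside: "\<not> meet_outside k"
  using meet_outside_imp_inside no_meet_inside by blast

end

section \<open>Cyclic order of the ideal endpoints\<close>

lemma det3_H_cis:
  "det3 (H (cis x)) (H (cis y)) (H (cis z)) = 32 * (sin ((y - x) / 2) * sin ((z - y) / 2) * sin ((z - x) / 2))"
proof -
  have "det3 (H (cis x)) (H (cis y)) (H (cis z)) =
    8 * ((cos y - cos x) * (sin z - sin x) - (sin y - sin x) * (cos z - cos x))"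
    by (simp add: H_def det3_def algebra_simps)
  also have "\<dots> = 32 * (sin ((y - x) / 2) * sin ((z - x) / 2) *
     (sin ((x + z) / 2) * cos ((x + y) / 2) - cos ((x + z) / 2) * sin ((x + y) / 2)))"
  proof -
    have 1: "cos y - cos x = - 2 * sin ((x + y) / 2) * sin ((y - x) / 2)"
      "cos z - cos x = - 2 * sin ((x + z) / 2) * sin ((z - x) / 2)"
      using cos_diff_cos[of x y] cos_diff_cos[of x z] by simp_all
    have 2: "sin y - sin x = 2 * sin ((y - x) / 2) * cos ((x + y) / 2)"
      "sin z - sin x = 2 * sin ((z - x) / 2) * cos ((x + z) / 2)"
      using sin_diff_sin[of y x] sin_diff_sin[of z x] by (simp_all add: add.commute)
    show ?thesis unfolding 1 2 by (simp add: algebra_simps)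
  qed
  also have "sin ((x + z) / 2) * cos ((x + y) / 2) - cos ((x + z) / 2) * sin ((x + y) / 2) = sin ((x + z) / 2 - (x + y) / 2)"
    by (rule sin_diff[symmetric])
  also have "(x + z) / 2 - (x + y) / 2 = (z - y) / 2" by (simp add: field_simps)
  finally show ?thesis by (simp add: mult_ac)
qed

lemma sin_half_sgn: "\<bar>x\<bar> < 2 * pi \<Longrightarrow> sgn (sin (x / 2)) = sgn x"
  using sin_gt_zero[of "x / 2"] sin_gt_zero[of "- x / 2"]
  by (cases x "0 :: real" rule: linorder_cases) (simp_all add: sgn_real_def)

text \<open>Within one turn the sine of half a difference has the sign of that difference, so the
  determinant reads off the cyclic order.\<close>

lemma det3_H_cis_sgn:
  assumes "{x, y, z} \<subseteq> {t..<t + 2 * pi}"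
  shows "sgn (det3 (H (cis x)) (H (cis y)) (H (cis z))) = sgn (y - x) * sgn (z - y) * sgn (z - x)"
  unfolding det3_H_cis sgn_mult using assms by (simp add: sin_half_sgn abs_less_iff)

lemma cyclic_pos:
  assumes "{x, y, z} \<subseteq> {t..<t + 2 * pi}" "0 < det3 (H (cis x)) (H (cis y)) (H (cis z))"
  shows "x < y \<and> y < z \<or> y < z \<and> z < x \<or> z < x \<and> x < y"
  using det3_H_cis_sgn[OF assms(1)] assms(2) by (auto simp: sgn_real_def split: if_splits)

lemma cyclic_neg:
  assumes "{x, y, z} \<subseteq> {t..<t + 2 * pi}" "det3 (H (cis x)) (H (cis y)) (H (cis z)) < 0"
  shows "y < x \<and> x < z \<or> x < z \<and> z < y \<or> z < y \<and> y < x"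
  using det3_H_cis_sgn[OF assms(1)] assms(2) by (auto simp: sgn_real_def split: if_splits)

lemma cis_eq_imp_eq:
  assumes "cis x = cis y" "c \<le> x" "x < c + 2 * pi" "c \<le> y" "y < c + 2 * pi" shows "x = y"
proof -
  obtain j :: int where j: "x = y + 2 * pi * of_int j" using assms(1) unfolding cis_eq_iff by blast
  have "\<bar>x - y\<bar> < 2 * pi" using assms by linarith
  then have "2 * pi * \<bar>of_int j\<bar> < 2 * pi * (1 :: real)" unfolding j by (simp add: abs_mult)
  then have "\<bar>of_int j :: real\<bar> < 1" by (rule mult_left_less_imp_less) simp
  then show ?thesis using j by simp
qed

context canonical
begin

text \<open>Otherwise the ray from \<open>V (k + 1)\<close> to \<open>P (k + 1)\<close> would reach
  the line of side \<open>k - 1\<close>; the combination \<open>X\<close> is the crossing point, and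
  it lies beyond side \<open>k\<close>.\<close>

lemma P_beyond: "0 < dt (k - 1) (H (P (k + 1)))"
proof (rule ccontr)
  assume A: "\<not> ?thesis"
  obtain x y where xy: "0 < x" "0 < y" "H (P (k + 1)) = x *\<^sub>R HV (k + 1) - y *\<^sub>R HV (k + 1 + 1)" using P_H .
  let ?d = "dt (k - 1)"
  have d: "0 < ?d (HV (k + 1))" using n_ge by (intro det_pos') auto
  define X where "X = ?d (HV (k + 1)) *\<^sub>R H (P (k + 1)) + (- ?d (H (P (k + 1)))) *\<^sub>R HV (k + 1)"
  have "X \<in> fcone" unfolding X_def using A d by (intro fcone_comb H_fcone) auto
  moreover have "?d X = 0" unfolding X_def det3_linear by simp
  moreover have "dt (k + 1) X = 0" unfolding X_def det3_linear unfolding xy(3) det3_linear_diff by simp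
  moreover have "dt k X < 0"
  proof -
    have "0 < dt k (HV (k + 1 + 1))" using n_ge by (intro det_pos') auto
    then show ?thesis unfolding X_def det3_linear unfolding xy(3) det3_linear_diff
      using d xy by (simp add: mult_pos_pos)
  qed
  ultimately have "meet_outside k" unfolding meet_outside_def by blast
  then show False using no_meet_outside by blast
qed

lemma P_behind: "dt (i - 1) (H (P i)) < 0"
proof -
  obtain x y where xy: "0 < x" "0 < y" "H (P i) = x *\<^sub>R HV i - y *\<^sub>R HV (i + 1)" using P_H .
  have "0 < dt (i - 1) (HV (i + 1))" using n_ge by (intro det_pos') auto
  then show ?thesis unfolding xy(3) det3_linear_diff using xy by simp
qed

text \<open>\<open>P_beyond\<close> settles line \<open>i - 2\<close>, convexity settles line
  \<open>i + 1\<close>. For lines in between, \<open>four_functionals\<close> writes the value as a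
  positive combination of those two and of minus the value at line \<open>i - 1\<close>, which
  \<open>P_behind\<close> makes negative.\<close>

lemma P_left:
  assumes "i + 1 \<le> j" "j \<le> i + n - 2" shows "0 < dt j (H (P i))"
proof -
  have first: "0 < dt (i + 1) (H (P i))"
  proof -
    obtain x y where xy: "0 < x" "0 < y" "H (P i) = x *\<^sub>R HV i - y *\<^sub>R HV (i + 1)" using P_H .
    have "0 < dt (i + 1) (HV (i + n))" using n_ge by (intro det_pos') auto
    then show ?thesis unfolding xy(3) det3_linear_diff V_per using xy by simp
  qed
  have last: "0 < dt (i - 2) (H (P i))" using P_beyond[of "i - 1"] by (simp add: algebra_simps)
  have per: "dt (l + n) w = dt l w" for l w using V_per[of l] V_per[of "l + 1"] by (simp add: algebra_simps)
  consider "j = i + 1" | "j = i - 2 + n" | "i + 1 < j" "j < i - 2 + n" using assms by linarith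
  then show ?thesis
  proof cases
    case 1
    show ?thesis unfolding 1 by (rule first)
  next
    case 2
    show ?thesis unfolding 2 per by (rule last)
  next
    case 3
    let ?a = "side_line (i + 1)" and ?b = "side_line j" and ?c = "side_line (i - 2 + n)" and ?d = "side_line (i - 1 + n)"
    have det: "0 < det3 ?b ?c ?d" "0 < det3 ?a ?b ?d" "0 < det3 ?a ?c ?d" "0 < det3 ?a ?b ?c"
      using 3 n_ge by (auto intro!: side_line_pos)
    have "0 < det3 ?b ?c ?d * dot3 ?a (H (P i)) + det3 ?a ?b ?d * dot3 ?c (H (P i))"
      using det first last unfolding dot3_ln' per by (intro add_pos_pos mult_pos_pos)
    also have "\<dots> = det3 ?a ?c ?d * dot3 ?b (H (P i)) + det3 ?a ?b ?c * dot3 ?d (H (P i))"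
      by (rule four_functionals)
    finally have "0 < det3 ?a ?c ?d * dt j (H (P i)) + det3 ?a ?b ?c * dt (i - 1) (H (P i))"
      unfolding dot3_ln' per .
    moreover have "det3 ?a ?b ?c * dt (i - 1) (H (P i)) < 0" using det P_behind by (simp add: mult_pos_neg)
    ultimately have "0 < det3 ?a ?c ?d * dt j (H (P i))" by linarith
    then show ?thesis by (rule zero_less_mult_pos) (rule det(3))
  qed
qed

lemma mink_linear: "mink u (x *\<^sub>R v - y *\<^sub>R w) = x * mink u v - y * mink u w"
  by (cases u; cases v; cases w) (simp add: algebra_simps)

text \<open>Both endpoints lie on the line of side \<open>k\<close>, so only the sign of the factor
  is at stake. It follows from nonnegativity of the Minkowski products with \<open>HV k\<close>; the
  factor 0 would make two future vectors opposite.\<close>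

lemma PQ_dt:
  obtains c where "0 < c" "\<And>w. det3 (H (P k)) (H (Q (k + 1))) w = c * dt k w"
proof -
  obtain x y where xy: "0 < x" "0 < y" "H (P k) = x *\<^sub>R HV k - y *\<^sub>R HV (k + 1)" using P_H .
  obtain x' y' where xy': "0 < x'" "0 < y'" "H (Q (k + 1)) = y' *\<^sub>R HV (k + 1) - x' *\<^sub>R HV (k + 1 - 1)" using Q_H .
  let ?c = "x * y' - y * x'"
  have "0 \<le> mink (HV k) (H (P k))" "0 \<le> mink (HV k) (H (Q (k + 1)))"
    by (intro mink_fcone_nonneg H_fcone)+
  then have m: "y * mink (HV k) (HV (k + 1)) \<le> x * mink (HV k) (HV k)"
    "x' * mink (HV k) (HV k) \<le> y' * mink (HV k) (HV (k + 1))"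
    unfolding xy(3) xy'(3) mink_linear by simp_all
  have "y * (x' * mink (HV k) (HV k)) \<le> y * (y' * mink (HV k) (HV (k + 1)))"
    using m(2) xy by (intro mult_left_mono) auto
  also have "\<dots> = y' * (y * mink (HV k) (HV (k + 1)))" by simp
  also have "\<dots> \<le> y' * (x * mink (HV k) (HV k))" using m(1) xy' by (intro mult_left_mono) auto
  finally have "0 \<le> ?c * mink (HV k) (HV k)" by (simp add: algebra_simps)
  then have c: "0 \<le> ?c" using mink_H_pos[OF V_disk[of k]] by (simp add: zero_le_mult_iff)
  have "?c \<noteq> 0"
  proof
    assume "?c = 0"
    then have e: "x' / x * y = y'" using xy by (simp add: field_simps)
    have "(x' / x) *\<^sub>R H (P k) = - H (Q (k + 1))"
      unfolding xy(3) xy'(3) using xy e by (simp add: scaleR_diff_right)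
    then have "(x' / x) * fst (H (P k)) = - fst (H (Q (k + 1)))" by (metis fst_scaleR fst_uminus real_scaleR_def)
    moreover have "0 < (x' / x) * fst (H (P k))" using xy(1) xy'(1) fst_H_pos[of "P k"] by simp
    ultimately show False using fst_H_pos[of "Q (k + 1)"] by linarith
  qed
  moreover have "det3 (H (P k)) (H (Q (k + 1))) w = ?c * dt k w" for w
    unfolding xy(3) xy'(3) using det3_line2[of x "HV k" y "HV (k + 1)" y' x' w] by simp
  ultimately show ?thesis using that[of ?c] c by simp
qed

lemma PQP_pos:
  assumes "i + 1 \<le> j" "j \<le> i + n - 2" shows "0 < det3 (H (P j)) (H (Q (j + 1))) (H (P i))"
proof -
  obtain c where "0 < c" "\<And>w. det3 (H (P j)) (H (Q (j + 1))) w = c * dt j w" using PQ_dt by blast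
  then show ?thesis using P_left[OF assms] by simp
qed

lemma PQP_neg: "det3 (H (P k)) (H (Q (k + 1))) (H (P (k + 1))) < 0"
proof -
  obtain c where "0 < c" "\<And>w. det3 (H (P k)) (H (Q (k + 1))) w = c * dt k w" using PQ_dt by blast
  then show ?thesis using P_behind[of "k + 1"] by (simp add: mult_pos_neg)
qed

lemma P_cong: "i mod n = j mod n \<Longrightarrow> P i = P j"
  using V_cong[of i j 0] V_cong[of i j 1] by (simp add: P_def Pend_def)

lemma Q_cong: "i mod n = j mod n \<Longrightarrow> Q i = Q j"
  using V_cong[of i j 0] V_cong[of i j "-1"] by (simp add: Q_def Qend_def)

lemma PQP_pos2: "0 < det3 (H (P k)) (H (Q (k + 1))) (H (P (k + 2)))"
proof -
  have "0 < det3 (H (P (k + n))) (H (Q (k + n + 1))) (H (P (k + 2)))"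
    using n_ge by (intro PQP_pos) auto
  moreover have "P (k + n) = P k" by (intro P_cong) simp
  moreover have "Q (k + n + 1) = Q (k + 1)"
    by (intro Q_cong) (metis add.commute add.left_commute mod_add_self2)
  ultimately show ?thesis by simp
qed

text \<open>Angles are counted from \<open>P 0\<close>, which becomes the least one; each cyclic
  statement about \<open>P 0\<close> then leaves a single linear order.\<close>

definition t0 :: real where "t0 = (SOME t. P 0 = cis t)"
definition ang :: "complex \<Rightarrow> real" where "ang x = (SOME r. t0 \<le> r \<and> r < t0 + 2 * pi \<and> x = cis r)"

lemma P0_t0: "P 0 = cis t0"
  unfolding t0_def using circ_cis[OF P_circ[of 0]] by (rule someI_ex)

lemma ang: assumes "x \<in> circ" shows "t0 \<le> ang x" "ang x < t0 + 2 * pi" "cis (ang x) = x"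
  using someI_ex[OF circ_lift[OF assms, of t0]] unfolding ang_def by auto

lemma ang_P0: "ang (P 0) = t0"
  using ang[OF P_circ[of 0]] P0_t0 by (intro cis_eq_imp_eq[of _ _ t0]) auto

definition P_ang :: "int \<Rightarrow> real" where "P_ang k = ang (P k)"
definition Q_ang :: "int \<Rightarrow> real" where "Q_ang k = ang (Q k)"

lemma P_ang_range: "t0 \<le> P_ang k" "P_ang k < t0 + 2 * pi" and Q_ang_range: "t0 \<le> Q_ang k" "Q_ang k < t0 + 2 * pi"
  and cis_P_ang: "cis (P_ang k) = P k" and cis_Q_ang: "cis (Q_ang k) = Q k"
  using ang[OF P_circ] ang[OF Q_circ] by (simp_all add: P_ang_def Q_ang_def)

lemma P_ang_0: "P_ang 0 = t0" by (simp add: P_ang_def ang_P0)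

lemma cyc_pos: "0 < det3 (H (P i)) (H (Q j)) (H (P k)) \<Longrightarrow>
    P_ang i < Q_ang j \<and> Q_ang j < P_ang k \<or> Q_ang j < P_ang k \<and> P_ang k < P_ang i \<or> P_ang k < P_ang i \<and> P_ang i < Q_ang j"
  using cyclic_pos[of "P_ang i" "Q_ang j" "P_ang k" t0] P_ang_range Q_ang_range by (simp add: cis_P_ang cis_Q_ang)

lemma cyc_neg: "det3 (H (P i)) (H (Q j)) (H (P k)) < 0 \<Longrightarrow>
    Q_ang j < P_ang i \<and> P_ang i < P_ang k \<or> P_ang i < P_ang k \<and> P_ang k < Q_ang j \<or> P_ang k < Q_ang j \<and> Q_ang j < P_ang i"
  using cyclic_neg[of "P_ang i" "Q_ang j" "P_ang k" t0] P_ang_range Q_ang_range by (simp add: cis_P_ang cis_Q_ang)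

lemma P_ang_less_Q_ang_next: "1 \<le> j \<Longrightarrow> j \<le> n - 2 \<Longrightarrow> t0 < P_ang j \<and> P_ang j < Q_ang (j + 1)"
  using cyc_pos[OF PQP_pos[of 0 j]] P_ang_range[of j] Q_ang_range[of "j + 1"] by (auto simp: P_ang_0)

lemma P_ang_between: "1 \<le> j \<Longrightarrow> j \<le> n - 2 \<Longrightarrow> P_ang j < P_ang (j + 1) \<and> P_ang (j + 1) < Q_ang (j + 1)"
  using cyc_neg[OF PQP_neg[of j]] P_ang_less_Q_ang_next[of j] by auto

text \<open>The inequalities near the cut at \<open>P 0\<close>, out of reach of
  \<open>P_ang_between\<close>; here label \<open>-1\<close> stands for
  \<open>n - 1\<close>.\<close>

lemma order_start: "t0 < Q_ang 0" "Q_ang 0 < P_ang 1" "P_ang 1 < Q_ang 1" "Q_ang 1 < P_ang 2"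
proof -
  have P: "P (- 1) = P (n - 1)" by (rule P_cong) (simp add: zmod_minus1 n_ge)
  then have pn: "P_ang (- 1) = P_ang (n - 1)" by (simp add: P_ang_def)
  have "t0 < P_ang (n - 2) \<and> P_ang (n - 2) < P_ang (n - 1)"
    using P_ang_less_Q_ang_next[of "n - 2"] P_ang_between[of "n - 2"] n_ge by simp
  then show "t0 < Q_ang 0" using cyc_neg[OF PQP_neg[of "- 1"]] P_ang_range[of "n - 1"] Q_ang_range[of 0] by (auto simp: P_ang_0 pn)
  show "P_ang 1 < Q_ang 1" using cyc_neg[OF PQP_neg[of 0]] P_ang_range Q_ang_range[of 1] by (auto simp: P_ang_0)
  show "Q_ang 1 < P_ang 2" using cyc_pos[OF PQP_pos2[of 0]] P_ang_range Q_ang_range[of 1]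
    by (auto simp: P_ang_0) (meson leD)+
  have "Q_ang 0 < P_ang (n - 1)"
    using cyc_neg[OF PQP_neg[of "- 1"]] P_ang_range[of "n - 1"] Q_ang_range[of 0] by (auto simp: P_ang_0 pn)
  then show "Q_ang 0 < P_ang 1" using cyc_pos[OF PQP_pos2[of "- 1"]] by (auto simp: pn)
qed

lemma P_ang_less_Q_ang: assumes "0 \<le> j" "j \<le> n - 1" shows "P_ang j < Q_ang j"
proof -
  consider "j = 0" | "j = 1" | "2 \<le> j" using assms by linarith
  then show ?thesis
    by cases (use order_start P_ang_0 P_ang_between[of "j - 1"] assms in auto)
qed

lemma Q_ang_less_P_ang: assumes "0 \<le> j" "j \<le> n - 2" shows "Q_ang j < P_ang (j + 1)"
proof -
  consider "j = 0" | "j = 1" | "2 \<le> j" using assms by linarith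
  then show ?thesis
  proof cases
    case 3
    have "P_ang (j - 1) < P_ang j \<and> P_ang j < Q_ang j" "P_ang j < P_ang (j + 1)"
      using P_ang_between[of "j - 1"] P_ang_between[of j] 3 assms by auto
    then show ?thesis using cyc_pos[OF PQP_pos2[of "j - 1"]] by (auto simp: add.commute)
  qed (use order_start in auto)
qed

definition p :: "int \<Rightarrow> real" where "p k = P_ang (k mod n) + 2 * pi * of_int (k div n)"
definition q :: "int \<Rightarrow> real" where "q k = Q_ang (k mod n) + 2 * pi * of_int (k div n)"

lemma cis_p: "cis (p k) = P k" and cis_q: "cis (q k) = Q k"
proof -
  have *: "cis (r + 2 * pi * of_int j) = cis r" for r and j :: int unfolding cis_eq_iff by blast
  show "cis (p k) = P k" unfolding p_def * cis_P_ang by (rule P_cong) simp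
  show "cis (q k) = Q k" unfolding q_def * cis_Q_ang by (rule Q_cong) simp
qed

lemma p_per: "p (k + n) = p k + 2 * pi" and q_per: "q (k + n) = q k + 2 * pi"
  using n_ge by (simp_all add: p_def q_def algebra_simps)

lemma p_less_q: "p k < q k"
  unfolding p_def q_def using P_ang_less_Q_ang[of "k mod n"] n_ge by simp

lemma q_less_p: "q k < p (k + 1)"
proof (cases "k mod n = n - 1")
  case True
  then have "k = n * (k div n) + (n - 1)" by (metis mult_div_mod_eq)
  then have "k + 1 = (k div n + 1) * n" by (simp add: algebra_simps)
  then have "(k + 1) mod n = 0" "(k + 1) div n = k div n + 1" using n_ge by simp_all
  then show ?thesis unfolding p_def q_def using Q_ang_range[of "k mod n"] by (simp add: P_ang_0 algebra_simps)
next
  case False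
  have m: "0 \<le> k mod n" "k mod n < n" using n_ge by auto
  have k: "k + 1 = n * (k div n) + (k mod n + 1)" by simp
  have "k mod n + 1 < n" using False m by linarith
  then have "(k + 1) mod n = k mod n + 1 \<and> (k + 1) div n = k div n"
    using m int_div_pos_eq[OF k] int_mod_pos_eq[OF k] by simp
  then show ?thesis unfolding p_def q_def using Q_ang_less_P_ang[of "k mod n"] False m by simp
qed

end

section \<open>The boundary map of a canonical polygon\<close>

text \<open>On the circle \<open>mob a b (cis t)\<close> equals
  \<open>cis t * (a / cnj a) * (w / cnj w)\<close> with \<open>w = 1 + b / a * cis (- t)\<close>. As
  \<open>|b| < |a|\<close>, \<open>w\<close> stays in the right half-plane, so the principal
  logarithm is continuous and adds no winding.\<close>

definition mlift :: "complex \<Rightarrow> complex \<Rightarrow> real \<Rightarrow> real" where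
  "mlift a b t = t + 2 * Arg a + 2 * Im (Ln (1 + b / a * cis (- t)))"

lemma cmod_less_of_disk_aut:
  assumes "disk_aut_params a b" shows "a \<noteq> 0" "cmod (b / a) < 1"
proof -
  have "(cmod b)\<^sup>2 < (cmod a)\<^sup>2" using assms by (simp add: disk_aut_params_def)
  then have "cmod b < cmod a" by (rule power_less_imp_less_base) simp
  moreover from this show "a \<noteq> 0" using norm_ge_zero[of b] by auto
  ultimately show "cmod (b / a) < 1" by (simp add: norm_divide)
qed

lemma one_plus_Re_pos: "cmod w < 1 \<Longrightarrow> 0 < Re (1 + w)"
  using abs_Re_le_cmod[of w] by simp

lemma cis_2_Im_Ln:
  assumes "z \<noteq> 0" shows "cis (2 * Im (Ln z)) = z / cnj z"
proof -
  have z: "z = of_real (cmod z) * cis (Im (Ln z))"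
    using rcis_cmod_Arg[of z] assms by (simp add: rcis_def Arg_eq_Im_Ln)
  have "cis (2 * Im (Ln z)) = cis (Im (Ln z)) / cis (- Im (Ln z))" by (simp add: cis_divide)
  also have "\<dots> = (of_real (cmod z) * cis (Im (Ln z))) / cnj (of_real (cmod z) * cis (Im (Ln z)))"
    using assms by (simp add: cis_cnj)
  also have "\<dots> = z / cnj z" using z by simp
  finally show ?thesis .
qed

lemma mob_cis_mlift:
  assumes "disk_aut_params a b" shows "mob a b (cis t) = cis (mlift a b t)"
proof -
  note a = cmod_less_of_disk_aut[OF assms]
  define w where "w = 1 + b / a * cis (- t)"
  have "cmod (b / a * cis (- t)) < 1" using a(2) by (simp only: norm_mult norm_cis mult_1_right)
  then have "0 < Re w" unfolding w_def by (rule one_plus_Re_pos)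
  then have w: "w \<noteq> 0" by auto
  have Arg: "cis (2 * Arg a) = a / cnj a" using cis_2_Im_Ln[OF a(1)] a(1) by (simp add: Arg_eq_Im_Ln)
  have "cis (mlift a b t) = cis t * (a / cnj a) * (w / cnj w)"
    unfolding mlift_def w_def[symmetric] cis_2_Im_Ln[OF w, symmetric] Arg[symmetric] cis_mult by simp
  also have "\<dots> = (cis t * (a * w)) / cnj (a * w)" by simp
  also have "a * w = a + b * cis (- t)" using a(1) by (simp add: w_def field_simps)
  also have "cis t * (a + b * cis (- t)) = a * cis t + b" by (simp add: algebra_simps cis_mult)
  also have "cnj (a + b * cis (- t)) = cnj b * cis t + cnj a" by (simp add: cis_cnj)
  finally show ?thesis by (simp add: mob_def)
qed

lemma mlift_deg: "mlift a b (t + 2 * pi) = mlift a b t + 2 * pi"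
proof -
  have "cis (- (t + 2 * pi)) = cis (- t)" unfolding cis_eq_iff by (intro exI[of _ "- 1"]) simp
  then show ?thesis by (simp add: mlift_def)
qed

text \<open>The derivative is a Poisson kernel, \<open>(1 - |w|^2) / |1 + w|^2\<close> with
  \<open>w = b / a * cis (- t)\<close>.\<close>

lemma mlift_deriv:
  assumes "disk_aut_params a b"
  shows "\<exists>d>0. (mlift a b has_real_derivative d) (at t)"
proof -
  note a = cmod_less_of_disk_aut[OF assms]
  define w where "w t = b / a * cis (- t)" for t
  have n: "cmod (w t) < 1" for t using a(2) by (simp only: w_def norm_mult norm_cis mult_1_right)
  have Re: "0 < Re (1 + w t)" using one_plus_Re_pos[OF n] .
  then have nz: "1 + w t \<noteq> 0" by (metis less_irrefl zero_complex.sel(1))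
  have nz': "cnj (1 + w t) \<noteq> 0" using nz complex_cnj_zero_iff by blast
  have ne: "(cmod (1 + w t))\<^sup>2 \<noteq> 0" using nz by simp
  have "((\<lambda>t. cis (- t)) has_vector_derivative (- \<i> * cis (- t))) (at t)"
    using exp_scaleR_has_vector_derivative_right[of "- \<i>" t UNIV]
    by (simp add: cis_conv_exp scaleR_conv_of_real mult.commute)
  then have "((\<lambda>t. 1 + w t) has_vector_derivative (- \<i> * w t)) (at t)"
    unfolding w_def by (auto intro!: derivative_eq_intros)
  moreover have "1 + w t \<notin> \<real>\<^sub>\<le>\<^sub>0" using Re by (auto simp: complex_nonpos_Reals_iff)
  ultimately have "((\<lambda>t. Ln (1 + w t)) has_vector_derivative ((- \<i> * w t) * (1 / (1 + w t)))) (at t)"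
    using field_vector_diff_chain_at[of "\<lambda>t. 1 + w t" "- \<i> * w t" t Ln "1 / (1 + w t)"]
      has_field_derivative_Ln[of "1 + w t"] by (simp add: o_def divide_inverse)
  then have "((\<lambda>t. Im (Ln (1 + w t))) has_vector_derivative Im ((- \<i> * w t) * (1 / (1 + w t)))) (at t)"
    by (rule bounded_linear.has_vector_derivative[OF bounded_linear_Im])
  then have I: "((\<lambda>t. Im (Ln (1 + w t))) has_real_derivative Im ((- \<i> * w t) * (1 / (1 + w t)))) (at t)"
    by (simp add: has_real_derivative_iff_has_vector_derivative)
  have m: "mlift a b = (\<lambda>t. t + 2 * Arg a + 2 * Im (Ln (1 + w t)))"
    by (rule ext) (simp add: mlift_def w_def)
  have "(mlift a b has_real_derivative (1 + 0 + 2 * Im ((- \<i> * w t) * (1 / (1 + w t))))) (at t)"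
    unfolding m by (intro DERIV_add DERIV_ident DERIV_const DERIV_cmult I)
  then have "(mlift a b has_real_derivative (1 + 2 * Im ((- \<i> * w t) * (1 / (1 + w t))))) (at t)"
    unfolding add_0_right .
  moreover have "1 + 2 * Im ((- \<i> * w t) * (1 / (1 + w t))) = (1 - (cmod (w t))\<^sup>2) / (cmod (1 + w t))\<^sup>2"
  proof -
    have "(- \<i> * w t) * (1 / (1 + w t)) = - \<i> * (w t / (1 + w t))" by (simp only: times_divide_eq_right mult_1_right)
    moreover have "Im (- \<i> * z) = - Re z" for z by simp
    ultimately have "Im ((- \<i> * w t) * (1 / (1 + w t))) = - Re (w t / (1 + w t))" by metis
    also have "w t / (1 + w t) = w t * cnj (1 + w t) / of_real ((cmod (1 + w t))\<^sup>2)"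
      unfolding complex_norm_square by (rule nonzero_mult_divide_mult_cancel_right[OF nz', symmetric])
    also have "Re \<dots> = Re (w t * cnj (1 + w t)) / (cmod (1 + w t))\<^sup>2" by (rule Re_divide_of_real)
    finally have "1 + 2 * Im ((- \<i> * w t) * (1 / (1 + w t)))
        = ((cmod (1 + w t))\<^sup>2 - 2 * Re (w t * cnj (1 + w t))) / (cmod (1 + w t))\<^sup>2"
      using ne by (simp add: diff_divide_distrib)
    also have "(cmod (1 + w t))\<^sup>2 - 2 * Re (w t * cnj (1 + w t)) = 1 - (cmod (w t))\<^sup>2"
      unfolding cmod_power2 by (simp add: power2_eq_square algebra_simps)
    finally show ?thesis .
  qed
  moreover have "0 < (1 - (cmod (w t))\<^sup>2) / (cmod (1 + w t))\<^sup>2"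
  proof (rule divide_pos_pos)
    show "0 < 1 - (cmod (w t))\<^sup>2" using n[of t] abs_square_less_1[of "cmod (w t)"] by simp
    show "0 < (cmod (1 + w t))\<^sup>2" using ne by simp
  qed
  ultimately show ?thesis by metis
qed

lemma mlift_strict_mono: "disk_aut_params a b \<Longrightarrow> strict_mono (mlift a b)"
  using mlift_deriv DERIV_pos_imp_increasing[of _ _ "mlift a b"] by (metis strict_monoI)

lemma mlift_continuous: "disk_aut_params a b \<Longrightarrow> continuous_on UNIV (mlift a b)"
  using mlift_deriv DERIV_isCont by (metis continuous_at_imp_continuous_on)

lemma degree_one_int:
  fixes F :: "real \<Rightarrow> real"
  assumes "\<And>t. F (t + 2 * pi) = F t + 2 * pi"
  shows "F (t + 2 * pi * of_int c) = F t + 2 * pi * of_int c"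
  using quasi_periodic_int[of F "2 * pi" "2 * pi" t c, OF assms] by (simp add: mult.commute)

lemma degree_one_surj:
  fixes F :: "real \<Rightarrow> real"
  assumes deg: "\<And>t. F (t + 2 * pi) = F t + 2 * pi" and cont: "continuous_on UNIV F"
  shows "surj F"
proof -
  have e: "F (2 * pi * of_int c) = F 0 + 2 * pi * of_int c" for c
    using degree_one_int[of F 0 c, OF deg] by simp
  have "\<exists>x. F x = y" for y
  proof -
    define c where "c = \<lfloor>(y - F 0) / (2 * pi)\<rfloor>"
    have "of_int c \<le> (y - F 0) / (2 * pi)" "(y - F 0) / (2 * pi) < of_int c + 1"
      unfolding c_def by linarith+
    then have "F 0 + 2 * pi * of_int c \<le> y" "y \<le> F 0 + 2 * pi * of_int (c + 1)"
      by (auto simp: field_simps)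
    then have y: "F (2 * pi * of_int c) \<le> y" "y \<le> F (2 * pi * of_int (c + 1))"
      by (simp_all only: e)
    have "2 * pi * of_int c \<le> 2 * pi * of_int (c + 1)" by simp
    from IVT'[OF y this continuous_on_subset[OF cont]] show ?thesis by auto
  qed
  then show ?thesis by (metis surjI)
qed

text \<open>Continuity is replaced by monotonicity: after matching the values at 0, both lifts map
  one turn into the same window of length \<open>2 * pi\<close>, where \<open>cis\<close> is
  injective.\<close>

lemma lifts_differ_by_const:
  fixes F G :: "real \<Rightarrow> real"
  assumes "strict_mono F" "strict_mono G"
    and F: "\<And>t. F (t + 2 * pi) = F t + 2 * pi" and G: "\<And>t. G (t + 2 * pi) = G t + 2 * pi"
    and eq: "\<And>t. cis (F t) = cis (G t)"
  shows "\<exists>c. \<forall>t. F t = G t + 2 * pi * of_int c"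
proof -
  obtain c :: int where c: "F 0 = G 0 + 2 * pi * of_int c" using eq[of 0] unfolding cis_eq_iff by blast
  have base: "F r = G r + 2 * pi * of_int c" if "0 \<le> r" "r < 2 * pi" for r
  proof (rule cis_eq_imp_eq[of _ _ "F 0"])
    show "cis (F r) = cis (G r + 2 * pi * of_int c)"
      using eq[of r] cis_eq_iff[of "G r + 2 * pi * of_int c" "G r"] by auto
    have "F 0 \<le> F r" "F r < F (0 + 2 * pi)" "G 0 \<le> G r" "G r < G (0 + 2 * pi)"
      using assms(1,2) that by (simp_all add: strict_mono_less strict_mono_less_eq)
    then show "F 0 \<le> F r" "F r < F 0 + 2 * pi" "F 0 \<le> G r + 2 * pi * of_int c" "G r + 2 * pi * of_int c < F 0 + 2 * pi"
      unfolding F G c by auto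
  qed
  have "F t = G t + 2 * pi * of_int c" for t
  proof -
    define j where "j = \<lfloor>t / (2 * pi)\<rfloor>"
    define r where "r = t - 2 * pi * of_int j"
    have "of_int j \<le> t / (2 * pi)" "t / (2 * pi) < of_int j + 1" unfolding j_def by linarith+
    then have "0 \<le> r" "r < 2 * pi" by (auto simp: r_def field_simps)
    from base[OF this] have "F (r + 2 * pi * of_int j) = G (r + 2 * pi * of_int j) + 2 * pi * of_int c"
      unfolding degree_one_int[of F, OF F] degree_one_int[of G, OF G] by simp
    then show ?thesis by (simp add: r_def)
  qed
  then show ?thesis by blast
qed

lemma quadratic_three_roots:
  fixes u v w :: complex
  assumes "z1 \<noteq> z2" "z1 \<noteq> z3" "z2 \<noteq> z3"
    and "u * z1\<^sup>2 + v * z1 + w = 0" "u * z2\<^sup>2 + v * z2 + w = 0" "u * z3\<^sup>2 + v * z3 + w = 0"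
  shows "u = 0 \<and> v = 0 \<and> w = 0"
proof -
  have "(z1 - z2) * (u * (z1 + z2) + v) = 0" "(z1 - z3) * (u * (z1 + z3) + v) = 0"
    using assms(4-6) by algebra+
  then have e: "u * (z1 + z2) + v = 0" "u * (z1 + z3) + v = 0" using assms(1,2) by auto
  then have "u * (z2 - z3) = 0" by algebra
  then have "u = 0" using assms(3) by simp
  then show ?thesis using e assms(4) by simp
qed

text \<open>Agreement at a point is a quadratic equation for it; three roots make all coefficients
  vanish.\<close>

lemma mob_three_points:
  assumes ab: "disk_aut_params a b" "disk_aut_params a' b'"
    and z: "z1 \<noteq> z2" "z1 \<noteq> z3" "z2 \<noteq> z3" "cmod z1 \<le> 1" "cmod z2 \<le> 1" "cmod z3 \<le> 1"
    and eq: "mob a b z1 = mob a' b' z1" "mob a b z2 = mob a' b' z2" "mob a b z3 = mob a' b' z3"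
    and x: "cmod x \<le> 1"
  shows "mob a b x = mob a' b' x"
proof -
  define u v w where "u = a * cnj b' - a' * cnj b" and "v = a * cnj a' + b * cnj b' - (a' * cnj a + b' * cnj b)"
    and "w = b * cnj a' - b' * cnj a"
  have iff: "mob a b y = mob a' b' y \<longleftrightarrow> u * y\<^sup>2 + v * y + w = 0" if "cmod y \<le> 1" for y
  proof -
    have "mob a b y = mob a' b' y \<longleftrightarrow>
        (a * y + b) * (cnj b' * y + cnj a') = (a' * y + b') * (cnj b * y + cnj a)"
      unfolding mob_def using mob_den_nz[OF ab(1) that] mob_den_nz[OF ab(2) that] by (rule frac_eq_eq)
    also have "\<dots> \<longleftrightarrow> u * y\<^sup>2 + v * y + w = 0"
      unfolding u_def v_def w_def by (auto simp: power2_eq_square algebra_simps)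
    finally show ?thesis .
  qed
  have "u = 0 \<and> v = 0 \<and> w = 0"
    using quadratic_three_roots[OF z(1-3)] eq iff z(4-6) by blast
  then show ?thesis using iff[OF x] by simp
qed

lemma mob_comp:
  assumes "disk_aut_params a b" "disk_aut_params c d"
  obtains e h where "disk_aut_params e h" "\<And>z. cmod z \<le> 1 \<Longrightarrow> mob a b (mob c d z) = mob e h z"
proof -
  let ?e = "a * c + b * cnj d" and ?h = "a * d + b * cnj c"
  have "?e * cnj ?e - ?h * cnj ?h = (a * cnj a - b * cnj b) * (c * cnj c - d * cnj d)"
    by (simp add: algebra_simps)
  then have 1: "disk_aut_params ?e ?h" using assms by (simp add: disk_aut_params_complex)
  have "mob a b (mob c d z) = mob ?e ?h z" if "cmod z \<le> 1" for z
  proof -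
    let ?D = "cnj d * z + cnj c"
    have D: "?D \<noteq> 0" using mob_den_nz[OF assms(2) that] .
    have "a * ((c * z + d) / ?D) + b = (?e * z + ?h) / ?D"
      "cnj b * ((c * z + d) / ?D) + cnj a = (cnj ?h * z + cnj ?e) / ?D"
      using D by (simp_all add: field_simps)
    then show ?thesis using D by (simp add: mob_def)
  qed
  then show ?thesis using that 1 by blast
qed

lemma ccw_angle_cis:
  assumes "0 \<le> d" "d < 2 * pi" shows "ccw_angle (cis x) (cis (x + d)) = d"
proof -
  have q: "cis (x + d) / cis x = cis d" by (simp add: cis_divide)
  show ?thesis
  proof (cases "d \<le> pi")
    case True
    have "- pi < d" using assms pi_gt_zero by linarith
    then have "Arg (cis d) = d" using True by (intro cis_Arg_unique) (simp_all add: sgn_div_norm)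
    then show ?thesis unfolding ccw_angle_def q using assms by simp
  next
    case False
    have "cis (d - 2 * pi) = cis d" unfolding cis_eq_iff by (intro exI[of _ "- 1"]) simp
    then have "Arg (cis d) = d - 2 * pi" using assms False by (intro cis_Arg_unique) (auto simp: sgn_div_norm)
    then show ?thesis unfolding ccw_angle_def q using assms by simp
  qed
qed

context canonical
begin

section \<open>Lifts of the side pairings and the relation at a vertex\<close>

lemma p_step: "p k < p (k + 1)" and q_step: "q k < q (k + 1)"
  using p_less_q[of k] q_less_p[of k] p_less_q[of "k + 1"] by linarith+

lemmas p_mono = step_imp_mono_int_iff[of p, OF p_step]
lemmas q_mono = step_imp_mono_int_iff[of q, OF q_step]

text \<open>The added constant is a multiple of \<open>2 * pi\<close> because \<open>T k\<close>
  maps \<open>P k\<close> to \<open>Q (s k + 1)\<close>; it selects the lift through that pair of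
  points.\<close>

definition tau :: "int \<Rightarrow> real \<Rightarrow> real" where
  "tau k t = mlift (a k) (b k) t + (q (s k + 1) - mlift (a k) (b k) (p k))"

lemma cis_tau: "cis (tau k t) = T k (cis t)"
proof -
  have "cis (q (s k + 1)) = cis (mlift (a k) (b k) (p k))"
    using T_P[of k] by (simp add: cis_q cis_p flip: mob_cis_mlift[OF ab])
  then obtain j :: int where "q (s k + 1) = mlift (a k) (b k) (p k) + 2 * pi * of_int j"
    unfolding cis_eq_iff by blast
  then have "cis (tau k t) = cis (mlift (a k) (b k) t)" unfolding tau_def cis_eq_iff by auto
  then show ?thesis by (simp add: mob_cis_mlift[OF ab])
qed

lemma tau_mono: "strict_mono (tau k)"
  using mlift_strict_mono[OF ab[of k]] by (simp add: strict_mono_def tau_def)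

lemma tau_cont: "continuous_on UNIV (tau k)"
  unfolding tau_def by (intro continuous_intros mlift_continuous[OF ab])

lemma tau_deg: "tau k (t + 2 * pi) = tau k t + 2 * pi"
  by (simp add: tau_def mlift_deg)

lemma tau_p: "tau k (p k) = q (s k + 1)" by (simp add: tau_def)

text \<open>The turn starting at \<open>p k\<close> is mapped to the turn starting at
  \<open>q (s k + 1)\<close>, so a value is determined by its point on the circle.\<close>

lemma tau_value:
  assumes "p k \<le> t" "t < p k + 2 * pi" "cis r = T k (cis t)" "q (s k + 1) \<le> r" "r < q (s k + 1) + 2 * pi"
  shows "tau k t = r"
proof (rule cis_eq_imp_eq)
  show "cis (tau k t) = cis r" using assms(3) by (simp add: cis_tau)
  have "tau k (p k) \<le> tau k t" "tau k t < tau k (p k + 2 * pi)"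
    using assms tau_mono by (simp_all add: strict_mono_less strict_mono_less_eq)
  then show "q (s k + 1) \<le> tau k t" "tau k t < q (s k + 1) + 2 * pi" unfolding tau_deg tau_p .
qed (use assms in auto)

lemma q_next_per: "q (s k + 1) + 2 * pi = q (s k + 1 + n)" by (simp add: q_per)

lemma tau_q: "tau k (q k) = q (s k + 2)"
proof (rule tau_value)
  show "q k < p k + 2 * pi" using q_less_p[of k] p_mono(2)[of "k + 1" "k + n"] n_ge p_per[of k] by linarith
  show "cis (q (s k + 2)) = T k (cis (q k))" by (simp add: cis_q T_Q)
  show "q (s k + 2) < q (s k + 1) + 2 * pi" unfolding q_next_per q_mono using n_ge by simp
qed (use p_less_q[of k] in \<open>simp_all add: q_mono less_imp_le\<close>)

lemma tau_p_next: "tau k (p (k + 1)) = p (s k - 1 + n)"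
proof (rule tau_value)
  show "p (k + 1) < p k + 2 * pi" unfolding p_per[symmetric] p_mono using n_ge by simp
  have "P (s k - 1 + n) = P (s k - 1)" by (rule P_cong) simp
  then show "cis (p (s k - 1 + n)) = T k (cis (p (k + 1)))" by (simp add: cis_p T_P_next)
  show "q (s k + 1) \<le> p (s k - 1 + n)"
    using q_less_p[of "s k + 1"] p_mono(2)[of "s k + 1 + 1" "s k - 1 + n"] n_ge by linarith
  show "p (s k - 1 + n) < q (s k + 1) + 2 * pi"
    unfolding q_next_per using p_less_q[of "s k - 1 + n"] q_mono(2)[of "s k - 1 + n" "s k + 1 + n"] by linarith
qed (simp add: p_mono)

lemma tau_q_next: "tau k (q (k + 1)) = p (s k + n)"
proof (rule tau_value)
  show "p k \<le> q (k + 1)" using p_mono(2)[of k "k + 1"] p_less_q[of "k + 1"] by linarith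
  show "q (k + 1) < p k + 2 * pi"
    unfolding p_per[symmetric] using q_less_p[of "k + 1"] p_mono(2)[of "k + 1 + 1" "k + n"] n_ge by linarith
  have "P (s k + n) = P (s k)" by (rule P_cong) simp
  then show "cis (p (s k + n)) = T k (cis (q (k + 1)))" by (simp add: cis_p cis_q T_Q_next)
  show "q (s k + 1) \<le> p (s k + n)"
    using q_less_p[of "s k + 1"] p_mono(2)[of "s k + 1 + 1" "s k + n"] n_ge by linarith
  show "p (s k + n) < q (s k + 1) + 2 * pi"
    unfolding q_next_per using p_less_q[of "s k + n"] q_mono(2)[of "s k + n" "s k + 1 + n"] by linarith
qed

lemma ab_per: "a (k + n) = a k" "b (k + n) = b k"
  using canon unfolding canonical_polygon_setup_def Let_def n_eq by blast+

lemma tau_per: "tau (k + n) t = tau k t - 4 * pi"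
proof -
  have e: "s (k + n) + 1 + n = s k + 1" by (simp add: pairing_def n_eq)
  have "q (s (k + n) + 1) = q (s k + 1) - 2 * pi" using q_per[of "s (k + n) + 1"] unfolding e by simp
  then show ?thesis by (simp add: tau_def ab_per p_per mlift_deg)
qed

lemma ab_cong: assumes "i mod n = j mod n" shows "a i = a j" "b i = b j"
proof -
  have per: "a (k + m * n) = a k" "b (k + m * n) = b k" for k m
    using quasi_periodic_int[of a n 0 k m] quasi_periodic_int[of b n 0 k m] ab_per by simp_all
  obtain m where m: "i - j = n * m" using assms by (auto simp: mod_eq_dvd_iff elim: dvdE)
  then have "i = j + m * n" by (simp add: algebra_simps)
  then show "a i = a j" "b i = b j" by (simp_all only: per)
qed

lemma pairing_vertex: "s (s (k - 1) - 1) mod n = (s (s k + 1) + 1) mod n"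
proof -
  have "s (s (k - 1) - 1) = s (s k + 1) + 1 + (if odd k then 1 else -1) * n"
    by (auto simp: pairing_def n_eq)
  then show ?thesis by (metis mod_mult_self1)
qed

text \<open>Both products are disk automorphisms and agree at \<open>V k\<close>, \<open>P k\<close>
  and \<open>Q k\<close>, whose images are known explicitly; \<open>pairing_vertex\<close> matches
  the resulting labels modulo \<open>n\<close>.\<close>

lemma T_vertex_cycle:
  assumes "cmod x \<le> 1"
  shows "T (s (k - 1) - 1) (T (k - 1) x) = T (s k + 1) (T k x)"
proof -
  let ?i = "s (k - 1) - 1" and ?j = "s k + 1"
  have sc: "(s ?i + c) mod n = (s ?j + 1 + c) mod n" for c
    using pairing_vertex[of k] by (metis mod_add_left_eq)
  obtain a1 b1 where 1: "disk_aut_params a1 b1" "\<And>z. cmod z \<le> 1 \<Longrightarrow> T ?i (T (k - 1) z) = mob a1 b1 z"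
    using mob_comp[OF ab[of ?i] ab[of "k - 1"]] by blast
  obtain a2 b2 where 2: "disk_aut_params a2 b2" "\<And>z. cmod z \<le> 1 \<Longrightarrow> T ?j (T k z) = mob a2 b2 z"
    using mob_comp[OF ab[of ?j] ab[of k]] by blast
  have "T ?i (T (k - 1) (V k)) = V (s ?i)" using T_V(2)[of "k - 1"] T_V(2)[of ?i] by simp
  also have "\<dots> = V (s ?j + 1)" using V_cong[OF pairing_vertex[of k], of 0] by simp
  finally have v: "T ?i (T (k - 1) (V k)) = T ?j (T k (V k))" by (simp add: T_V)
  have "T ?i (T (k - 1) (P k)) = Q (s ?i + 1)" using T_P_next[of "k - 1"] T_P[of ?i] by simp
  also have "\<dots> = Q (s ?j + 2)" using sc[of 1] by (intro Q_cong) (simp add: add.commute)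
  finally have p: "T ?i (T (k - 1) (P k)) = T ?j (T k (P k))" by (simp add: T_P T_Q)
  have "T ?i (T (k - 1) (Q k)) = P (s ?i - 1)" using T_Q_next[of "k - 1"] T_P_next[of ?i] by simp
  also have "\<dots> = P (s ?j)" using sc[of "- 1"] by (intro P_cong) simp
  finally have q: "T ?i (T (k - 1) (Q k)) = T ?j (T k (Q k))"
    using T_Q[of k] T_Q_next[of ?j] by (simp add: algebra_simps)
  have ne: "V k \<noteq> P k" "V k \<noteq> Q k"
    using V_disk[of k] P_circ[of k] Q_circ[of k] by (auto simp: disk_def circ_def)
  have "P k \<noteq> Q k"
  proof
    assume "P k = Q k"
    then have "p k = q k"
      using p_less_q[of k] q_less_p[of k] p_mono(2)[of "k + 1" "k + n"] n_ge p_per[of k]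
      by (intro cis_eq_imp_eq[of _ _ "p k"]) (simp_all add: cis_p cis_q)
    then show False using p_less_q[of k] by simp
  qed
  moreover have cb: "cmod (V k) \<le> 1" "cmod (P k) \<le> 1" "cmod (Q k) \<le> 1"
    using V_cball circ_cball[OF P_circ] circ_cball[OF Q_circ] by auto
  moreover have "mob a1 b1 (V k) = mob a2 b2 (V k)" "mob a1 b1 (P k) = mob a2 b2 (P k)"
    "mob a1 b1 (Q k) = mob a2 b2 (Q k)"
    using v p q unfolding 1(2)[OF cb(1)] 1(2)[OF cb(2)] 1(2)[OF cb(3)] 2(2)[OF cb(1)] 2(2)[OF cb(2)] 2(2)[OF cb(3)]
    by auto
  ultimately have "mob a1 b1 x = mob a2 b2 x"
    using ne assms by (intro mob_three_points[OF 1(1) 2(1), of "V k" "P k" "Q k" x])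
  then show ?thesis using 1(2) 2(2) assms by simp
qed

lemma tau_comm: "\<exists>c. \<forall>t. tau (s (k - 1) - 1) (tau (k - 1) t) = tau (s k + 1) (tau k t) + 2 * pi * of_int c"
proof (rule lifts_differ_by_const)
  fix t
  have "cmod (cis t) \<le> 1" by simp
  from T_vertex_cycle[OF this, of k]
  show "cis (tau (s (k - 1) - 1) (tau (k - 1) t)) = cis (tau (s k + 1) (tau k t))"
    unfolding cis_tau .
qed (use tau_mono in \<open>auto simp: strict_mono_def tau_deg\<close>)

lemma entropy_boundary_map:
  fixes A :: "int \<Rightarrow> complex"
  assumes A_per: "\<And>k. A (k + n) = A k" and A_arc: "\<And>k. A k \<in> ccw_arc (P k) (Q k)"
  shows "top_entropy (boundary_map a b A) circ
    = ereal (ln (4 * real g - 3 + sqrt ((4 * real g - 3)\<^sup>2 - 1)))"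
proof -
  have pq: "0 < q k - p k" "q k - p k < 2 * pi" for k
    using p_less_q[of k] q_less_p[of k] p_mono(2)[of "k + 1" "k + n"] n_ge p_per[of k] by simp_all
  define al where "al k = p k + ccw_angle (P k) (A k)" for k
  have al: "p k \<le> al k \<and> al k \<le> q k \<and> cis (al k) = A k" for k
  proof -
    have "ccw_angle (P k) (Q k) = q k - p k"
      using ccw_angle_cis[of "q k - p k" "p k"] pq[of k] by (simp add: cis_p cis_q)
    then obtain t where t: "A k = P k * cis t" "0 \<le> t" "t \<le> q k - p k"
      using A_arc[of k] unfolding ccw_arc_def by auto
    have At: "A k = cis (p k + t)" unfolding t(1) cis_p[symmetric] cis_mult ..
    have "ccw_angle (P k) (A k) = t"
      using ccw_angle_cis[of t "p k"] t pq[of k] unfolding At cis_p by simp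
    then show ?thesis using t At by (simp add: al_def)
  qed
  have al_per: "al (k + n) = al k + 2 * pi" for k
  proof -
    have "P (k + n) = P k" by (rule P_cong) simp
    then show ?thesis by (simp add: al_def A_per p_per)
  qed
  have al_step: "al k < al (k + 1)" "al (k + 1) < al k + 2 * pi" for k
    using al[of k] al[of "k + 1"] al[of "k + n"] q_less_p[of k] q_less_p[of "k + 1"]
      p_mono(2)[of "k + 1 + 1" "k + n"] n_ge al_per[of k] by simp_all
  have arc: "cis r \<in> ccw_arc_ho (A k) (A (k + 1)) \<longleftrightarrow> (\<exists>t. al k \<le> t \<and> t < al (k + 1) \<and> cis r = cis t)" for r k
  proof -
    have "ccw_angle (A k) (A (k + 1)) = al (k + 1) - al k"
      using ccw_angle_cis[of "al (k + 1) - al k" "al k"] al_step[of k] al[of k] al[of "k + 1"] by simp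
    moreover have "A k * cis u = cis (al k + u)" for u using al[of k] by (metis cis_mult)
    ultimately have "cis r \<in> ccw_arc_ho (A k) (A (k + 1)) \<longleftrightarrow> (\<exists>u. 0 \<le> u \<and> u < al (k + 1) - al k \<and> cis r = cis (al k + u))"
      unfolding ccw_arc_ho_def by auto
    also have "\<dots> \<longleftrightarrow> (\<exists>t. al k \<le> t \<and> t < al (k + 1) \<and> cis r = cis t)"
    proof
      assume "\<exists>t. al k \<le> t \<and> t < al (k + 1) \<and> cis r = cis t"
      then obtain t where "al k \<le> t" "t < al (k + 1)" "cis r = cis t" by blast
      then show "\<exists>u. 0 \<le> u \<and> u < al (k + 1) - al k \<and> cis r = cis (al k + u)"
        by (intro exI[of _ "t - al k"]) simp
    next
      assume "\<exists>u. 0 \<le> u \<and> u < al (k + 1) - al k \<and> cis r = cis (al k + u)"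
      then obtain u where "0 \<le> u" "u < al (k + 1) - al k" "cis r = cis (al k + u)" by blast
      then show "\<exists>t. al k \<le> t \<and> t < al (k + 1) \<and> cis r = cis t"
        by (intro exI[of _ "al k + u"]) simp
    qed
    finally show ?thesis .
  qed
  have al_per_int: "al (k + j * n) = al k + 2 * pi * of_int j" for j k
    using quasi_periodic_int[of al n "2 * pi" k j, OF al_per] by (simp add: mult.commute)
  have f: "boundary_map a b A (cis r) = cis (tau k r)" if r: "al k \<le> r" "r < al (k + 1)" for k r
  proof -
    \<comment> \<open>The choice operator fixes the label only up to multiples of \<open>n\<close>,
      and these do not affect the branch.\<close>
    define l where "l = (SOME l. cis r \<in> ccw_arc_ho (A l) (A (l + 1)))"
    have "cis r \<in> ccw_arc_ho (A l) (A (l + 1))"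
      unfolding l_def by (rule someI[of _ k]) (use arc r in blast)
    then obtain t where t: "al l \<le> t" "t < al (l + 1)" "cis r = cis t" using arc by blast
    then obtain j where j: "r = t + 2 * pi * of_int j" unfolding cis_eq_iff by blast
    have "al (l + j * n) \<le> r" "r < al (l + 1 + j * n)" unfolding al_per_int j using t by auto
    then have "al (l + j * n) < al (k + 1)" "al k < al (l + j * n + 1)"
      using r by (auto simp: algebra_simps)
    then have "l + j * n = k"
      using step_imp_mono_int_iff(1)[of al, OF al_step(1)] by force
    then have "l mod n = k mod n" by (metis mod_mult_self1)
    then have "T l = T k" using ab_cong by metis
    then show ?thesis unfolding boundary_map_def Let_def l_def[symmetric] by (simp add: cis_tau)
  qed
  have L: "lifted_boundary_map g n p q al tau (boundary_map a b A)"
    by unfold_locales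
      (use g2 n_eq p_less_q q_less_p p_per q_per al al_per tau_mono degree_one_surj[OF tau_deg tau_cont] tau_cont
        tau_deg tau_per tau_p tau_q tau_p_next tau_q_next tau_comm f in \<open>auto simp: fun_eq_iff\<close>)
  show ?thesis using lifted_boundary_map.entropy[OF L] unfolding lifted_boundary_map.lam_def[OF L] .
qed

end

theorem theorem1:
  fixes g :: nat and V a b A :: "int \<Rightarrow> complex"
  assumes "g \<ge> 2"
    and "canonical_polygon_setup g V a b"
    and "\<forall>k. A (k + (8 * int g - 4)) = A k"
    and "\<forall>k. A k \<in> ccw_arc (Pend V k) (Qend V k)"
  shows "top_entropy (boundary_map a b A) circ
           = ereal (ln (4 * real g - 3 + sqrt ((4 * real g - 3)\<^sup>2 - 1)))"
proof -
  interpret canonical g "8 * int g - 4" V a b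
    using assms(1,2) by unfold_locales auto
  show ?thesis
    by (rule entropy_boundary_map) (use assms(3,4) in \<open>simp_all add: P_def Q_def\<close>)
qed

end
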